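(* If a preference relation $\succeq$ on $\tilde V_0$ satisfies Axioms A1-A8, then $\succeq$ is ambiguity averse.
   Context: Setup. $(W,\Sigma')$ is a measurable space (states of the world). $(S,\Sigma,P)$ is a non-atomic probability space, supporting a uniform random variable on $[0,1]$. $\tilde V$ is the space of all bounded $\Sigma'\otimes\Sigma$-measurable $\tilde v:W\times S\to\mathbb{R}$; $\tilde V_0\subset\tilde V$ consists of those taking finitely many values. For $w\in W$, $\tilde v^w:S\to\mathbb{R}$ is $s\mapsto\tilde v(w,s)$, and $F_{\tilde v}(w,t)=P[\tilde v^w\le t]$. $V$ (resp. $V_0$) is the set of $v\in\tilde V$ (resp. $\tilde V_0$) for which $F_v(w,\cdot)$ does not depend on $w$; write $F_v(t)$. $V'$ (resp. $V'_0$) is the set of elements of $\tilde V$ (resp. $\tilde V_0$) not depending on $s\in S$. Real numbers are identified with constant random variables. $\Delta(W,\Sigma')$ is the set of finitely additive measures on $(W,\Sigma')$ with mass one. "Increasing" means strictly increasing. $\tilde v,\tilde u\in\tilde V$ are comonotonic if $(\tilde v^w(s')-\tilde v^w(s))(\tilde u^w(s')-\tilde u^w(s))\ge0$ for all $w\in W$, $s,s'\in S$; "pc" means (pairwise) comonotonic. For a non-decreasing continuous $\psi:[0,1]\to[0,1]$ with $\psi(0)=0,\psi(1)=1$ (a probability weighting function) and $v\in V$, $\int v\,\mathrm{d}\nu_\psi:=\int_{-\infty}^0(\psi(1-F_v(t))-1)\,\mathrm{d}t+\int_0^\infty\psi(1-F_v(t))\,\mathrm{d}t$; for a utility function (increasing,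 continuous) $\phi:\mathbb{R}\to\mathbb{R}$, $\int\phi(\tilde v^{\cdot})\,\mathrm{d}\nu_\psi$ is the function of $w$ obtained by applying this to $s\mapsto\phi(\tilde v^w(s))$ for each $w$. Ambiguity attitudes. $\succeq$ is more ambiguity averse than $\succeq^*$ if, for all $\tilde v\in\tilde V_0$ and $v\in V_0$, $\tilde v\succeq v\Rightarrow\tilde v\succeq^*v$. A relation $\succeq^{\mathrm{AN}}$ on $\tilde V_0$ is ambiguity neutral if there exist a measure $P'\in\Delta(W,\Sigma')$, a utility function $\phi$ and a probability weighting function $\psi$ such that for all $\tilde v,\tilde u\in\tilde V_0$: $\tilde v\succeq^{\mathrm{AN}}\tilde u\iff\mathbb{E}_{P'}[\int\phi(\tilde v^{\cdot})\,\mathrm{d}\nu_\psi]\ge\mathbb{E}_{P'}[\int\phi(\tilde u^{\cdot})\,\mathrm{d}\nu_\psi]$. $\succeq$ is ambiguity averse if it is more ambiguity averse than some ambiguity neutral $\succeq^{\mathrm{AN}}$. Preferences. For a binary relation $\succeq$ on $\tilde V_0$, $\succ$ and $\sim$ are its strict part and indifference. It induces a relation on sections: $\tilde v^w\succeq\tilde u^w$ iff $v\succeq u$ for $v,u\in V_0$ with $F_v=F_{\tilde v}(w,\cdot)$, $F_u=F_{\tilde u}(w,\cdot)$. The certainty equivalent of $\tilde v$ is the $m_{\tilde v}\in\mathbb{R}$ with $m_{\tilde v}\sim\tilde v$. For $A\in\Sigma$, $t,x\in\mathbb{R}$, $tAx:=tI_A+xI_{A^c}\in V_0$. $E\in\Sigma$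 is essential if $t\succ tEx\succ x$ for some $t>x$. For $v,u\in V_0$ and $B\in\Sigma$, $\mathrm{sub}(vBu)(s)=m_{v(s)Bu(s)}$. Axioms. A1: $\succeq$ is complete and transitive on $\tilde V_0$. A2: if $F_{\tilde v}=F_{\tilde u}$ then $\tilde v\sim\tilde u$. A3: if $v,u\in V_0$, $v\succ u$, and $v_n,u_n$ are uniformly bounded sequences in $V_0$ converging in distribution to $v,u$, then from some $n$ onwards $v_n\succ u$ and $v\succ u_n$; moreover for every $\tilde v\in\tilde V_0$ the sets $\{m\in\mathbb{R}:m\succ\tilde v\}$ and $\{m\in\mathbb{R}:\tilde v\succ m\}$ are open. A4: for $v,u\in V_0$, if $F_v(t)\le F_u(t)$ for all $t$ then $v\succeq u$; if in addition the inequality is strict for some $t$ then $v\succ u$. A5: if $\tilde v^w\succeq\tilde u^w$ for every $w\in W$ then $\tilde v\succeq\tilde u$. A6: if $v',u'\in V'_0$, $\alpha\in(0,1)$ and $v'\sim u'$, then $\alpha v'\oplus(1-\alpha)u'\succeq v'$. A7: if $\tilde v,\tilde u\in\tilde V_0$, $r\in V_0$, and $\tilde v,r$ and $\tilde u,r$ are pc, then $\tilde v\succeq\tilde u\Rightarrow\tilde v\oplus r\succeq\tilde u\oplus r$ (whenever both subjective sums exist). A8: for every essential $A\in\Sigma$, every $B\in\Sigma$, and all $v=xAy$, $u=x'Ay'$, $r=x''Ay''$ that are pairwise comonotonic with $x,x'\ge x''$ and $y,y'\ge y''$ (or $x''\ge x,x'$ and $y''\ge y,y'$): $v\succeq u\Rightarrow\mathrm{sub}(vBr)\succeq\mathrm{sub}(uBr)$.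 The operation $\oplus$. Under A1-A4 and A8, $\succeq$ restricted to $V_0$ has a (biseparable) representation $\mathcal{U}:V_0\to\mathbb{R}$ and a function $\rho:[0,1]\to[0,1]$, not identically $0$ or $1$ on $(0,1)$, with $\mathcal{U}(tAx)=\phi(t)\rho(P(A))+\phi(x)(1-\rho(P(A)))$ for all $t\ge x$, $A\in\Sigma$, where $\phi(t)=\mathcal{U}(t)$ is increasing, continuous, and unique up to positive affine transformations. $\alpha\tilde v\oplus(1-\alpha)\tilde u$ is the $\tilde r$ with $\phi(\tilde r)=\alpha\phi(\tilde v)+(1-\alpha)\phi(\tilde u)$ pointwise; $\tilde v\oplus\tilde u$ is the $\tilde r$ (when it exists) with $\tfrac12\phi(\tilde r)+\tfrac12\phi(0)=\tfrac12\phi(\tilde v)+\tfrac12\phi(\tilde u)$ pointwise. *)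

theory Defs
  imports "HOL-Probability.Probability"
begin

text \<open>
  The states of the world are a measurable space \<open>W\<close> (a \<open>measure\<close> of which only \<open>space\<close> and
  \<open>sets\<close> are used) and \<open>P\<close> is the probability space \<open>(S, \<Sigma>, P)\<close>. Elements of the act spaces are
  represented by total functions on \<open>'w \<times> 's\<close>. All definitions inspect only their values on
  \<open>space (W \<Otimes>\<^sub>M P)\<close>, and two representatives that agree there have the same conditional
  distributions, hence are indifferent under axiom A2.
\<close>

type_synonym ('w, 's) act = "'w \<times> 's \<Rightarrow> real"
type_synonym ('w, 's) pref = "('w, 's) act \<Rightarrow> ('w, 's) act \<Rightarrow> bool"


subsection \<open>Probability space and acts\<close>

definition nonatomic :: "'s measure \<Rightarrow> bool" where
  "nonatomic P \<longleftrightarrow> (\<forall>A\<in>sets P. 0 < measure P A \<longrightarrow>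
     (\<exists>B\<in>sets P. B \<subseteq> A \<and> 0 < measure P B \<and> measure P B < measure P A))"

definition supports_uniform :: "'s measure \<Rightarrow> bool" where
  "supports_uniform P \<longleftrightarrow>
     (\<exists>X\<in>borel_measurable P. distr P borel X = uniform_measure lborel {0..1::real})"

definition Vt :: "'w measure \<Rightarrow> 's measure \<Rightarrow> ('w, 's) act set" where
  "Vt W P = {v \<in> borel_measurable (W \<Otimes>\<^sub>M P). bounded (v ` space (W \<Otimes>\<^sub>M P))}"

definition Vt0 :: "'w measure \<Rightarrow> 's measure \<Rightarrow> ('w, 's) act set" where
  "Vt0 W P = {v \<in> Vt W P. finite (v ` space (W \<Otimes>\<^sub>M P))}"

definition cond_cdf :: "'s measure \<Rightarrow> ('w, 's) act \<Rightarrow> 'w \<Rightarrow> real \<Rightarrow> real" where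
  "cond_cdf P v w t = \<P>(s in P. v (w, s) \<le> t)"

definition V0 :: "'w measure \<Rightarrow> 's measure \<Rightarrow> ('w, 's) act set" where
  "V0 W P = {v \<in> Vt0 W P. \<forall>w\<in>space W. \<forall>w'\<in>space W. cond_cdf P v w = cond_cdf P v w'}"

text \<open>\<open>F\<^sub>v\<close> for \<open>v \<in> V\<close>: the conditional distribution function at any state of the world.\<close>

definition act_cdf :: "'w measure \<Rightarrow> 's measure \<Rightarrow> ('w, 's) act \<Rightarrow> real \<Rightarrow> real" where
  "act_cdf W P v = cond_cdf P v (SOME w. w \<in> space W)"

definition V0' :: "'w measure \<Rightarrow> 's measure \<Rightarrow> ('w, 's) act set" where
  "V0' W P = {v \<in> Vt0 W P. \<forall>w\<in>space W. \<forall>s\<in>space P. \<forall>s'\<in>space P. v (w, s) = v (w, s')}"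

definition const_act :: "real \<Rightarrow> ('w, 's) act" where
  "const_act m = (\<lambda>_. m)"

text \<open>The binary act \<open>tAx\<close>.\<close>

definition bin_act :: "'s set \<Rightarrow> real \<Rightarrow> real \<Rightarrow> ('w, 's) act" where
  "bin_act A t x = (\<lambda>(w, s). if s \<in> A then t else x)"

definition comonotonic ::
    "'w measure \<Rightarrow> 's measure \<Rightarrow> ('w, 's) act \<Rightarrow> ('w, 's) act \<Rightarrow> bool" where
  "comonotonic W P v u \<longleftrightarrow> (\<forall>w\<in>space W. \<forall>s\<in>space P. \<forall>s'\<in>space P.
     (v (w, s') - v (w, s)) * (u (w, s') - u (w, s)) \<ge> 0)"


subsection \<open>Preferences\<close>

definition strict_pref :: "('w, 's) pref \<Rightarrow> ('w, 's) pref" where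
  "strict_pref R v u \<longleftrightarrow> R v u \<and> \<not> R u v"

definition indiff :: "('w, 's) pref \<Rightarrow> ('w, 's) pref" where
  "indiff R v u \<longleftrightarrow> R v u \<and> R u v"

text \<open>The induced relation \<open>v\<^sup>w \<succeq> u\<^sup>w\<close> between sections.\<close>

definition section_pref :: "'w measure \<Rightarrow> 's measure \<Rightarrow> ('w, 's) pref \<Rightarrow>
    'w \<Rightarrow> ('w, 's) act \<Rightarrow> ('w, 's) act \<Rightarrow> bool" where
  "section_pref W P R w vt ut \<longleftrightarrow> (\<exists>v\<in>V0 W P. \<exists>u\<in>V0 W P.
     act_cdf W P v = cond_cdf P vt w \<and> act_cdf W P u = cond_cdf P ut w \<and> R v u)"

definition cert_equiv :: "('w, 's) pref \<Rightarrow> ('w, 's) act \<Rightarrow> real" where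
  "cert_equiv R v = (THE m. indiff R (const_act m) v)"

definition essential :: "'s measure \<Rightarrow> ('w, 's) pref \<Rightarrow> 's set \<Rightarrow> bool" where
  "essential P R E \<longleftrightarrow> E \<in> sets P \<and> (\<exists>t x. t > x \<and>
     strict_pref R (const_act t) (bin_act E t x) \<and> strict_pref R (bin_act E t x) (const_act x))"

definition sub_act ::
    "('w, 's) pref \<Rightarrow> ('w, 's) act \<Rightarrow> 's set \<Rightarrow> ('w, 's) act \<Rightarrow> ('w, 's) act" where
  "sub_act R v B u = (\<lambda>\<omega>. cert_equiv R (bin_act B (v \<omega>) (u \<omega>)))"


subsection \<open>Biseparable utility and subjective mixtures\<close>

definition biseparable :: "'w measure \<Rightarrow> 's measure \<Rightarrow> ('w, 's) pref \<Rightarrow>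
    (('w, 's) act \<Rightarrow> real) \<Rightarrow> (real \<Rightarrow> real) \<Rightarrow> (real \<Rightarrow> real) \<Rightarrow> bool" where
  "biseparable W P R U \<rho> \<phi> \<longleftrightarrow>
     (\<forall>v\<in>V0 W P. \<forall>u\<in>V0 W P. R v u \<longleftrightarrow> U v \<ge> U u) \<and>
     \<rho> \<in> {0..1} \<rightarrow> {0..1} \<and>
     \<not> (\<forall>p\<in>{0<..<1}. \<rho> p = 0) \<and> \<not> (\<forall>p\<in>{0<..<1}. \<rho> p = 1) \<and>
     (\<forall>t. \<phi> t = U (const_act t)) \<and> strict_mono \<phi> \<and> continuous_on UNIV \<phi> \<and>
     (\<forall>A\<in>sets P. \<forall>t x. t \<ge> x \<longrightarrow>
        U (bin_act A t x) = \<phi> t * \<rho> (measure P A) + \<phi> x * (1 - \<rho> (measure P A)))"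

text \<open>
  Under axioms A1--A4 and A8 such a \<open>\<phi>\<close> exists and is unique up to positive affine
  transformations. The operations \<open>smix\<close> and \<open>ssum\<close> are invariant under these, so
  the choice made here is immaterial.
\<close>

definition utility :: "'w measure \<Rightarrow> 's measure \<Rightarrow> ('w, 's) pref \<Rightarrow> real \<Rightarrow> real" where
  "utility W P R = (SOME \<phi>. \<exists>U \<rho>. biseparable W P R U \<rho> \<phi>)"

text \<open>\<open>smix \<phi> \<alpha> v u\<close> is \<open>\<alpha> v \<oplus> (1 - \<alpha>) u\<close>, and \<open>ssum \<phi> v u\<close> is \<open>v \<oplus> u\<close>.\<close>

definition smix :: "(real \<Rightarrow> real) \<Rightarrow> real \<Rightarrow> ('w, 's) act \<Rightarrow> ('w, 's) act \<Rightarrow> ('w, 's) act" where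
  "smix \<phi> \<alpha> v u = (\<lambda>\<omega>. THE y. \<phi> y = \<alpha> * \<phi> (v \<omega>) + (1 - \<alpha>) * \<phi> (u \<omega>))"

definition ssum :: "(real \<Rightarrow> real) \<Rightarrow> ('w, 's) act \<Rightarrow> ('w, 's) act \<Rightarrow> ('w, 's) act" where
  "ssum \<phi> v u = (\<lambda>\<omega>. THE y. 1/2 * \<phi> y + 1/2 * \<phi> 0 = 1/2 * \<phi> (v \<omega>) + 1/2 * \<phi> (u \<omega>))"

definition ssum_exists :: "'w measure \<Rightarrow> 's measure \<Rightarrow> (real \<Rightarrow> real) \<Rightarrow>
    ('w, 's) act \<Rightarrow> ('w, 's) act \<Rightarrow> bool" where
  "ssum_exists W P \<phi> v u \<longleftrightarrow> (\<forall>\<omega>\<in>space (W \<Otimes>\<^sub>M P).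
     \<exists>y. 1/2 * \<phi> y + 1/2 * \<phi> 0 = 1/2 * \<phi> (v \<omega>) + 1/2 * \<phi> (u \<omega>))"


subsection \<open>Axioms\<close>

definition A1 :: "'w measure \<Rightarrow> 's measure \<Rightarrow> ('w, 's) pref \<Rightarrow> bool" where
  "A1 W P R \<longleftrightarrow>
     (\<forall>v\<in>Vt0 W P. \<forall>u\<in>Vt0 W P. R v u \<or> R u v) \<and>
     (\<forall>v\<in>Vt0 W P. \<forall>u\<in>Vt0 W P. \<forall>r\<in>Vt0 W P. R v u \<longrightarrow> R u r \<longrightarrow> R v r)"

definition A2 :: "'w measure \<Rightarrow> 's measure \<Rightarrow> ('w, 's) pref \<Rightarrow> bool" where
  "A2 W P R \<longleftrightarrow> (\<forall>v\<in>Vt0 W P. \<forall>u\<in>Vt0 W P.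
     (\<forall>w\<in>space W. \<forall>t. cond_cdf P v w t = cond_cdf P u w t) \<longrightarrow> indiff R v u)"

definition unif_bounded ::
    "'w measure \<Rightarrow> 's measure \<Rightarrow> (nat \<Rightarrow> ('w, 's) act) \<Rightarrow> bool" where
  "unif_bounded W P vs \<longleftrightarrow> (\<exists>K. \<forall>n. \<forall>\<omega>\<in>space (W \<Otimes>\<^sub>M P). \<bar>vs n \<omega>\<bar> \<le> K)"

definition A3 :: "'w measure \<Rightarrow> 's measure \<Rightarrow> ('w, 's) pref \<Rightarrow> bool" where
  "A3 W P R \<longleftrightarrow>
     (\<forall>v\<in>V0 W P. \<forall>u\<in>V0 W P. \<forall>vs us.
        strict_pref R v u \<longrightarrow> range vs \<subseteq> V0 W P \<longrightarrow> range us \<subseteq> V0 W P \<longrightarrow>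
        unif_bounded W P vs \<longrightarrow> unif_bounded W P us \<longrightarrow>
        weak_conv (\<lambda>n. act_cdf W P (vs n)) (act_cdf W P v) \<longrightarrow>
        weak_conv (\<lambda>n. act_cdf W P (us n)) (act_cdf W P u) \<longrightarrow>
        (\<forall>\<^sub>F n in sequentially. strict_pref R (vs n) u \<and> strict_pref R v (us n))) \<and>
     (\<forall>v\<in>Vt0 W P. open {m. strict_pref R (const_act m) v} \<and>
                  open {m. strict_pref R v (const_act m)})"

definition A4 :: "'w measure \<Rightarrow> 's measure \<Rightarrow> ('w, 's) pref \<Rightarrow> bool" where
  "A4 W P R \<longleftrightarrow> (\<forall>v\<in>V0 W P. \<forall>u\<in>V0 W P.
     (\<forall>t. act_cdf W P v t \<le> act_cdf W P u t) \<longrightarrow>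
     R v u \<and> ((\<exists>t. act_cdf W P v t < act_cdf W P u t) \<longrightarrow> strict_pref R v u))"

definition A5 :: "'w measure \<Rightarrow> 's measure \<Rightarrow> ('w, 's) pref \<Rightarrow> bool" where
  "A5 W P R \<longleftrightarrow> (\<forall>v\<in>Vt0 W P. \<forall>u\<in>Vt0 W P.
     (\<forall>w\<in>space W. section_pref W P R w v u) \<longrightarrow> R v u)"

definition A6 :: "'w measure \<Rightarrow> 's measure \<Rightarrow> ('w, 's) pref \<Rightarrow> bool" where
  "A6 W P R \<longleftrightarrow> (\<forall>v\<in>V0' W P. \<forall>u\<in>V0' W P. \<forall>\<alpha>\<in>{0<..<1}.
     indiff R v u \<longrightarrow> R (smix (utility W P R) \<alpha> v u) v)"

definition A7 :: "'w measure \<Rightarrow> 's measure \<Rightarrow> ('w, 's) pref \<Rightarrow> bool" where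
  "A7 W P R \<longleftrightarrow> (\<forall>v\<in>Vt0 W P. \<forall>u\<in>Vt0 W P. \<forall>r\<in>V0 W P.
     comonotonic W P v r \<longrightarrow> comonotonic W P u r \<longrightarrow>
     ssum_exists W P (utility W P R) v r \<longrightarrow> ssum_exists W P (utility W P R) u r \<longrightarrow>
     R v u \<longrightarrow> R (ssum (utility W P R) v r) (ssum (utility W P R) u r))"

definition A8 :: "'w measure \<Rightarrow> 's measure \<Rightarrow> ('w, 's) pref \<Rightarrow> bool" where
  "A8 W P R \<longleftrightarrow> (\<forall>A B x y x' y' x'' y''.
     essential P R A \<longrightarrow> B \<in> sets P \<longrightarrow>
     (let v = bin_act A x y; u = bin_act A x' y'; r = bin_act A x'' y'' in
        comonotonic W P v u \<longrightarrow> comonotonic W P v r \<longrightarrow> comonotonic W P u r \<longrightarrow>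
        (x \<ge> x'' \<and> x' \<ge> x'' \<and> y \<ge> y'' \<and> y' \<ge> y'') \<or>
        (x'' \<ge> x \<and> x'' \<ge> x' \<and> y'' \<ge> y \<and> y'' \<ge> y') \<longrightarrow>
        R v u \<longrightarrow> R (sub_act R v B r) (sub_act R u B r)))"


subsection \<open>Ambiguity attitudes\<close>

definition weighting_function :: "(real \<Rightarrow> real) \<Rightarrow> bool" where
  "weighting_function \<psi> \<longleftrightarrow> \<psi> \<in> {0..1} \<rightarrow> {0..1} \<and> mono_on {0..1} \<psi> \<and>
     continuous_on {0..1} \<psi> \<and> \<psi> 0 = 0 \<and> \<psi> 1 = 1"

definition utility_function :: "(real \<Rightarrow> real) \<Rightarrow> bool" where
  "utility_function \<phi> \<longleftrightarrow> strict_mono \<phi> \<and> continuous_on UNIV \<phi>"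

definition rd_integral :: "'s measure \<Rightarrow> (real \<Rightarrow> real) \<Rightarrow> ('s \<Rightarrow> real) \<Rightarrow> real" where
  "rd_integral P \<psi> f =
     (LBINT t:{..0}. (\<psi> (1 - \<P>(s in P. f s \<le> t)) - 1)) +
     (LBINT t:{0..}. \<psi> (1 - \<P>(s in P. f s \<le> t)))"

definition fa_probs :: "'w measure \<Rightarrow> ('w set \<Rightarrow> real) set" where
  "fa_probs W = {\<mu>. (\<forall>A\<in>sets W. 0 \<le> \<mu> A) \<and> additive (sets W) \<mu> \<and> \<mu> (space W) = 1}"

text \<open>
  Expectation under a finitely additive probability. For bounded measurable \<open>f\<close> this supremum
  equals the infimum over simple functions above \<open>f\<close>.
\<close>

definition fa_expectation :: "'w measure \<Rightarrow> ('w set \<Rightarrow> real) \<Rightarrow> ('w \<Rightarrow> real) \<Rightarrow> real" where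
  "fa_expectation W \<mu> f =
     (SUP g\<in>{g. simple_function W g \<and> (\<forall>w\<in>space W. g w \<le> f w)}.
        \<Sum>y\<in>g ` space W. y * \<mu> (g -` {y} \<inter> space W))"

definition more_ambiguity_averse ::
    "'w measure \<Rightarrow> 's measure \<Rightarrow> ('w, 's) pref \<Rightarrow> ('w, 's) pref \<Rightarrow> bool" where
  "more_ambiguity_averse W P R R' \<longleftrightarrow> (\<forall>vt\<in>Vt0 W P. \<forall>v\<in>V0 W P. R vt v \<longrightarrow> R' vt v)"

definition ambiguity_neutral :: "'w measure \<Rightarrow> 's measure \<Rightarrow> ('w, 's) pref \<Rightarrow> bool" where
  "ambiguity_neutral W P R \<longleftrightarrow>
     (\<exists>\<mu>\<in>fa_probs W. \<exists>\<phi> \<psi>. utility_function \<phi> \<and> weighting_function \<psi> \<and>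
       (\<forall>v\<in>Vt0 W P. \<forall>u\<in>Vt0 W P. R v u \<longleftrightarrow>
          fa_expectation W \<mu> (\<lambda>w. rd_integral P \<psi> (\<lambda>s. \<phi> (v (w, s)))) \<ge>
          fa_expectation W \<mu> (\<lambda>w. rd_integral P \<psi> (\<lambda>s. \<phi> (u (w, s))))))"

definition ambiguity_averse :: "'w measure \<Rightarrow> 's measure \<Rightarrow> ('w, 's) pref \<Rightarrow> bool" where
  "ambiguity_averse W P R \<longleftrightarrow>
     (\<exists>R'. ambiguity_neutral W P R' \<and> more_ambiguity_averse W P R R')"

end

theory Submission
  imports Defs
begin

text \<open>
  On acts with objective distributions, A8 makes the certainty equivalents of binary acts a family
  of means that commute with each other on rank-ordered arguments. Composing one of these means
  with itself gives an expression in four outcomes that is symmetric in the two middle ones; this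
  defines a bisymmetric midpoint operation on outcomes, whose additive representation is the
  utility of a biseparable representation. Comonotonic independence (A7) then peels off the levels
  of a simple random variable one at a time and identifies the certainty equivalent with the
  rank-dependent utility.

  For acts that depend on the state of the world only, measured in utils, call a simple function
  acceptable if its small positive multiples are weakly preferred to 0. By A7 (translations) and
  A6 the acceptable functions form a convex cone, and the excess of any function over its
  certainty equivalent is acceptable. A positive normalised linear functional that is nonnegative
  on this cone is the expectation under the required finitely additive prior. A general act is
  compared, statewise by A5, with simple functions slightly above its conditional rank-dependent
  utility.
\<close>

subsection \<open>Bisymmetric midpoints on an interval\<close>

text \<open>A8 controls mixtures only for rank-ordered outcomes, so the classical theory of
  bisymmetric means does not apply to certainty equivalents directly. Freezing a best outcome
  \<open>a\<close> and a worst outcome \<open>d\<close> removes the restriction: the two outcomes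
  between them may come in either order. The price is that utility is first found on compact
  intervals; normalised representations are unique there, which allows gluing.

  Utility may be bounded, so sums of utils need not be utils. This dictates that levels are peeled
  towards 0 and that acceptability looks at small multiples. Moreover A6 concerns indifferent acts
  only, so functions have to be translated to equal certainty equivalents before they can be mixed.

  The conditional rank-dependent utility of an act with finitely many values can take infinitely
  many values as the state varies, so it need not be the utility profile of any act in
  \<open>Vt0\<close>. Approximation from above is chosen because the preference passes to better
  acts, while the expectation is a supremum over simple functions below; an arbitrarily small
  constant bridges the two.\<close>

locale midpoint_interval =
  fixes lo hi :: real and m :: "real \<Rightarrow> real \<Rightarrow> real"
  assumes lo_less_hi: "lo < hi"
    and m_in: "\<lbrakk>x \<in> {lo..hi}; y \<in> {lo..hi}\<rbrakk> \<Longrightarrow> m x y \<in> {lo..hi}"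
    and m_idem: "x \<in> {lo..hi} \<Longrightarrow> m x x = x"
    and m_commute: "\<lbrakk>x \<in> {lo..hi}; y \<in> {lo..hi}\<rbrakk> \<Longrightarrow> m x y = m y x"
    and m_less: "\<lbrakk>x \<in> {lo..hi}; y \<in> {lo..hi}; z \<in> {lo..hi}; x < y\<rbrakk> \<Longrightarrow> m z x < m z y"
    and m_bisym: "\<lbrakk>x \<in> {lo..hi}; y \<in> {lo..hi}; z \<in> {lo..hi}; w \<in> {lo..hi}\<rbrakk>
      \<Longrightarrow> m (m x y) (m z w) = m (m x z) (m y w)"
    and m_split: "x \<in> {lo..hi} \<Longrightarrow> \<exists>y\<in>{lo..hi}. x = m lo y \<or> x = m hi y"
    and m_above: "\<lbrakk>x \<in> {lo..hi}; x < s; s < hi\<rbrakk> \<Longrightarrow> \<exists>t\<in>{lo..hi}. s < t \<and> m x t < s"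
    and m_below: "\<lbrakk>x \<in> {lo..hi}; s < x; lo < s\<rbrakk> \<Longrightarrow> \<exists>t\<in>{lo..hi}. t < s \<and> s < m x t"
begin

abbreviation I :: "real set" where "I \<equiv> {lo..hi}"

lemma lo_hi_in [simp]: "lo \<in> I" "hi \<in> I" "lo \<le> hi"
  using lo_less_hi by auto

lemma m_less_iff: "\<lbrakk>x \<in> I; y \<in> I; z \<in> I\<rbrakk> \<Longrightarrow> m z x < m z y \<longleftrightarrow> x < y"
  using m_less by (metis linorder_less_linear order_less_asym)

lemma m_eq_iff: "\<lbrakk>x \<in> I; y \<in> I; z \<in> I\<rbrakk> \<Longrightarrow> m z x = m z y \<longleftrightarrow> x = y"
  using m_less_iff by (metis linorder_less_linear less_irrefl)

text \<open>Every point is the midpoint of some point and an end of the interval, so an error that at least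
  halves under both midpoint maps vanishes.\<close>
lemma halving:
  assumes "\<And>x. x \<in> I \<Longrightarrow> \<bar>e x\<bar> \<le> (K::real)"
    and "\<And>x. x \<in> I \<Longrightarrow> \<bar>e (m lo x)\<bar> \<le> \<bar>e x\<bar> / 2" "\<And>x. x \<in> I \<Longrightarrow> \<bar>e (m hi x)\<bar> \<le> \<bar>e x\<bar> / 2"
    and "x \<in> I"
  shows "e x = 0"
proof -
  have "\<bar>e x\<bar> \<le> K / 2 ^ n" if "x \<in> I" for n x
    using that
  proof (induction n arbitrary: x)
    case 0
    then show ?case using assms(1) by simp
  next
    case (Suc n)
    obtain y where y: "y \<in> I" "x = m lo y \<or> x = m hi y" using m_split Suc.prems by blast
    have "\<bar>e x\<bar> \<le> \<bar>e y\<bar> / 2" using y assms(2,3) by auto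
    with Suc.IH[OF y(1)] show ?case by simp
  qed
  then have *: "\<bar>e x\<bar> \<le> K / 2 ^ n" for n using assms(4) .
  have "(\<lambda>n. K / 2 ^ n) \<longlonglongrightarrow> 0" by (rule LIMSEQ_divide_realpow_zero) simp
  then have "\<bar>e x\<bar> \<le> 0" by (rule LIMSEQ_le_const) (use * in auto)
  then show ?thesis by simp
qed

text \<open>The representation assigns to a point its binary expansion: the digit tells the half of the
  interval containing it, and the shift expands that half to the whole interval.\<close>
definition h :: real where "h = m lo hi"

definition digit :: "real \<Rightarrow> real" where "digit x = (if x \<le> h then 0 else 1)"

definition shift :: "real \<Rightarrow> real" where
  "shift x = (SOME y. y \<in> I \<and> x = m (if x \<le> h then lo else hi) y)"

definition \<Phi> :: "real \<Rightarrow> real" where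
  "\<Phi> x = (\<Sum>n. digit ((shift ^^ n) x) * (1/2) ^ Suc n)"

lemma m_lo_le_h: "x \<in> I \<Longrightarrow> m lo x \<le> h"
  unfolding h_def using m_less_iff[of hi x lo] by fastforce

lemma m_hi_ge_h: "x \<in> I \<Longrightarrow> h \<le> m hi x"
  unfolding h_def using m_less_iff[of x lo hi] m_commute[of lo hi] by fastforce

lemma shift: 
  assumes "x \<in> I" shows "shift x \<in> I \<and> x = m (if x \<le> h then lo else hi) (shift x)"
  unfolding shift_def
proof (rule someI_ex)
  obtain y where y: "y \<in> I" "x = m lo y \<or> x = m hi y" using m_split assms by blast
  show "\<exists>y. y \<in> I \<and> x = m (if x \<le> h then lo else hi) y"
  proof (cases "x \<le> h")
    case True
    show ?thesis
    proof (cases "x = m lo y")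
      case False
      \<comment> \<open>The halves meet only in \<open>h\<close>, which counts as lower. Here it
        arises as a midpoint with \<open>hi\<close>, but it is also \<open>m lo hi\<close>, so
        \<open>hi\<close> serves as the shifted point.\<close>
      then have "x = h" using True m_hi_ge_h[OF y(1)] y(2) by simp
      then show ?thesis by (intro exI[of _ hi]) (simp add: h_def)
    qed (use True y in auto)
  next
    case False
    then show ?thesis using y m_lo_le_h by auto
  qed
qed

lemma \<Phi>_summable: "summable (\<lambda>n. digit ((shift ^^ n) x) * (1/2) ^ Suc n)"
  by (rule summable_comparison_test'[OF sums_summable[OF power_half_series], of 0])
     (auto simp: digit_def)

lemma \<Phi>_bounds: "0 \<le> \<Phi> x" "\<Phi> x \<le> 1"
proof -
  show "0 \<le> \<Phi> x" unfolding \<Phi>_def by (rule suminf_nonneg[OF \<Phi>_summable]) (simp add: digit_def)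
  have "\<Phi> x \<le> (\<Sum>n. (1/2) ^ Suc n)" unfolding \<Phi>_def
    by (rule suminf_le[OF _ \<Phi>_summable]) (use power_half_series sums_summable in \<open>auto simp: digit_def\<close>)
  then show "\<Phi> x \<le> 1" using power_half_series by (simp add: sums_iff)
qed

lemma \<Phi>_unfold: "\<Phi> x = (digit x + \<Phi> (shift x)) / 2"
proof -
  have "\<Phi> x = digit x / 2 + (\<Sum>n. digit ((shift ^^ Suc n) x) * (1/2) ^ Suc (Suc n))"
    unfolding \<Phi>_def by (subst suminf_split_head[OF \<Phi>_summable]) simp
  also have "(\<Sum>n. digit ((shift ^^ Suc n) x) * (1/2) ^ Suc (Suc n)) = \<Phi> (shift x) * (1/2)"
    unfolding \<Phi>_def by (subst suminf_mult2[OF \<Phi>_summable]) (simp add: funpow_swap1 algebra_simps)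
  finally show ?thesis by (simp add: field_simps)
qed

lemma \<Phi>_m_lo: assumes "x \<in> I" shows "\<Phi> (m lo x) = \<Phi> x / 2"
proof -
  have "shift (m lo x) = x"
    using shift[of "m lo x"] m_lo_le_h[OF assms] m_in[of lo x] assms m_eq_iff[of _ _ lo] by auto
  then show ?thesis using \<Phi>_unfold[of "m lo x"] m_lo_le_h[OF assms] by (simp add: digit_def)
qed

lemma \<Phi>_lo: "\<Phi> lo = 0"
  using \<Phi>_m_lo[of lo] m_idem[of lo] by auto

lemma \<Phi>_hi: "\<Phi> hi = 1"
proof -
  have "h < hi" using m_less[of lo hi hi] m_idem[of hi] m_commute[of lo hi] lo_less_hi h_def by auto
  moreover have "shift hi = hi"
    using shift[of hi] \<open>h < hi\<close> m_idem[of hi] m_eq_iff[of "shift hi" hi hi] by auto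
  ultimately show ?thesis using \<Phi>_unfold[of hi] by (simp add: digit_def)
qed

lemma \<Phi>_m_hi: assumes "x \<in> I" shows "\<Phi> (m hi x) = (1 + \<Phi> x) / 2"
proof (cases "m hi x = h")
  \<comment> \<open>\<open>h\<close> has digit 0, so it is expanded as 0.0111... and not as
    0.1000...; the equation survives because \<open>h = m hi lo\<close> forces \<open>x = lo\<close>
    and both expansions have the value 1/2.\<close>
  case True
  then have "x = lo" using m_eq_iff[of x lo hi] m_commute[of hi lo] h_def assms by auto
  then show ?thesis using True \<Phi>_lo \<Phi>_hi \<Phi>_m_lo[of hi] by (simp add: h_def)
next
  case False
  then have "h < m hi x" using m_hi_ge_h[OF assms] by simp
  moreover have "shift (m hi x) = x"
    using shift[of "m hi x"] \<open>h < m hi x\<close> m_in[of hi x] assms m_eq_iff[of _ _ hi] by auto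
  ultimately show ?thesis using \<Phi>_unfold[of "m hi x"] by (simp add: digit_def)
qed

text \<open>Bisymmetry rewrites \<open>m h (m lo y)\<close> as \<open>m lo (m hi y)\<close> and
  \<open>m h (m hi y)\<close> as \<open>m hi (m lo y)\<close>, so the centre is handled by the rules
  for the two ends. It occurs when two points lie in different halves.\<close>

lemma \<Phi>_m_h: assumes "z \<in> I" shows "\<Phi> (m h z) = \<Phi> z / 2 + 1/4"
proof -
  obtain y where y: "y \<in> I" "z = m lo y \<or> z = m hi y" using m_split assms by blast
  have "m (m lo hi) (m lo y) = m lo (m hi y)"
    using m_bisym[of lo hi lo y] y m_idem[of lo] by auto
  moreover have "m (m lo hi) (m hi y) = m hi (m lo y)"
    using m_bisym[of hi lo hi y] y m_idem[of hi] m_commute[of lo hi] by auto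
  ultimately show ?thesis
    using y m_in[of hi y] m_in[of lo y] by (auto simp: h_def \<Phi>_m_lo \<Phi>_m_hi add_divide_distrib)
qed

text \<open>For ends \<open>s\<close> and \<open>t\<close>, bisymmetry gives
  \<open>m (m s x') (m t y') = m (m s t) (m x' y')\<close>, where \<open>m s t\<close> is
  \<open>lo\<close>, \<open>h\<close> or \<open>hi\<close>. So the defect of the midpoint equation
  at \<open>x\<close>, \<open>y\<close> is half the defect at \<open>x'\<close>, \<open>y'\<close>,
  and being bounded it vanishes.\<close>

lemma \<Phi>_m:
  assumes "x \<in> I" "y \<in> I" shows "\<Phi> (m x y) = (\<Phi> x + \<Phi> y) / 2"
proof -
  define d where "d x y = \<Phi> (m x y) - (\<Phi> x + \<Phi> y) / 2" for x y
  have "\<bar>d x y\<bar> \<le> 1 / 2 ^ n" if "x \<in> I" "y \<in> I" for n x y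
    using that
  proof (induction n arbitrary: x y)
    case 0
    show ?case unfolding d_def abs_le_iff
      using \<Phi>_bounds[of "m x y"] \<Phi>_bounds[of x] \<Phi>_bounds[of y] by (simp add: field_simps)
  next
    case (Suc n)
    obtain x' where x': "x' \<in> I" "x = m lo x' \<or> x = m hi x'" using m_split Suc.prems by blast
    obtain y' where y': "y' \<in> I" "y = m lo y' \<or> y = m hi y'" using m_split Suc.prems by blast
    have z: "m x' y' \<in> I" using m_in x' y' by blast
    have 1: "m (m lo x') (m lo y') = m lo (m x' y')"
      using m_bisym[of lo x' lo y'] x'(1) y'(1) m_idem[of lo] by auto
    have 2: "m (m hi x') (m hi y') = m hi (m x' y')"
      using m_bisym[of hi x' hi y'] x'(1) y'(1) m_idem[of hi] by auto
    have 3: "m (m lo x') (m hi y') = m h (m x' y')"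
      using m_bisym[of lo x' hi y'] x'(1) y'(1) h_def by auto
    have 4: "m (m hi x') (m lo y') = m h (m x' y')"
      using m_bisym[of hi x' lo y'] x'(1) y'(1) h_def m_commute[of lo hi] by auto
    have "d x y = d x' y' / 2"
      using x' y' z by (auto simp: d_def 1 2 3 4 \<Phi>_m_lo \<Phi>_m_hi \<Phi>_m_h field_simps)
    with Suc.IH[OF x'(1) y'(1)] show ?case by simp
  qed
  then have *: "\<bar>d x y\<bar> \<le> 1 / 2 ^ n" for n using assms .
  have "(\<lambda>n. 1 / 2 ^ n :: real) \<longlonglongrightarrow> 0" by (rule LIMSEQ_divide_realpow_zero) simp
  then have "\<bar>d x y\<bar> \<le> 0" by (rule LIMSEQ_le_const) (use * in auto)
  then show ?thesis by (simp add: d_def)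
qed

section \<open>Order and continuity of the binary expansion\<close>

lemma \<Phi>_mono: assumes "x \<in> I" "y \<in> I" "x \<le> y" shows "\<Phi> x \<le> \<Phi> y"
proof -
  have "\<Phi> x - \<Phi> y \<le> 1 / 2 ^ n" if "x \<in> I" "y \<in> I" "x \<le> y" for n x y
    using that
  proof (induction n arbitrary: x y)
    case 0
    show ?case using \<Phi>_bounds[of x] \<Phi>_bounds[of y] by simp
  next
    case (Suc n)
    obtain x' where x': "x' \<in> I" "x = m lo x' \<or> x = m hi x'" using m_split Suc.prems by blast
    obtain y' where y': "y' \<in> I" "y = m lo y' \<or> y = m hi y'" using m_split Suc.prems by blast
    consider "x = m lo x'" "y = m hi y'" | "x = m lo x'" "y = m lo y'" | "x = m hi x'" "y = m hi y'"
      | "x = m hi x'" "y = m lo y'" using x' y' by blast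
    then show ?case
    proof cases
      case 1
      have "\<Phi> x \<le> 1/2" "\<Phi> y \<ge> 1/2"
        using 1 x' y' \<Phi>_bounds[of x'] \<Phi>_bounds[of y'] by (auto simp: \<Phi>_m_lo \<Phi>_m_hi)
      then have "\<Phi> x - \<Phi> y \<le> 0" by linarith
      moreover have "0 \<le> 1 / (2::real) ^ Suc n" by simp
      ultimately show ?thesis by (rule order_trans)
    next
      case 2
      then have "x' \<le> y'" using Suc.prems m_less_iff[of y' x' lo] x' y' by force
      then show ?thesis using Suc.IH[OF x'(1) y'(1)] 2 x' y' by (simp add: \<Phi>_m_lo)
    next
      case 3
      then have "x' \<le> y'" using Suc.prems m_less_iff[of y' x' hi] x' y' by force
      then show ?thesis using Suc.IH[OF x'(1) y'(1)] 3 x' y' by (simp add: \<Phi>_m_hi field_simps)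
    next
      case 4
      then have "x = y" using Suc.prems m_lo_le_h[OF y'(1)] m_hi_ge_h[OF x'(1)] by simp
      then show ?thesis by simp
    qed
  qed
  then have *: "\<Phi> x - \<Phi> y \<le> 1 / 2 ^ n" for n using assms .
  have "(\<lambda>n. 1 / 2 ^ n :: real) \<longlonglongrightarrow> 0" by (rule LIMSEQ_divide_realpow_zero) simp
  then have "\<Phi> x - \<Phi> y \<le> 0" by (rule LIMSEQ_le_const) (use * in auto)
  then show ?thesis by simp
qed

lemma m_between: assumes "x \<in> I" "y \<in> I" "x < y" shows "x < m x y" "m x y < y"
  using m_less[of x y x] m_less[of x y y] m_idem[of x] m_idem[of y] m_commute[of x y] assms by auto

text \<open>A level set \<open>F\<close> with two points would swallow everything: by the midpoint
  equation, \<open>u\<close> and \<open>m u t\<close> in \<open>F\<close> force \<open>t\<close>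
  into \<open>F\<close>. If \<open>Sup F < hi\<close>, then \<open>m_above\<close> supplies a point
  beyond \<open>Sup F\<close> whose midpoint with \<open>x\<close> still lies in \<open>F\<close>.
  So \<open>F\<close> reaches \<open>hi\<close>, and likewise \<open>lo\<close>, where
  \<open>\<Phi>\<close> has another value.\<close>

lemma \<Phi>_strict_mono: assumes "x \<in> I" "y \<in> I" "x < y" shows "\<Phi> x < \<Phi> y"
proof (rule ccontr)
  assume "\<not> \<Phi> x < \<Phi> y"
  then have eq: "\<Phi> y = \<Phi> x" using \<Phi>_mono[of x y] assms by auto
  define F where "F = {t \<in> I. \<Phi> t = \<Phi> x}"
  have F: "x \<in> F" "y \<in> F" using eq assms by (auto simp: F_def)
  have bdd: "bdd_above F" "bdd_below F" by (auto simp: F_def bdd_above_def bdd_below_def)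
  have conv: "t \<in> F" if "u \<in> F" "v \<in> F" "u \<le> t" "t \<le> v" for u v t
    using that \<Phi>_mono[of u t] \<Phi>_mono[of t v] by (auto simp: F_def)
  have flat: "t \<in> F" if "u \<in> F" "t \<in> I" "m u t \<in> F" for u t
    using that \<Phi>_m[of u t] by (auto simp: F_def)
  have up: "\<exists>v\<in>F. t < v" if "t < Sup F" for t using that less_cSup_iff[of F t] F bdd by blast
  have dn: "\<exists>v\<in>F. v < t" if "Inf F < t" for t using that cInf_less_iff[of F t] F bdd by blast
  have SI: "y \<le> Sup F" "Inf F \<le> x" using F bdd cSup_upper cInf_lower by blast+
  have SIin: "Sup F \<le> hi" "lo \<le> Inf F"
    using F by (auto intro!: cSup_least cInf_greatest simp: F_def)
  have "hi \<in> F"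
  proof (cases "Sup F = hi")
    case True
    have "x < m x hi" "m x hi < hi" using m_between[of x hi] assms by auto
    then obtain v where "v \<in> F" "m x hi < v" using up True by auto
    then have "m x hi \<in> F" using conv[of x v "m x hi"] F \<open>x < m x hi\<close> by auto
    then show ?thesis using flat[of x hi] F(1) by simp
  next
    case False
    then obtain t where t: "t \<in> I" "Sup F < t" "m x t < Sup F"
      using m_above[of x "Sup F"] SI SIin assms by auto
    then have "x < m x t" using m_between[of x t] assms SI by auto
    obtain v where "v \<in> F" "m x t < v" using up t by auto
    then have "m x t \<in> F" using conv[of x v "m x t"] F \<open>x < m x t\<close> by auto
    then have "t \<in> F" using flat[of x t] F(1) t(1) by blast
    then show ?thesis using cSup_upper[of t F] bdd t by auto
  qed
  moreover have "lo \<in> F"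
  proof (cases "Inf F = lo")
    case True
    have "lo < m hi lo" "m hi lo < hi" using m_between[of lo hi] m_commute[of lo hi] lo_less_hi by auto
    then obtain v where "v \<in> F" "v < m hi lo" using dn True by auto
    then have "m hi lo \<in> F" using conv[of v hi "m hi lo"] \<open>hi \<in> F\<close> \<open>m hi lo < hi\<close> by auto
    then show ?thesis using flat[of hi lo] \<open>hi \<in> F\<close> by simp
  next
    case False
    then obtain t where t: "t \<in> I" "t < Inf F" "Inf F < m hi t"
      using m_below[of hi "Inf F"] SI SIin assms by auto
    then have "m hi t < hi" using m_between[of t hi] m_commute[of t hi] assms SI by auto
    obtain v where "v \<in> F" "v < m hi t" using dn t by auto
    then have "m hi t \<in> F" using conv[of v hi "m hi t"] \<open>hi \<in> F\<close> \<open>m hi t < hi\<close> by auto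
    then have "t \<in> F" using flat[of hi t] \<open>hi \<in> F\<close> t(1) by blast
    then show ?thesis using cInf_lower[of t F] bdd t by auto
  qed
  ultimately show False using \<Phi>_lo \<Phi>_hi by (simp add: F_def)
qed

text \<open>Taking the midpoint with \<open>x\<close> again and again keeps \<open>t\<close> on its
  side of \<open>x\<close> and halves the difference of the values, which rules out jumps.\<close>

lemma \<Phi>_less_near:
  assumes "x \<in> I" "\<epsilon> > 0" shows "x < hi \<Longrightarrow> \<exists>t\<in>I. x < t \<and> \<Phi> t < \<Phi> x + \<epsilon>"
    and "lo < x \<Longrightarrow> \<exists>t\<in>I. t < x \<and> \<Phi> x - \<epsilon> < \<Phi> t"
proof -
  show "\<exists>t\<in>I. x < t \<and> \<Phi> t < \<Phi> x + \<epsilon>" if "x < hi"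
  proof -
    have "\<exists>t\<in>I. x < t \<and> \<Phi> t \<le> \<Phi> x + 1 / 2 ^ n" for n
    proof (induction n)
      case 0
      show ?case using that \<Phi>_hi \<Phi>_bounds[of x] by (intro bexI[of _ hi]) auto
    next
      case (Suc n)
      then obtain t where "t \<in> I" "x < t" "\<Phi> t \<le> \<Phi> x + 1 / 2 ^ n" by blast
      then show ?case using m_between[of x t] m_in[of x t] \<Phi>_m[of x t] assms
        by (intro bexI[of _ "m x t"]) auto
    qed
    moreover obtain n where "1 / 2 ^ n < \<epsilon>"
      using real_arch_pow_inv[of \<epsilon> "1/2"] assms by (auto simp: power_one_over)
    ultimately show ?thesis by (meson add_strict_left_mono le_less_trans)
  qed
  show "\<exists>t\<in>I. t < x \<and> \<Phi> x - \<epsilon> < \<Phi> t" if "lo < x"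
  proof -
    have "\<exists>t\<in>I. t < x \<and> \<Phi> x - 1 / 2 ^ n \<le> \<Phi> t" for n
    proof (induction n)
      case 0
      show ?case using that \<Phi>_lo \<Phi>_bounds[of x] by (intro bexI[of _ lo]) auto
    next
      case (Suc n)
      then obtain t where "t \<in> I" "t < x" "\<Phi> x - 1 / 2 ^ n \<le> \<Phi> t" by blast
      then show ?case using m_between[of t x] m_in[of t x] \<Phi>_m[of t x] assms
        by (intro bexI[of _ "m t x"]) auto
    qed
    moreover obtain n where "1 / 2 ^ n < \<epsilon>"
      using real_arch_pow_inv[of \<epsilon> "1/2"] assms by (auto simp: power_one_over)
    ultimately show ?thesis by (meson diff_strict_left_mono less_le_trans)
  qed
qed

lemma \<Phi>_continuous: "continuous_on I \<Phi>"
  unfolding continuous_on_iff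
proof (intro ballI allI impI)
  fix x \<epsilon> :: real assume x: "x \<in> I" "0 < \<epsilon>"
  obtain u where u: "x < u" "\<And>y. \<lbrakk>y \<in> I; y < u\<rbrakk> \<Longrightarrow> \<Phi> y < \<Phi> x + \<epsilon>"
  proof (cases "x < hi")
    case True
    then obtain t where "t \<in> I" "x < t" "\<Phi> t < \<Phi> x + \<epsilon>" using \<Phi>_less_near(1) x by blast
    then show ?thesis using that[of t] \<Phi>_strict_mono less_trans by blast
  next
    case False
    then have "\<Phi> y < \<Phi> x + \<epsilon>" if "y \<in> I" for y using \<Phi>_mono[of y x] that x by fastforce
    then show ?thesis using that[of "x + 1"] by auto
  qed
  obtain l where l: "l < x" "\<And>y. \<lbrakk>y \<in> I; l < y\<rbrakk> \<Longrightarrow> \<Phi> x - \<epsilon> < \<Phi> y"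
  proof (cases "lo < x")
    case True
    then obtain t where "t \<in> I" "t < x" "\<Phi> x - \<epsilon> < \<Phi> t" using \<Phi>_less_near(2) x by blast
    then show ?thesis using that[of t] \<Phi>_strict_mono less_trans by blast
  next
    case False
    then have "\<Phi> x - \<epsilon> < \<Phi> y" if "y \<in> I" for y using \<Phi>_mono[of x y] that x by fastforce
    then show ?thesis using that[of "x - 1"] by auto
  qed
  have "dist (\<Phi> y) (\<Phi> x) < \<epsilon>" if "y \<in> I" "dist y x < min (u - x) (x - l)" for y
    using u(2)[of y] l(2)[of y] that by (auto simp: dist_real_def abs_less_iff)
  then show "\<exists>d>0. \<forall>y\<in>I. dist y x < d \<longrightarrow> dist (\<Phi> y) (\<Phi> x) < \<epsilon>"
    using u(1) l(1) by (intro exI[of _ "min (u - x) (x - l)"]) auto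
qed

end

subsection \<open>Commuting families of rank-ordered means\<close>

text \<open>\<open>bisym\<close> is required only when the array with rows \<open>(a, b)\<close> and
  \<open>(g, d)\<close> is non-increasing along rows and columns, so that every mean in it has its
  larger argument first. The index \<open>j\<close> is singled out to build the utility, in which
  the other means then turn out to be affine too.\<close>

locale comonotone_means =
  fixes c :: "'i \<Rightarrow> real \<Rightarrow> real \<Rightarrow> real" and J :: "'i set" and j :: 'i
  assumes j: "j \<in> J"
    and idem: "p \<in> J \<Longrightarrow> c p a a = a"
    and less1: "\<lbrakk>p \<in> J; a < a'\<rbrakk> \<Longrightarrow> c p a b < c p a' b"
    and less2: "\<lbrakk>p \<in> J; b < b'\<rbrakk> \<Longrightarrow> c p a b < c p a b'"
    and cont: "p \<in> J \<Longrightarrow> continuous_on UNIV (\<lambda>(a, b). c p a b)"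
    and bisym: "\<lbrakk>p \<in> J; q \<in> J; b \<le> a; g \<le> a; d \<le> b; d \<le> g\<rbrakk>
      \<Longrightarrow> c p (c q a g) (c q b d) = c q (c p a b) (c p g d)"
begin

lemma mono: "\<lbrakk>p \<in> J; a \<le> a'; b \<le> b'\<rbrakk> \<Longrightarrow> c p a b \<le> c p a' b'"
  using less1[of p a a' b] less2[of p b b' a'] by (cases "a = a'"; cases "b = b'") auto

lemma between: assumes "p \<in> J" "b \<le> a" shows "b \<le> c p a b" "c p a b \<le> a"
  using mono[of p b a b b] mono[of p a a b a] idem assms by auto

lemma continuous_on_c [continuous_intros]:
  assumes "p \<in> J" "continuous_on S f" "continuous_on S g"
  shows "continuous_on S (\<lambda>x. c p (f x) (g x))"
  using continuous_on_compose2[OF cont[OF assms(1)] continuous_on_Pair[OF assms(2,3)]] by simp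

text \<open>In a representation with weight \<open>r\<close> for the larger outcome, \<open>b\<close> and \<open>g\<close> both get the weight
  \<open>r (1 - r)\<close> in \<open>T a b g d\<close>.\<close>
definition T :: "real \<Rightarrow> real \<Rightarrow> real \<Rightarrow> real \<Rightarrow> real" where
  "T a b g d = c j (c j a b) (c j g d)"

lemma T_commute: "\<lbrakk>b \<le> a; g \<le> a; d \<le> b; d \<le> g\<rbrakk> \<Longrightarrow> T a b g d = T a g b d"
  unfolding T_def using bisym[OF j j, of b a g d] by simp

lemma T_mono: "\<lbrakk>a \<le> a'; b \<le> b'; g \<le> g'; d \<le> d'\<rbrakk> \<Longrightarrow> T a b g d \<le> T a' b' g' d'"
  unfolding T_def by (intro mono j)

lemma T_less: assumes "a \<le> a'" "b \<le> b'" "g \<le> g'" "d \<le> d'" "b < b' \<or> g < g'"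
  shows "T a b g d < T a' b' g' d'"
proof -
  have "T a b g d < T a b' g' d"
    unfolding T_def using assms(2,3,5) less1[OF j] less2[OF j] mono[OF j]
    by (smt (verit, ccfv_threshold))
  also have "\<dots> \<le> T a' b' g' d'" using assms by (intro T_mono) auto
  finally show ?thesis .
qed

lemma T_idem: "T a a a a = a" by (simp add: T_def idem j)

lemma T_diag_less_iff: "T a x x d < T a y y d \<longleftrightarrow> x < y"
  using T_less[of a a x y x y d d] T_mono[of a a y x y x d d] by (cases "x < y") auto

lemma T_diag_eq_iff: "T a x x d = T a y y d \<longleftrightarrow> x = y"
  using T_diag_less_iff by (metis linorder_less_linear less_irrefl)

text \<open>\<open>T\<close> is made of three means \<open>c j\<close>, and each is moved past
  \<open>c p\<close> by one use of \<open>bisym\<close>; the order assumptions make every 2 by 2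
  array involved non-increasing.\<close>

lemma T_hom:
  assumes "p \<in> J" "b \<le> a" "g \<le> a" "d \<le> b" "d \<le> g" "b' \<le> a'" "g' \<le> a'" "d' \<le> b'" "d' \<le> g'"
    "a' \<le> a" "b' \<le> b" "g' \<le> g" "d' \<le> d"
  shows "T (c p a a') (c p b b') (c p g g') (c p d d') = c p (T a b g d) (T a' b' g' d')"
proof -
  have "c p (T a b g d) (T a' b' g' d')
      = c j (c p (c j a b) (c j a' b')) (c p (c j g d) (c j g' d'))"
    unfolding T_def by (rule bisym[symmetric, OF j assms(1)]) (use assms in \<open>auto intro!: mono j\<close>)
  also have "c p (c j a b) (c j a' b') = c j (c p a a') (c p b b')"
    by (rule bisym[symmetric, OF j assms(1)]) (use assms in auto)
  also have "c p (c j g d) (c j g' d') = c j (c p g g') (c p d d')"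
    by (rule bisym[symmetric, OF j assms(1)]) (use assms in auto)
  finally show ?thesis by (simp add: T_def)
qed

text \<open>Both sides evaluate, by rows and by columns, the matrix with rows \<open>(a, a, a, a)\<close>, \<open>(a, b, g, d)\<close>,
  \<open>(a, e, f, d)\<close> and \<open>(d, d, d, d)\<close>, which is decreasing in both indices.\<close>
lemma T_transpose:
  assumes "b \<in> {d..a}" "g \<in> {d..a}" "e \<in> {d..a}" "f \<in> {d..a}"
  shows "T a (T a b g d) (T a e f d) d = T (T a a a d) (T a b e d) (T a g f d) (T a d d d)"
proof -
  have "T a (T a b g d) (T a e f d) d = T (T a a a a) (T a b g d) (T a e f d) (T d d d d)"
    by (simp add: T_idem)
  also have "\<dots> = c j (T (c j a a) (c j a b) (c j a g) (c j a d))
                     (T (c j a d) (c j e d) (c j f d) (c j d d))"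
    unfolding T_def[of "T a a a a"]
    by (subst (1 2) T_hom[OF j]) (use assms in auto)
  also have "\<dots> = T (c j (c j a a) (c j a d)) (c j (c j a b) (c j e d))
                   (c j (c j a g) (c j f d)) (c j (c j a d) (c j d d))"
    by (rule T_hom[OF j, symmetric]) (use assms in \<open>auto intro!: mono j\<close>)
  finally show ?thesis by (simp add: T_def)
qed

section \<open>Midpoints between two frozen outcomes\<close>

definition mid :: "real \<Rightarrow> real \<Rightarrow> real \<Rightarrow> real \<Rightarrow> real" where
  "mid d a x y = (SOME z. z \<in> {d..a} \<and> T a z z d = T a x y d)"

text \<open>\<open>x\<close> and \<open>y\<close> have equal weight in \<open>T a x y d\<close>, so
  \<open>mid\<close> is the midpoint in utility. Between the extremes \<open>a\<close> and
  \<open>d\<close> they may stand in either order, hence no rank condition is left. Existence is the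
  intermediate value theorem along the diagonal.\<close>

lemma mid:
  assumes "x \<in> {d..a}" "y \<in> {d..a}"
  shows "mid d a x y \<in> {d..a} \<and> T a (mid d a x y) (mid d a x y) d = T a x y d"
  unfolding mid_def
proof (rule someI_ex)
  have "continuous_on {d..a} (\<lambda>z. T a z z d)" unfolding T_def by (intro continuous_intros j)
  moreover have "T a d d d \<le> T a x y d" "T a x y d \<le> T a a a d" using assms by (auto intro!: T_mono)
  ultimately show "\<exists>z. z \<in> {d..a} \<and> T a z z d = T a x y d"
    using IVT'[of "\<lambda>z. T a z z d" d "T a x y d" a] assms by auto
qed

lemma mid_eqI:
  assumes "x \<in> {d..a}" "y \<in> {d..a}" "T a z z d = T a x y d" shows "mid d a x y = z"
  using mid[OF assms(1,2)] assms(3) T_diag_eq_iff by metis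

text \<open>\<open>Q\<close> is the value of the array with rows \<open>(x, y)\<close> and
  \<open>(z, w)\<close> framed by \<open>a\<close> and \<open>d\<close>. By definition it depends
  only on the row values, and by \<open>T_transpose\<close> (this is \<open>cong\<close>) only on
  the column values. So the entries can be averaged rows first or columns first without changing
  \<open>Q\<close>, which is strictly increasing on constant arrays.\<close>

lemma mid_bisym:
  assumes "x \<in> {d..a}" "y \<in> {d..a}" "z \<in> {d..a}" "w \<in> {d..a}"
  shows "mid d a (mid d a x y) (mid d a z w) = mid d a (mid d a x z) (mid d a y w)"
proof -
  define Q where "Q x y z w = T a (T a x y d) (T a z w d) d" for x y z w
  have cong: "Q x y z w = Q x' y' z' w'"
    if "T a x z d = T a x' z' d" "T a y w d = T a y' w' d" "{x,y,z,w,x',y',z',w'} \<subseteq> {d..a}" 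
    for x y z w x' y' z' w'
    using that T_transpose[of x d a y z w] T_transpose[of x' d a y' z' w'] by (simp add: Q_def)
  let ?u = "mid d a x y" and ?v = "mid d a z w" and ?u' = "mid d a x z" and ?v' = "mid d a y w"
  let ?w = "mid d a ?u ?v" and ?w' = "mid d a ?u' ?v'"
  note m = mid[OF assms(1,2)] mid[OF assms(3,4)] mid[OF assms(1,3)] mid[OF assms(2,4)]
  note n = mid[of ?u d a ?v] mid[of ?u' d a ?v']
  have "Q x y z w = Q ?u ?u ?v ?v" using m unfolding Q_def by simp
  also have "\<dots> = Q ?w ?w ?w ?w" using m n by (intro cong) auto
  finally have 1: "Q x y z w = Q ?w ?w ?w ?w" .
  have "Q x y z w = Q ?u' ?v' ?u' ?v'" using m assms by (intro cong) auto
  also have "\<dots> = Q ?w' ?w' ?w' ?w'" using m n unfolding Q_def by simp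
  finally have "Q ?w ?w ?w ?w = Q ?w' ?w' ?w' ?w'" using 1 by simp
  then show ?thesis unfolding Q_def T_diag_eq_iff .
qed

lemma mid_less_iff:
  assumes "x \<in> {d..a}" "y \<in> {d..a}"
  shows "mid d a x y < s \<longleftrightarrow> T a x y d < T a s s d" "s < mid d a x y \<longleftrightarrow> T a s s d < T a x y d"
  using mid[OF assms] T_diag_less_iff[of a "mid d a x y" d s] T_diag_less_iff[of a s d "mid d a x y"] by auto

text \<open>Since \<open>x < s\<close>, there is a gap between \<open>T a x s d\<close> and
  \<open>T a s s d\<close>. Either \<open>t = a\<close> does not fill it, or by continuity some
  \<open>t\<close> fills exactly half of it.\<close>

lemma mid_above:
  assumes "x \<in> {d..a}" "x < s" "s < a"
  shows "\<exists>t\<in>{d..a}. s < t \<and> mid d a x t < s"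
proof -
  define v where "v = (T a x s d + T a s s d) / 2"
  have v: "T a x s d < v" "v < T a s s d" using T_less[of a a x s s s d d] assms by (auto simp: v_def)
  show ?thesis
  proof (cases "T a x a d < T a s s d")
    case True
    then show ?thesis using assms by (intro bexI[of _ a]) (auto simp: mid_less_iff)
  next
    case False
    have "continuous_on {s..a} (\<lambda>t. T a x t d)" unfolding T_def by (intro continuous_intros j)
    then obtain t where t: "s \<le> t" "t \<le> a" "T a x t d = v"
      using IVT'[of "\<lambda>t. T a x t d" s v a] v False assms by auto
    then have "s \<noteq> t" using v by auto
    then show ?thesis using t v assms by (intro bexI[of _ t]) (auto simp: mid_less_iff)
  qed
qed

lemma mid_below:
  assumes "x \<in> {d..a}" "s < x" "d < s"
  shows "\<exists>t\<in>{d..a}. t < s \<and> s < mid d a x t"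
proof -
  define v where "v = (T a x s d + T a s s d) / 2"
  have v: "v < T a x s d" "T a s s d < v" using T_less[of a a s x s s d d] assms by (auto simp: v_def)
  show ?thesis
  proof (cases "T a s s d < T a x d d")
    case True
    then show ?thesis using assms by (intro bexI[of _ d]) (auto simp: mid_less_iff)
  next
    case False
    have "continuous_on {d..s} (\<lambda>t. T a x t d)" unfolding T_def by (intro continuous_intros j)
    then obtain t where t: "d \<le> t" "t \<le> s" "T a x t d = v"
      using IVT'[of "\<lambda>t. T a x t d" d v s] v False assms by auto
    then have "s \<noteq> t" using v by auto
    then show ?thesis using t v assms by (intro bexI[of _ t]) (auto simp: mid_less_iff)
  qed
qed

text \<open>The curves \<open>y \<mapsto> T a d y d\<close> and \<open>y \<mapsto> T a a y d\<close>
  join at \<open>T a d a d = T a a d d\<close>, so together they take every value that the diagonal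
  takes.\<close>

lemma mid_split:
  assumes "x \<in> {d..a}" shows "\<exists>y\<in>{d..a}. x = mid d a d y \<or> x = mid d a a y"
proof -
  have cont: "continuous_on {d..a} (\<lambda>t. T a z t d)" for z unfolding T_def by (intro continuous_intros j)
  show ?thesis
  proof (cases "T a x x d \<le> T a d a d")
    case True
    moreover have "T a d d d \<le> T a x x d" using assms by (intro T_mono) auto
    ultimately obtain y where "y \<in> {d..a}" "T a d y d = T a x x d"
      using IVT'[OF _ _ _ cont] assms by fastforce
    then show ?thesis using mid_eqI[of d d a y x] assms by (intro bexI[of _ y]) auto
  next
    case False
    moreover have "T a x x d \<le> T a a a d" using assms by (intro T_mono) auto
    moreover have "T a a d d = T a d a d" using T_commute[of a a d d] assms by auto
    ultimately obtain y where "y \<in> {d..a}" "T a a y d = T a x x d"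
      using IVT'[of "\<lambda>t. T a a t d" d "T a x x d" a, OF _ _ _ cont] assms by fastforce
    then show ?thesis using mid_eqI[of a d a y x] assms by (intro bexI[of _ y]) auto
  qed
qed

lemma midpoint_interval: assumes "d < a" shows "midpoint_interval d a (mid d a)"
proof
  show "mid d a x x = x" if "x \<in> {d..a}" for x using that mid_eqI by blast
  show "mid d a x y = mid d a y x" if "x \<in> {d..a}" "y \<in> {d..a}" for x y
    using that mid[of x d a y] T_commute[of x a y d] by (auto intro!: mid_eqI[symmetric])
  show "mid d a z x < mid d a z y" if "x \<in> {d..a}" "y \<in> {d..a}" "z \<in> {d..a}" "x < y" for x y z
    using that mid[of z d a y] T_less[of a a z z x y d d] by (subst mid_less_iff) auto
qed (use assms mid mid_bisym mid_split mid_above mid_below in auto)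

text \<open>\<open>T_hom\<close> moves \<open>c p\<close> past \<open>T\<close>, and idempotence
  keeps the frame \<open>a\<close>, \<open>d\<close> in place. The comparison of the two midpoints
  puts them into the order that \<open>T_hom\<close> expects.\<close>

lemma c_mid:
  assumes "p \<in> J" "x \<in> {d..a}" "y \<in> {d..a}" "x' \<in> {d..a}" "y' \<in> {d..a}" "y \<le> x" "y' \<le> x'"
    "mid d a y y' \<le> mid d a x x'"
  shows "c p (mid d a x x') (mid d a y y') = mid d a (c p x y) (c p x' y')"
proof (rule mid_eqI[symmetric])
  note in' = between[OF assms(1,6)] between[OF assms(1,7)]
  show "c p x y \<in> {d..a}" "c p x' y' \<in> {d..a}" using in' assms by auto
  let ?u = "mid d a x x'" and ?v = "mid d a y y'"
  note m = mid[OF assms(2,4)] mid[OF assms(3,5)]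
  have "T a (c p ?u ?v) (c p ?u ?v) d = T (c p a a) (c p ?u ?v) (c p ?u ?v) (c p d d)"
    by (simp add: idem assms)
  also have "\<dots> = c p (T a ?u ?u d) (T a ?v ?v d)" using m assms by (intro T_hom) auto
  also have "\<dots> = c p (T a x x' d) (T a y y' d)" using m by simp
  also have "\<dots> = T (c p a a) (c p x y) (c p x' y') (c p d d)"
    using assms by (intro T_hom[symmetric]) auto
  finally show "T a (c p ?u ?v) (c p ?u ?v) d = T a (c p x y) (c p x' y') d"
    by (simp add: idem assms)
qed

section \<open>Additive representations on compact intervals and on the line\<close>

definition rep_on :: "real \<Rightarrow> real \<Rightarrow> (real \<Rightarrow> real) \<Rightarrow> ('i \<Rightarrow> real) \<Rightarrow> bool" where
  "rep_on d a \<phi> \<rho> \<longleftrightarrow> strict_mono_on {d..a} \<phi> \<and> continuous_on {d..a} \<phi> \<and>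
     (\<forall>p\<in>J. \<forall>x\<in>{d..a}. \<forall>y\<in>{d..x}. \<phi> (c p x y) = \<rho> p * \<phi> x + (1 - \<rho> p) * \<phi> y)"

text \<open>The weight \<open>\<rho> p = \<Phi> (c p a d)\<close> is forced, as
  \<open>\<Phi>\<close> runs from 0 at \<open>d\<close> to 1 at \<open>a\<close>. With the lower
  outcome at \<open>d\<close> the error of the formula halves under both midpoint maps; a general
  lower outcome is reduced to this case.\<close>

lemma rep_on_exists:
  assumes "d < a" shows "\<exists>\<phi> \<rho>. rep_on d a \<phi> \<rho>"
proof -
  interpret midpoint_interval d a "mid d a" by (rule midpoint_interval[OF assms])
  define \<rho> where "\<rho> p = \<Phi> (c p a d)" for p
  have base: "\<Phi> (c p x d) = \<rho> p * \<Phi> x" if p: "p \<in> J" and "x \<in> I" for p x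
  proof -
    define e where "e x = \<Phi> (c p x d) - \<rho> p * \<Phi> x" for x
    have le: "mid d a d d \<le> mid d a x y" if "x \<in> I" "y \<in> I" for x y
      using m_in[OF that] m_idem[of d] by simp
    have cin: "c p x d \<in> I" if "x \<in> I" for x using between[of p d x] p that by auto
    have "e x = 0"
    proof (rule halving[of e 1])
      show "\<bar>e x\<bar> \<le> 1" if "x \<in> I" for x
      proof -
        have "0 \<le> \<rho> p * \<Phi> x" "\<rho> p * \<Phi> x \<le> 1"
          using \<Phi>_bounds by (auto simp: \<rho>_def intro: mult_le_one)
        then show ?thesis using \<Phi>_bounds[of "c p x d"] by (simp add: e_def abs_le_iff)
      qed
      fix x assume x: "x \<in> I"
      have "c p (mid d a d x) d = mid d a d (c p x d)"
        using c_mid[OF p, of d d a d x d] le[of d x] x m_idem[of d] idem[OF p] by auto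
      then have "e (mid d a d x) = e x / 2" using x cin by (simp add: e_def \<Phi>_m_lo)
      then show "\<bar>e (mid d a d x)\<bar> \<le> \<bar>e x\<bar> / 2" by simp
      have "c p (mid d a a x) d = mid d a (c p a d) (c p x d)"
        using c_mid[OF p, of a d a d x d] le[of a x] x m_idem[of d] by auto
      then have "e (mid d a a x) = e x / 2"
        using x cin cin[of a] by (simp add: e_def \<Phi>_m \<Phi>_hi \<rho>_def[symmetric] field_simps)
      then show "\<bar>e (mid d a a x)\<bar> \<le> \<bar>e x\<bar> / 2" by simp
    qed (rule that(2))
    then show ?thesis by (simp add: e_def)
  qed
  have gen: "\<Phi> (c p x y) = \<rho> p * \<Phi> x + (1 - \<rho> p) * \<Phi> y" if p: "p \<in> J" and "x \<in> I" "y \<in> {d..x}" for p x y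
  proof -
    have xy: "x \<in> I" "y \<in> I" "y \<le> x" using that by auto
    have "\<Phi> y \<le> \<Phi> x" using \<Phi>_mono xy by auto
    \<comment> \<open>\<open>z\<close> carries the utility difference, so
      \<open>mid d a z y = mid d a x d\<close>. The mean \<open>c p\<close> of this point and
      \<open>mid d a y d\<close> is computed in two ways, pairing \<open>x\<close> with
      \<open>y\<close> or \<open>z\<close> with \<open>d\<close>; this yields the formula for
      \<open>x\<close>, \<open>y\<close> from the one for \<open>z\<close>,
      \<open>d\<close>.\<close>
    then obtain z where z: "z \<in> I" "\<Phi> z = \<Phi> x - \<Phi> y"
      using IVT'[of \<Phi> d "\<Phi> x - \<Phi> y" a, OF _ _ _ \<Phi>_continuous] \<Phi>_bounds[of x] \<Phi>_bounds[of y] assms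
      by (auto simp: \<Phi>_lo \<Phi>_hi)
    have in': "mid d a z y \<in> I" "mid d a x d \<in> I" "mid d a y d \<in> I" using m_in z xy by auto
    have "\<Phi> (mid d a z y) = \<Phi> (mid d a x d)" using z xy by (simp add: \<Phi>_m \<Phi>_lo)
    then have eq: "mid d a z y = mid d a x d"
      using \<Phi>_strict_mono[OF in'(1,2)] \<Phi>_strict_mono[OF in'(2,1)] by (metis linorder_less_linear less_irrefl)
    have le: "mid d a y d \<le> mid d a x d"
      using m_less_iff[of x y d] xy m_commute[of d x] m_commute[of d y] by fastforce
    have cin: "c p x y \<in> I" "c p z d \<in> I" using between[of p y x] between[of p d z] p xy z by auto
    have "c p (mid d a x d) (mid d a y d) = mid d a (c p x y) d"
      using c_mid[OF p, of x d a y d d] xy le idem[OF p] by auto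
    then have 1: "\<Phi> (c p (mid d a x d) (mid d a y d)) = \<Phi> (c p x y) / 2"
      using cin by (simp add: \<Phi>_m \<Phi>_lo)
    have "c p (mid d a z y) (mid d a d y) = mid d a (c p z d) y"
      using c_mid[OF p, of z d a d y y] xy z le eq idem[OF p] m_commute[of d y] by auto
    then have 2: "\<Phi> (c p (mid d a z y) (mid d a d y)) = (\<rho> p * \<Phi> z + \<Phi> y) / 2"
      using cin xy z p by (simp add: \<Phi>_m base)
    have "mid d a d y = mid d a y d" using m_commute xy by auto
    then have "\<Phi> (c p x y) = \<rho> p * \<Phi> z + \<Phi> y" using 1 2 eq by simp
    then show ?thesis using z by (simp add: algebra_simps)
  qed
  have "rep_on d a \<Phi> \<rho>"
    unfolding rep_on_def using gen \<Phi>_continuous \<Phi>_strict_mono by (auto intro!: strict_mono_onI)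
  then show ?thesis by blast
qed

lemma rep_on_subset: "\<lbrakk>rep_on d a \<phi> \<rho>; d \<le> d'; a' \<le> a\<rbrakk> \<Longrightarrow> rep_on d' a' \<phi> \<rho>"
  unfolding rep_on_def by (auto intro: monotone_on_subset continuous_on_subset)

lemma rep_on_less: "\<lbrakk>rep_on d a \<phi> \<rho>; x < y; d \<le> x; y \<le> a\<rbrakk> \<Longrightarrow> \<phi> x < \<phi> y"
  unfolding rep_on_def using strict_mono_onD[of "{d..a}" \<phi> x y] by auto

lemma rep_on_affine:
  assumes "rep_on d a \<phi> \<rho>" "(r::real) > 0" shows "rep_on d a (\<lambda>x. r * \<phi> x + s) \<rho>"
  unfolding rep_on_def
proof (intro conjI ballI)
  show "strict_mono_on {d..a} (\<lambda>x. r * \<phi> x + s)"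
    using rep_on_less[OF assms(1)] assms(2) by (intro strict_mono_onI) auto
  show "continuous_on {d..a} (\<lambda>x. r * \<phi> x + s)"
    using assms(1) unfolding rep_on_def by (intro continuous_intros) auto
  fix p x y assume "p \<in> J" "x \<in> {d..a}" "y \<in> {d..x}"
  then have "\<phi> (c p x y) = \<rho> p * \<phi> x + (1 - \<rho> p) * \<phi> y" using assms(1) unfolding rep_on_def by blast
  then show "r * \<phi> (c p x y) + s = \<rho> p * (r * \<phi> x + s) + (1 - \<rho> p) * (r * \<phi> y + s)"
    by (simp only:) (simp add: algebra_simps)
qed

text \<open>Both middle outcomes of \<open>T\<close> get the weight
  \<open>\<rho> j * (1 - \<rho> j)\<close>, which is nonzero because \<open>c j a d\<close> lies
  strictly between \<open>d\<close> and \<open>a\<close>. So \<open>mid\<close> is the utility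
  midpoint in any representation, however obtained.\<close>

lemma rep_on_mid:
  assumes "rep_on d a \<phi> \<rho>" "d < a" "x \<in> {d..a}" "y \<in> {d..a}"
  shows "\<phi> (mid d a x y) = (\<phi> x + \<phi> y) / 2"
proof -
  have sm: "strict_mono_on {d..a} \<phi>" and
    af: "\<And>x y. \<lbrakk>x \<in> {d..a}; y \<in> {d..x}\<rbrakk> \<Longrightarrow> \<phi> (c j x y) = \<rho> j * \<phi> x + (1 - \<rho> j) * \<phi> y"
    using assms(1) j unfolding rep_on_def by auto
  let ?r = "\<rho> j"
  have T: "\<phi> (T a x y d) = ?r * (?r * \<phi> a + (1 - ?r) * \<phi> x) + (1 - ?r) * (?r * \<phi> y + (1 - ?r) * \<phi> d)"
    if "x \<in> {d..a}" "y \<in> {d..a}" for x y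
    unfolding T_def using that between[OF j, of x a] between[OF j, of d y] mono[OF j, of y a d x]
    by (subst af; (subst af)?; (subst af)?; auto)
  have "c j d d < c j a d" "c j a d < c j a a" using less1 less2 j assms by blast+
  then have "d < c j a d" "c j a d < a" by (auto simp: idem j)
  then have "\<phi> d < \<phi> (c j a d)" "\<phi> (c j a d) < \<phi> a" "\<phi> d < \<phi> a"
    using strict_mono_onD[OF sm] assms by auto
  moreover have "\<phi> (c j a d) = ?r * \<phi> a + (1 - ?r) * \<phi> d" using af[of a d] assms by auto
  ultimately have r: "?r * (\<phi> a - \<phi> d) > 0" "(1 - ?r) * (\<phi> a - \<phi> d) > 0" by (auto simp: algebra_simps)
  then have "?r \<noteq> 0" "1 - ?r \<noteq> 0" by auto
  define z where "z = mid d a x y"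
  have "z \<in> {d..a}" "T a z z d = T a x y d" using mid[OF assms(3,4)] by (auto simp: z_def)
  then have "?r * (1 - ?r) * (2 * \<phi> z) = ?r * (1 - ?r) * (\<phi> x + \<phi> y)"
    using T[of z z] T[of x y] assms by (simp add: algebra_simps)
  then have "2 * \<phi> z = \<phi> x + \<phi> y" using \<open>?r \<noteq> 0\<close> \<open>1 - ?r \<noteq> 0\<close> by simp
  then show ?thesis by (simp add: z_def)
qed

text \<open>After an affine change that matches the increments from \<open>d\<close> to
  \<open>a\<close>, the difference of the representations vanishes at both ends and respects
  midpoints, so \<open>halving\<close> applies. The normalisation at 0 and 1 then fixes the affine
  change.\<close>

lemma rep_on_unique:
  assumes "rep_on d a \<phi> \<rho>" "rep_on d a \<psi> \<sigma>" "0 \<in> {d..a}" "1 \<in> {d..a}"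
    "\<phi> 0 = 0" "\<phi> 1 = 1" "\<psi> 0 = 0" "\<psi> 1 = 1" "x \<in> {d..a}"
  shows "\<phi> x = \<psi> x"
proof -
  have "d < a" using assms by auto
  interpret midpoint_interval d a "mid d a" by (rule midpoint_interval[OF \<open>d < a\<close>])
  define r where "r = (\<phi> a - \<phi> d) / (\<psi> a - \<psi> d)"
  define e where "e x = (\<phi> x - \<phi> d) - r * (\<psi> x - \<psi> d)" for x
  have "\<psi> d < \<psi> a" using rep_on_less[OF assms(2) \<open>d < a\<close>] by simp
  then have e0: "e d = 0" "e a = 0" by (auto simp: e_def r_def)
  have em: "e (mid d a x y) = (e x + e y) / 2" if "x \<in> I" "y \<in> I" for x y
    using rep_on_mid[OF assms(1) \<open>d < a\<close> that] rep_on_mid[OF assms(2) \<open>d < a\<close> that]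
    by (simp add: e_def field_simps)
  have "continuous_on I e" unfolding e_def
    using assms(1,2) by (intro continuous_intros) (auto simp: rep_on_def)
  then have "bounded (e ` I)" using compact_continuous_image compact_imp_bounded compact_Icc by blast
  then obtain K where "\<forall>y\<in>e ` I. \<bar>y\<bar> \<le> K" unfolding bounded_real by blast
  then have K: "\<bar>e x\<bar> \<le> K" if "x \<in> I" for x using that by blast
  have z: "e x = 0" if "x \<in> I" for x
    by (rule halving[OF K]) (use that in \<open>auto simp: em e0\<close>)
  have "\<phi> x = \<psi> x * r + (\<phi> d - r * \<psi> d)" if "x \<in> I" for x
    using z[OF that] by (simp add: e_def algebra_simps)
  from this[of 0] this[of 1] this[of x] assms show ?thesis by auto
qed

theorem representation:
  "\<exists>(\<phi> :: real \<Rightarrow> real) \<rho>. strict_mono \<phi> \<and> continuous_on UNIV \<phi> \<and>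
     (\<forall>p\<in>J. \<forall>x y. y \<le> x \<longrightarrow> \<phi> (c p x y) = \<rho> p * \<phi> x + (1 - \<rho> p) * \<phi> y)"
proof -
  have "\<exists>\<phi> \<rho>. rep_on (- real (Suc n)) (real (Suc n)) \<phi> \<rho> \<and> \<phi> 0 = 0 \<and> \<phi> 1 = 1" for n
  proof -
    have "- real (Suc n) < real (Suc n)" by simp
    from rep_on_exists[OF this] obtain \<phi> \<rho> where r: "rep_on (- real (Suc n)) (real (Suc n)) \<phi> \<rho>" by blast
    then have lt: "\<phi> 0 < \<phi> 1" by (rule rep_on_less) auto
    have "rep_on (- real (Suc n)) (real (Suc n)) (\<lambda>x. 1 / (\<phi> 1 - \<phi> 0) * \<phi> x + (- \<phi> 0 / (\<phi> 1 - \<phi> 0))) \<rho>"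
      by (rule rep_on_affine[OF r]) (use lt in simp)
    moreover have "1 / (\<phi> 1 - \<phi> 0) * \<phi> 0 + (- \<phi> 0 / (\<phi> 1 - \<phi> 0)) = 0"
      "1 / (\<phi> 1 - \<phi> 0) * \<phi> 1 + (- \<phi> 0 / (\<phi> 1 - \<phi> 0)) = 1"
      using lt by (simp_all flip: diff_divide_distrib)
    ultimately show ?thesis by blast
  qed
  then obtain f r where f: "rep_on (- real (Suc n)) (real (Suc n)) (f n) (r n)"
    and f01: "f n 0 = 0" "f n 1 = 1" for n by metis
  \<comment> \<open>Any index whose interval contains \<open>x\<close> gives the same value;
    \<open>Suc n\<close> makes every interval contain 0 and 1, the points of normalisation.\<close>
  define \<Psi> where "\<Psi> x = f (nat \<lceil>\<bar>x\<bar>\<rceil>) x" for x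
  have agree: "f n x = f k x" if "n \<le> k" "x \<in> {- real (Suc n)..real (Suc n)}" for n k x
    by (rule rep_on_unique[OF f rep_on_subset[OF f[of k]]]) (use that f01 in auto)
  have \<Psi>: "\<Psi> x = f n x" if "x \<in> {- real (Suc n)..real (Suc n)}" for n x
  proof (cases "n \<le> nat \<lceil>\<bar>x\<bar>\<rceil>")
    case True
    then show ?thesis unfolding \<Psi>_def using agree that by metis
  next
    case False
    moreover have "x \<in> {- real (Suc (nat \<lceil>\<bar>x\<bar>\<rceil>))..real (Suc (nat \<lceil>\<bar>x\<bar>\<rceil>))}"
      using real_nat_ceiling_ge[of "\<bar>x\<bar>"] by (simp add: abs_le_iff) linarith
    ultimately show ?thesis unfolding \<Psi>_def by (intro agree) auto
  qed
  have big: "\<exists>n. \<bar>x\<bar> < real (Suc n) \<and> \<bar>y\<bar> < real (Suc n)" for x y :: real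
  proof -
    obtain n where "max \<bar>x\<bar> \<bar>y\<bar> < real n" using reals_Archimedean2 by blast
    then show ?thesis by (intro exI[of _ n]) auto
  qed
  have "strict_mono \<Psi>"
  proof
    fix x y :: real assume "x < y"
    obtain n where n: "\<bar>x\<bar> < real (Suc n)" "\<bar>y\<bar> < real (Suc n)" using big by blast
    have "f n x < f n y" using n \<open>x < y\<close> by (intro rep_on_less[OF f]) auto
    then show "\<Psi> x < \<Psi> y" using \<Psi>[of x n] \<Psi>[of y n] n by (auto simp: abs_less_iff)
  qed
  moreover have "continuous_on UNIV \<Psi>"
    unfolding continuous_on_eq_continuous_at[OF open_UNIV]
  proof
    fix x :: real
    obtain n where n: "\<bar>x\<bar> < real (Suc n)" using big by blast
    let ?S = "{- real (Suc n)<..<real (Suc n)}"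
    have "continuous_on ?S (f n)"
      using f[of n] by (auto simp: rep_on_def intro: continuous_on_subset)
    then have "continuous_on ?S \<Psi>"
      by (rule continuous_on_eq) (use \<Psi>[of _ n] in auto)
    then show "isCont \<Psi> x" using n by (auto simp: continuous_on_eq_continuous_at abs_less_iff)
  qed
  \<comment> \<open>The weight does not depend on the interval: with values 0 and 1 at the outcomes
    0 and 1, it is the utility of \<open>c p 1 0\<close>.\<close>
  moreover have "\<Psi> (c p x y) = \<Psi> (c p 1 0) * \<Psi> x + (1 - \<Psi> (c p 1 0)) * \<Psi> y" if "p \<in> J" "y \<le> x" for p x y
  proof -
    obtain n where n: "\<bar>x\<bar> < real (Suc n)" "\<bar>y\<bar> < real (Suc n)" using big by blast
    have "c p x y \<in> {y..x}" "c p 1 0 \<in> {0..1}"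
      using between[of p y x] between[of p 0 1] that by auto
    then have e: "\<Psi> (c p x y) = f n (c p x y)" "\<Psi> (c p 1 0) = f n (c p 1 0)" "\<Psi> x = f n x" "\<Psi> y = f n y"
      using n by (auto intro!: \<Psi>)
    have "f n (c p u v) = r n p * f n u + (1 - r n p) * f n v"
      if "u \<in> {- real (Suc n)..real (Suc n)}" "v \<in> {- real (Suc n)..u}" for u v
      using f[of n] that \<open>p \<in> J\<close> unfolding rep_on_def by blast
    from this[of 1 0] this[of x y] show ?thesis unfolding e using n that f01[of n] by auto
  qed
  ultimately show ?thesis by (intro exI[of _ \<Psi>] exI[of _ "\<lambda>p. \<Psi> (c p 1 0)"]) blast
qed

end

subsection \<open>Certainty equivalents of binary acts\<close>

lemma of_bool_tendsto:
  fixes x z :: real assumes "f \<longlonglongrightarrow> x" "x \<noteq> z"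
  shows "(\<lambda>n. of_bool (f n \<le> z) :: real) \<longlonglongrightarrow> of_bool (x \<le> z)"
proof (rule tendsto_eventually)
  show "\<forall>\<^sub>F n in sequentially. (of_bool (f n \<le> z) :: real) = of_bool (x \<le> z)"
  proof (cases "x < z")
    case True
    then show ?thesis using order_tendstoD(2)[OF assms(1) True] by (auto elim!: eventually_mono)
  next
    case False
    then have "z < x" using assms by simp
    then show ?thesis using order_tendstoD(1)[OF assms(1) \<open>z < x\<close>] by (auto elim!: eventually_mono)
  qed
qed

locale risk_preference = prob_space P for P :: "'s measure" +
  fixes W :: "'w measure" and R :: "('w, 's) pref"
  assumes space_W: "space W \<noteq> {}" and unif: "supports_uniform P"
    and A1: "A1 W P R" and A2: "A2 W P R" and A3: "A3 W P R" and A4: "A4 W P R" and A8: "A8 W P R"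
begin

definition lift :: "('s \<Rightarrow> real) \<Rightarrow> ('w, 's) act" where "lift f = (\<lambda>(w, s). f s)"

lemma lift_apply [simp]: "lift f (w, s) = f s" by (simp add: lift_def)

lemma const_act_lift: "const_act m = lift (\<lambda>_. m)" by (auto simp: lift_def const_act_def)

lemma bin_act_lift: "bin_act A t x = lift (\<lambda>s. if s \<in> A then t else x)"
  by (simp add: lift_def bin_act_def)

lemma lift_in: "\<lbrakk>f \<in> borel_measurable P; finite (f ` space P)\<rbrakk> \<Longrightarrow> lift f \<in> V0 W P"
proof -
  assume f: "f \<in> borel_measurable P" "finite (f ` space P)"
  have "lift f ` space (W \<Otimes>\<^sub>M P) \<subseteq> f ` space P" by (auto simp: space_pair_measure)
  then have "finite (lift f ` space (W \<Otimes>\<^sub>M P))" using f(2) by (rule finite_subset)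
  moreover have "lift f \<in> borel_measurable (W \<Otimes>\<^sub>M P)" unfolding lift_def using f(1) by measurable
  ultimately show ?thesis by (simp add: V0_def Vt0_def Vt_def finite_imp_bounded cond_cdf_def fun_eq_iff)
qed

lemma const_act_in [simp, intro]: "const_act m \<in> V0 W P"
  unfolding const_act_lift by (rule lift_in) (auto intro: finite_subset[of _ "{m}"])

lemma bin_act_in [simp, intro]: "A \<in> sets P \<Longrightarrow> bin_act A t x \<in> V0 W P"
  unfolding bin_act_lift by (rule lift_in) (auto intro: finite_subset[of _ "{t, x}"])

lemma V0_Vt0: "v \<in> V0 W P \<Longrightarrow> v \<in> Vt0 W P" by (simp add: V0_def)

lemma act_cdf_eq: "\<lbrakk>v \<in> V0 W P; w \<in> space W\<rbrakk> \<Longrightarrow> act_cdf W P v = cond_cdf P v w"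
  unfolding act_cdf_def V0_def by (metis (mono_tags, lifting) mem_Collect_eq someI)

lemma act_cdf_const: "act_cdf W P (const_act m) z = of_bool (m \<le> z)"
  by (simp add: act_cdf_def cond_cdf_def const_act_def prob_space)

lemma act_cdf_bin:
  assumes "A \<in> sets P"
  shows "act_cdf W P (bin_act A t x) z = prob A * of_bool (t \<le> z) + (1 - prob A) * of_bool (x \<le> z)"
proof -
  have "A \<subseteq> space P" using assms by (rule sets.sets_into_space)
  then have e: "{s \<in> space P. (if s \<in> A then t else x) \<le> z} =
      (if t \<le> z then if x \<le> z then space P else A else if x \<le> z then space P - A else {})"
    by auto
  have "act_cdf W P (bin_act A t x) z = prob {s \<in> space P. (if s \<in> A then t else x) \<le> z}"
    by (simp add: act_cdf_def cond_cdf_def bin_act_def)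
  then show ?thesis unfolding e using assms by (simp add: prob_space prob_compl)
qed

lemma total: "\<lbrakk>v \<in> Vt0 W P; u \<in> Vt0 W P\<rbrakk> \<Longrightarrow> R v u \<or> R u v"
  using A1 unfolding A1_def by blast

lemma trans: "\<lbrakk>R v u; R u r; v \<in> Vt0 W P; u \<in> Vt0 W P; r \<in> Vt0 W P\<rbrakk> \<Longrightarrow> R v r"
  using A1 unfolding A1_def by blast

lemma indiff_cdf:
  assumes "v \<in> V0 W P" "u \<in> V0 W P" "\<And>z. act_cdf W P v z = act_cdf W P u z" shows "indiff R v u"
proof -
  have "cond_cdf P v w t = cond_cdf P u w t" if "w \<in> space W" for w t
    using assms act_cdf_eq[of _ w] that by metis
  then show ?thesis using A2 assms(1,2) V0_Vt0 unfolding A2_def by blast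
qed

lemma dominance:
  assumes "v \<in> V0 W P" "u \<in> V0 W P" "\<And>z. act_cdf W P v z \<le> act_cdf W P u z"
  shows "R v u" "act_cdf W P v z < act_cdf W P u z \<Longrightarrow> strict_pref R v u"
  using A4 assms unfolding A4_def by blast+

lemma const_iff: "R (const_act m) (const_act n) \<longleftrightarrow> n \<le> m"
proof -
  have "R (const_act m) (const_act n)" if "n \<le> m" for m n
    using that by (intro dominance) (auto simp: act_cdf_const)
  moreover have "strict_pref R (const_act n) (const_act m)" if "m < n" for m n
    using that dominance(2)[of "const_act n" "const_act m" m] by (auto simp: act_cdf_const)
  ultimately show ?thesis by (metis linorder_not_le strict_pref_def)
qed

text \<open>Without an indifferent constant, the two sets that A3 declares open would disconnect the
  real line.\<close>

lemma ex_indiff_const: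
  assumes v: "v \<in> Vt0 W P" and "R (const_act a) v" "R v (const_act b)"
  shows "\<exists>m\<in>{b..a}. indiff R (const_act m) v"
proof -
  let ?U = "{m. strict_pref R (const_act m) v}" and ?L = "{m. strict_pref R v (const_act m)}"
  have "\<exists>m. indiff R (const_act m) v"
  proof (rule ccontr)
    assume no: "\<nexists>m. indiff R (const_act m) v"
    have "open ?U" "open ?L" using A3 v unfolding A3_def by auto
    moreover have "?U \<union> ?L = UNIV"
      using no total[OF V0_Vt0[OF const_act_in] v] unfolding strict_pref_def indiff_def by blast
    moreover have "?U \<inter> ?L = {}" by (auto simp: strict_pref_def)
    moreover have "a \<in> ?U" "b \<in> ?L" using no assms by (auto simp: strict_pref_def indiff_def)
    ultimately show False using connected_UNIV[where 'a=real] unfolding connected_def by blast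
  qed
  then obtain m where m: "indiff R (const_act m) v" by blast
  then have "R (const_act a) (const_act m)" "R (const_act m) (const_act b)"
    using assms trans[of _ v] V0_Vt0[OF const_act_in] unfolding indiff_def by blast+
  then show ?thesis using m by (auto simp: const_iff)
qed

lemma indiff_const_unique:
  "\<lbrakk>v \<in> Vt0 W P; indiff R (const_act m) v; indiff R (const_act n) v\<rbrakk> \<Longrightarrow> m = n"
  using trans[of _ v] V0_Vt0[OF const_act_in] const_iff unfolding indiff_def by (meson order_antisym)

lemma cert_equiv_eqI: "\<lbrakk>v \<in> Vt0 W P; indiff R (const_act m) v\<rbrakk> \<Longrightarrow> cert_equiv R v = m"
  unfolding cert_equiv_def using indiff_const_unique by blast

lemma cert_equiv: assumes v: "v \<in> V0 W P" shows "indiff R (const_act (cert_equiv R v)) v"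
proof -
  obtain w where w: "w \<in> space W" using space_W by blast
  have fin: "finite (v ` space (W \<Otimes>\<^sub>M P))" and vm: "v \<in> borel_measurable (W \<Otimes>\<^sub>M P)"
    using v by (auto simp: V0_def Vt0_def Vt_def)
  then obtain K where K: "\<And>\<omega>. \<omega> \<in> space (W \<Otimes>\<^sub>M P) \<Longrightarrow> \<bar>v \<omega>\<bar> \<le> K"
    using finite_imp_bounded[OF fin] unfolding bounded_real by blast
  then have K: "\<bar>v (w, s)\<bar> \<le> K" if "s \<in> space P" for s using that w by (simp add: space_pair_measure)
  have cdf: "act_cdf W P v z = prob {s \<in> space P. v (w, s) \<le> z}" for z
    using act_cdf_eq[OF v w] by (simp add: cond_cdf_def)
  have "R (const_act K) v"
  proof (rule dominance)
    fix z show "act_cdf W P (const_act K) z \<le> act_cdf W P v z"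
    proof (cases "K \<le> z")
      case True
      then have "{s \<in> space P. v (w, s) \<le> z} = space P" using K by force
      then show ?thesis unfolding cdf act_cdf_const by (simp add: prob_space)
    qed (simp add: cdf act_cdf_const)
  qed (use v in auto)
  moreover have "R v (const_act (- K))"
  proof (rule dominance)
    fix z show "act_cdf W P v z \<le> act_cdf W P (const_act (- K)) z"
    proof (cases "- K \<le> z")
      case False
      then have "{s \<in> space P. v (w, s) \<le> z} = {}" using K by (force simp: abs_le_iff)
      then show ?thesis unfolding cdf act_cdf_const by (simp only: measure_empty) simp
    qed (simp add: cdf act_cdf_const)
  qed (use v in auto)
  ultimately obtain m where "indiff R (const_act m) v" using ex_indiff_const[OF V0_Vt0[OF v]] by blast
  then show ?thesis using cert_equiv_eqI[OF V0_Vt0[OF v]] by metis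
qed

lemma pref_iff: assumes "v \<in> V0 W P" "u \<in> V0 W P" shows "R v u \<longleftrightarrow> cert_equiv R u \<le> cert_equiv R v"
proof -
  have "R v u \<longleftrightarrow> R (const_act (cert_equiv R v)) (const_act (cert_equiv R u))"
    using cert_equiv[OF assms(1)] cert_equiv[OF assms(2)] V0_Vt0[OF assms(1)] V0_Vt0[OF assms(2)]
      V0_Vt0[OF const_act_in] trans unfolding indiff_def by meson
  then show ?thesis by (simp add: const_iff)
qed

lemma strict_pref_iff: "\<lbrakk>v \<in> V0 W P; u \<in> V0 W P\<rbrakk> \<Longrightarrow> strict_pref R v u \<longleftrightarrow> cert_equiv R u < cert_equiv R v"
  by (auto simp: strict_pref_def pref_iff)

lemma cert_equiv_const [simp]: "cert_equiv R (const_act m) = m"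
  using const_iff by (intro cert_equiv_eqI V0_Vt0) (auto simp: indiff_def)

lemma cert_equiv_cong_cdf:
  assumes "v \<in> V0 W P" "u \<in> V0 W P" "\<And>z. act_cdf W P v z = act_cdf W P u z"
  shows "cert_equiv R v = cert_equiv R u"
  using indiff_cdf[OF assms] pref_iff[OF assms(1,2)] pref_iff[OF assms(2,1)] by (auto simp: indiff_def)

text \<open>A3 is used with one of its two sequences constantly \<open>const_act m\<close>, once for
  each side of the limit.\<close>

lemma cert_equiv_tendsto:
  assumes v: "v \<in> V0 W P" and vs: "range vs \<subseteq> V0 W P" and "unif_bounded W P vs"
    and "weak_conv (\<lambda>n. act_cdf W P (vs n)) (act_cdf W P v)"
  shows "(\<lambda>n. cert_equiv R (vs n)) \<longlonglongrightarrow> cert_equiv R v"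
proof (rule order_tendstoI)
  have const: "range (\<lambda>_. const_act m) \<subseteq> V0 W P" "unif_bounded W P (\<lambda>_. const_act m)"
    "weak_conv (\<lambda>_. act_cdf W P (const_act m)) (act_cdf W P (const_act m))" for m
    by (auto simp: unif_bounded_def weak_conv_def) (auto simp: const_act_def)
  note A3' = A3[unfolded A3_def, THEN conjunct1]
  show "\<forall>\<^sub>F n in sequentially. m < cert_equiv R (vs n)" if "m < cert_equiv R v" for m
  proof -
    have "strict_pref R v (const_act m)" using that by (simp add: strict_pref_iff v)
    then have "\<forall>\<^sub>F n in sequentially. strict_pref R (vs n) (const_act m)"
      using A3'[rule_format, of v "const_act m" vs "\<lambda>_. const_act m"] assms const[of m] by (auto elim: eventually_mono)
    then show ?thesis
      by (rule eventually_mono) (use vs in \<open>auto simp: strict_pref_iff range_subsetD\<close>)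
  qed
  show "\<forall>\<^sub>F n in sequentially. cert_equiv R (vs n) < m" if "cert_equiv R v < m" for m
  proof -
    have "strict_pref R (const_act m) v" using that by (simp add: strict_pref_iff v)
    then have "\<forall>\<^sub>F n in sequentially. strict_pref R (const_act m) (vs n)"
      using A3'[rule_format, of "const_act m" v "\<lambda>_. const_act m" vs] assms const[of m] by (auto elim: eventually_mono)
    then show ?thesis
      by (rule eventually_mono) (use vs in \<open>auto simp: strict_pref_iff range_subsetD\<close>)
  qed
qed

section \<open>Certainty equivalents as functions of probability and outcomes\<close>

definition event :: "real \<Rightarrow> 's set" where
  "event = (SOME E. \<forall>p\<in>{0..1}. E p \<in> sets P \<and> prob (E p) = p)"

text \<open>The uniform variable \<open>X\<close> provides the event \<open>X \<le> p\<close>. One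
  event of each probability suffices, because by A2 only probabilities matter for binary
  acts.\<close>

lemma event: assumes "p \<in> {0..1}" shows "event p \<in> sets P" "prob (event p) = p"
proof -
  obtain X where X: "X \<in> borel_measurable P" "distr P borel X = uniform_measure lborel {0..1::real}"
    using unif unfolding supports_uniform_def by blast
  have "\<exists>E. \<forall>p\<in>{0..1}. E p \<in> sets P \<and> prob (E p) = p"
  proof (intro exI ballI conjI)
    fix p :: real assume p: "p \<in> {0..1}"
    show "X -` {..p} \<inter> space P \<in> sets P" using X(1) by (rule measurable_sets) auto
    have "prob (X -` {..p} \<inter> space P) = measure (distr P borel X) {..p}"
      using X(1) by (intro measure_distr[symmetric]) auto
    also have "\<dots> = measure lborel ({0..1} \<inter> {..p}) / measure lborel {0..1::real}"
      unfolding X(2) by (subst measure_uniform_measure) auto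
    also have "{0..1} \<inter> {..p} = {0..p}" using p by auto
    finally show "prob (X -` {..p} \<inter> space P) = p" using p by simp
  qed
  then have "\<forall>p\<in>{0..1}. event p \<in> sets P \<and> prob (event p) = p" unfolding event_def by (rule someI_ex)
  then show "event p \<in> sets P" "prob (event p) = p" using assms by auto
qed

definition c :: "real \<Rightarrow> real \<Rightarrow> real \<Rightarrow> real" where
  "c p a b = cert_equiv R (bin_act (event p) a b)"

lemma cert_equiv_bin: assumes "A \<in> sets P" shows "cert_equiv R (bin_act A a b) = c (prob A) a b"
  unfolding c_def using assms event[of "prob A"]
  by (intro cert_equiv_cong_cdf) (auto simp: act_cdf_bin)

lemma c_swap: assumes "p \<in> {0..1}" shows "c (1 - p) a b = c p b a"
  unfolding c_def using assms event[of p] event[of "1 - p"]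
  by (intro cert_equiv_cong_cdf) (auto simp: act_cdf_bin)

lemma c_const: "p \<in> {0..1} \<Longrightarrow> c p a a = a"
  unfolding c_def using event[of p] cert_equiv_cong_cdf[of "bin_act (event p) a a" "const_act a"]
  by (auto simp: act_cdf_bin act_cdf_const)

lemma c_1: "c 1 a b = a"
  unfolding c_def using event[of 1] cert_equiv_cong_cdf[of "bin_act (event 1) a b" "const_act a"]
  by (auto simp: act_cdf_bin act_cdf_const)

lemma c_0: "c 0 a b = b" using c_swap[of 1 a b] by (simp add: c_1)

lemma c_less1: assumes "p \<in> {0<..<1}" "a < a'" shows "c p a b < c p a' b"
proof -
  have p: "p \<in> {0..1}" using assms by auto
  have "strict_pref R (bin_act (event p) a' b) (bin_act (event p) a b)"
    using assms event[OF p] by (intro dominance(2)[of _ _ a]) (auto simp: act_cdf_bin)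
  then show ?thesis unfolding c_def by (simp add: strict_pref_iff event[OF p])
qed

lemma c_less2: assumes "p \<in> {0<..<1}" "b < b'" shows "c p a b < c p a b'"
  using c_less1[of "1 - p" b b' a] assms by (simp add: c_swap)

text \<open>At either outcome the distribution function jumps by at least
  \<open>min p (1 - p)\<close>. Weak convergence tests continuity points only, and away from the
  outcomes the indicators in the distribution function do converge.\<close>

lemma isCont_bin_cdf:
  assumes p: "p \<in> {0<..<1}" and "isCont (act_cdf W P (bin_act (event p) a b)) z"
  shows "z \<noteq> a" "z \<noteq> b"
proof -
  have pin: "p \<in> {0..1}" using p by auto
  let ?F = "act_cdf W P (bin_act (event p) a b)"
  have jump: "\<exists>\<delta>>0. \<forall>y<z. ?F y \<le> ?F z - \<delta>" if "z = a \<or> z = b"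
    using that p event[OF pin] by (intro exI[of _ "min p (1 - p)"]) (auto simp: act_cdf_bin)
  have "\<not> (z = a \<or> z = b)"
  proof
    assume "z = a \<or> z = b"
    then obtain \<delta> where \<delta>: "\<delta> > 0" "\<And>y. y < z \<Longrightarrow> ?F y \<le> ?F z - \<delta>" using jump by blast
    have "(\<lambda>n. z - 1 / real (Suc n)) \<longlonglongrightarrow> z - 0"
      by (intro tendsto_intros LIMSEQ_Suc lim_1_over_n)
    then have "(\<lambda>n. ?F (z - 1 / real (Suc n))) \<longlonglongrightarrow> ?F z"
      using isCont_tendsto_compose[OF assms(2)] by simp
    then have "?F z \<le> ?F z - \<delta>" by (rule LIMSEQ_le_const2) (use \<delta> in auto)
    then show False using \<delta>(1) by simp
  qed
  then show "z \<noteq> a" "z \<noteq> b" by auto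
qed

lemma unif_bounded_bin:
  assumes "bounded (range f)" "bounded (range g)"
  shows "unif_bounded W P (\<lambda>n. bin_act (A n) (f n) (g n))"
proof -
  obtain K L where "\<And>n. \<bar>f n\<bar> \<le> K" "\<And>n. \<bar>g n\<bar> \<le> L" using assms unfolding bounded_real by blast
  then show ?thesis unfolding unif_bounded_def bin_act_def
    by (intro exI[of _ "max K L"]) (auto simp: le_max_iff_disj)
qed

lemma c_continuous: assumes p: "p \<in> {0<..<1}" shows "continuous_on UNIV (\<lambda>(a, b). c p a b)"
  unfolding continuous_on_sequentially
proof (intro allI ballI impI)
  have pin: "p \<in> {0..1}" using p by auto
  fix x :: "nat \<Rightarrow> real \<times> real" and y assume "(\<forall>n. x n \<in> UNIV) \<and> x \<longlonglongrightarrow> y"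
  then have "(\<lambda>n. fst (x n)) \<longlonglongrightarrow> fst y" "(\<lambda>n. snd (x n)) \<longlonglongrightarrow> snd y"
    by (auto intro: tendsto_fst tendsto_snd)
  then obtain f g a b where fg: "x = (\<lambda>n. (f n, g n))" "y = (a, b)" "f \<longlonglongrightarrow> a" "g \<longlonglongrightarrow> b"
    by (rule that[of "\<lambda>n. fst (x n)" "\<lambda>n. snd (x n)" "fst y" "snd y", rotated 2]) auto
  have "(\<lambda>n. cert_equiv R (bin_act (event p) (f n) (g n))) \<longlonglongrightarrow> cert_equiv R (bin_act (event p) a b)"
  proof (rule cert_equiv_tendsto)
    show "weak_conv (\<lambda>n. act_cdf W P (bin_act (event p) (f n) (g n))) (act_cdf W P (bin_act (event p) a b))"
      unfolding weak_conv_def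
    proof (intro allI impI)
      fix z assume "isCont (act_cdf W P (bin_act (event p) a b)) z"
      then have "a \<noteq> z" "b \<noteq> z" using isCont_bin_cdf[OF p] by blast+
      then show "(\<lambda>n. act_cdf W P (bin_act (event p) (f n) (g n)) z) \<longlonglongrightarrow> act_cdf W P (bin_act (event p) a b) z"
        unfolding act_cdf_bin[OF event(1)[OF pin]] using fg by (intro tendsto_intros of_bool_tendsto)
    qed
    show "unif_bounded W P (\<lambda>n. bin_act (event p) (f n) (g n))"
      using fg by (intro unif_bounded_bin convergent_imp_bounded)
  qed (use event[OF pin] in auto)
  then show "((\<lambda>(a, b). c p a b) \<circ> x) \<longlonglongrightarrow> (case y of (a, b) \<Rightarrow> c p a b)"
    by (simp add: c_def fg o_def)
qed

lemma c_tendsto: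
  assumes "q \<longlonglongrightarrow> p" "\<And>n. q n \<in> {0..1}" "p \<in> {0..1}"
  shows "(\<lambda>n. c (q n) a b) \<longlonglongrightarrow> c p a b"
  unfolding c_def
proof (rule cert_equiv_tendsto)
  show "weak_conv (\<lambda>n. act_cdf W P (bin_act (event (q n)) a b)) (act_cdf W P (bin_act (event p) a b))"
    unfolding weak_conv_def act_cdf_bin[OF event(1)[OF assms(2)]] act_cdf_bin[OF event(1)[OF assms(3)]]
      event(2)[OF assms(2)] event(2)[OF assms(3)]
    using assms(1) by (auto intro!: tendsto_intros)
qed (use event assms in \<open>auto intro!: unif_bounded_bin\<close>)

lemma comonotonic_bin:
  "\<lbrakk>y \<le> x; y' \<le> x'\<rbrakk> \<Longrightarrow> comonotonic W P (bin_act A x y) (bin_act A x' y')"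
  by (auto simp: comonotonic_def bin_act_def intro: mult_nonpos_nonpos)

lemma sub_act_bin:
  "B \<in> sets P \<Longrightarrow> sub_act R (bin_act A x y) B (bin_act A x' y') = bin_act A (c (prob B) x x') (c (prob B) y y')"
  by (auto simp: sub_act_def bin_act_def cert_equiv_bin[unfolded bin_act_def] fun_eq_iff)

text \<open>A8 for the events of probability \<open>p\<close> and \<open>q\<close>, expressed
  through certainty equivalents. Strict dominance makes every event of probability strictly between
  0 and 1 essential.\<close>

lemma c_substitution:
  assumes p: "p \<in> {0<..<1}" and q: "q \<in> {0..1}" and "y \<le> x" "y' \<le> x'" "y'' \<le> x''"
    and "(x'' \<le> x \<and> x'' \<le> x' \<and> y'' \<le> y \<and> y'' \<le> y') \<or> (x \<le> x'' \<and> x' \<le> x'' \<and> y \<le> y'' \<and> y' \<le> y'')"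
    and "c p x' y' \<le> c p x y"
  shows "c p (c q x' x'') (c q y' y'') \<le> c p (c q x x'') (c q y y'')"
proof -
  have pin: "p \<in> {0..1}" using p by auto
  note ep = event[OF pin] and eq = event[OF q]
  have "essential P R (event p)"
    unfolding essential_def using c_less1[OF p, of 0 1 0] c_less2[OF p, of 0 1 1] c_const[OF pin]
    by (intro conjI exI[of _ "1::real"] exI[of _ "0::real"])
       (auto simp: strict_pref_iff ep cert_equiv_bin)
  moreover have "R (bin_act (event p) x y) (bin_act (event p) x' y')"
    using assms by (simp add: pref_iff ep cert_equiv_bin)
  ultimately have "R (sub_act R (bin_act (event p) x y) (event q) (bin_act (event p) x'' y''))
      (sub_act R (bin_act (event p) x' y') (event q) (bin_act (event p) x'' y''))"
    using A8[unfolded A8_def Let_def, rule_format, of "event p" "event q" x y x' y' x'' y''] assms(3-6) eq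
    by (simp add: comonotonic_bin)
  then show ?thesis by (simp add: sub_act_bin eq ep pref_iff cert_equiv_bin)
qed

lemma c_le: assumes "p \<in> {0<..<1}" "b \<le> a" shows "b \<le> c p a b" "c p a b \<le> a"
  using assms c_less1[of p b a b] c_less2[of p b a a] c_const[of p a] c_const[of p b]
  by (cases "a = b"; auto)+

text \<open>First \<open>(a, b)\<close> is replaced by its certainty equivalent, then \<open>(g, d)\<close>; \<open>g \<le> b\<close> provides the
  dominance that A8 demands.\<close>
lemma c_bisym_aux:
  assumes p: "p \<in> {0<..<1}" and q: "q \<in> {0<..<1}" and o: "b \<le> a" "g \<le> a" "d \<le> b" "d \<le> g" "g \<le> b"
  shows "c p (c q a g) (c q b d) = c q (c p a b) (c p g d)"
proof -
  have pin: "p \<in> {0..1}" "q \<in> {0..1}" "1 - q \<in> {0..1}" using p q by auto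
  let ?m = "c p a b" and ?n = "c p g d"
  have m: "b \<le> ?m" "?m \<le> a" "d \<le> ?n" "?n \<le> g" using c_le[OF p] o by auto
  have "c p (c q a g) (c q b d) = c p (c q ?m g) (c q ?m d)"
    by (intro antisym c_substitution[OF p pin(2)]) (use m o pin in \<open>auto simp: c_const\<close>)
  \<comment> \<open>In A8 the acts being compared occupy the first slot of the mixture, so the slots
    are exchanged by passing to the complementary probability.\<close>
  also have "\<dots> = c p (c (1 - q) g ?m) (c (1 - q) d ?m)" using pin by (simp add: c_swap)
  also have "\<dots> = c p (c (1 - q) ?n ?m) (c (1 - q) ?n ?m)"
    by (intro antisym c_substitution[OF p pin(3)]) (use m o pin in \<open>auto simp: c_const\<close>)
  also have "\<dots> = c q ?m ?n" using pin by (simp add: c_const c_swap)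
  finally show ?thesis .
qed

text \<open>The order assumptions do not compare \<open>b\<close> with \<open>g\<close>, but
  interchanging \<open>p\<close> with \<open>q\<close> and \<open>b\<close> with \<open>g\<close>
  swaps the two sides of the equation, so \<open>g \<le> b\<close> is no restriction. Any interior
  probability could serve as the distinguished index.\<close>

sublocale comonotone_means c "{0<..<1}" "1 / 2"
proof
  show "c p (c q a g) (c q b d) = c q (c p a b) (c p g d)"
    if "p \<in> {0<..<1}" "q \<in> {0<..<1}" "b \<le> a" "g \<le> a" "d \<le> b" "d \<le> g" for p q a b g d
  proof (cases "g \<le> b")
    case True
    show ?thesis by (rule c_bisym_aux) (use that True in simp_all)
  next
    case False
    show ?thesis by (rule c_bisym_aux[symmetric]) (use that False in simp_all)
  qed
qed (auto simp: c_const c_less1 c_less2 c_continuous)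

lemma biseparable_exists: "\<exists>\<phi> U \<rho>. biseparable W P R U \<rho> \<phi>"
proof -
  obtain \<phi> r :: "real \<Rightarrow> real" where sm: "strict_mono \<phi>" and ct: "continuous_on UNIV \<phi>" and
    af: "\<And>p x y. \<lbrakk>p \<in> {0<..<1}; y \<le> x\<rbrakk> \<Longrightarrow> \<phi> (c p x y) = r p * \<phi> x + (1 - r p) * \<phi> y"
    using representation by blast
  \<comment> \<open>The representation covers only the open unit interval; null and almost sure
    events get the weights 0 and 1.\<close>
  define \<rho> :: "real \<Rightarrow> real" where "\<rho> p = (if p = 1 then 1 else if p = 0 then 0 else r p)" for p
  have r: "0 < r p \<and> r p < 1" if p: "p \<in> {0<..<1}" for p
  proof -
    have "\<phi> 0 < \<phi> (c p 1 0)" "\<phi> (c p 1 0) < \<phi> 1"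
      using c_less1[OF p, of 0 1 0] c_less2[OF p, of 0 1 1] p sm by (auto simp: c_const strict_mono_less)
    then have "r p * (\<phi> 1 - \<phi> 0) > 0" "(1 - r p) * (\<phi> 1 - \<phi> 0) > 0" "\<phi> 1 > \<phi> 0"
      using af[OF p, of 0 1] by (auto simp: algebra_simps)
    then show ?thesis by (simp add: zero_less_mult_iff)
  qed
  have "biseparable W P R (\<lambda>v. \<phi> (cert_equiv R v)) \<rho> \<phi>"
    unfolding biseparable_def
  proof (intro conjI ballI allI impI)
    have "0 \<le> \<rho> p \<and> \<rho> p \<le> 1" if "p \<in> {0..1}" for p
      using r[of p] that by (cases "p = 0 \<or> p = 1") (auto simp: \<rho>_def)
    then show "\<rho> \<in> {0..1} \<rightarrow> {0..1}" by auto
    have "(1/2::real) \<in> {0<..<1}" by simp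
    then have "\<rho> (1/2) \<noteq> 0" "\<rho> (1/2) \<noteq> 1" using r[of "1/2"] by (auto simp: \<rho>_def)
    then show "\<not> (\<forall>p\<in>{0<..<1}. \<rho> p = 0)" "\<not> (\<forall>p\<in>{0<..<1}. \<rho> p = 1)" using \<open>1/2 \<in> {0<..<1}\<close> by blast+
    fix A t x assume A: "A \<in> sets P" "x \<le> (t::real)"
    consider "prob A = 1" | "prob A = 0" | "prob A \<in> {0<..<1}"
      using measure_nonneg[of P A] prob_le_1[of A]
      by (cases "prob A = 0"; cases "prob A = 1") (auto simp: less_le)
    then show "\<phi> (cert_equiv R (bin_act A t x)) = \<phi> t * \<rho> (prob A) + \<phi> x * (1 - \<rho> (prob A))"
      by cases (use A in \<open>auto simp: cert_equiv_bin \<rho>_def c_0 c_1 af\<close>)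
  qed (use sm ct in \<open>auto simp: pref_iff strict_mono_less_eq\<close>)
  then show ?thesis by blast
qed

end

subsection \<open>Finitely additive probabilities from cones of simple functions\<close>

locale acceptance_cone =
  fixes W :: "'w measure" and C :: "('w \<Rightarrow> real) set"
  assumes simple: "f \<in> C \<Longrightarrow> simple_function W f"
    and nonneg: "\<lbrakk>simple_function W f; \<And>w. w \<in> space W \<Longrightarrow> 0 \<le> f w\<rbrakk> \<Longrightarrow> f \<in> C"
    and add: "\<lbrakk>f \<in> C; g \<in> C\<rbrakk> \<Longrightarrow> (\<lambda>w. f w + g w) \<in> C"
    and scale: "\<lbrakk>f \<in> C; 0 < a\<rbrakk> \<Longrightarrow> (\<lambda>w. a * f w) \<in> C"
    and minus_one: "(\<lambda>_. - 1) \<notin> C"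
begin

lemma const_nonneg: "(\<lambda>_. k) \<in> C \<Longrightarrow> 0 \<le> k"
  using scale[of "\<lambda>_. k" "- 1 / k"] minus_one by (cases "k < 0") auto

lemma zero_in: "(\<lambda>_. 0) \<in> C" by (rule nonneg) auto

lemma bounded: 
  assumes "simple_function W f" obtains K where "\<And>w. w \<in> space W \<Longrightarrow> \<bar>f w\<bar> \<le> (K :: real)"
proof -
  have "bounded (f ` space W)" using assms by (simp add: simple_function_def finite_imp_bounded)
  then show ?thesis using that unfolding bounded_real by blast
qed

end

lemma simple_function_real_intros:
  fixes f g :: "'w \<Rightarrow> real"
  assumes "simple_function W f" "simple_function W g"
  shows "simple_function W (\<lambda>w. f w + g w)" "simple_function W (\<lambda>w. f w - g w)"
    "simple_function W (\<lambda>w. a * f w)" "simple_function W (\<lambda>w. f w + a)" "simple_function W (\<lambda>w. f w - a)"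
    "simple_function W (\<lambda>w. a - f w)" "simple_function W (\<lambda>w. - f w)"
  using assms by (auto intro: simple_function_compose2 simple_function_compose1)

definition simple_expectation :: "'w measure \<Rightarrow> ('w set \<Rightarrow> real) \<Rightarrow> ('w \<Rightarrow> real) \<Rightarrow> real" where
  "simple_expectation W \<mu> f = (\<Sum>y\<in>f ` space W. y * \<mu> (f -` {y} \<inter> space W))"

context acceptance_cone begin

text \<open>If neither \<open>g\<close> nor \<open>- g\<close> is in a maximal cone, then adjoining \<open>g\<close> produces \<open>- 1 = m + t g\<close> with
  \<open>t > 0\<close>, so that \<open>- g = (m + 1) / t\<close> is in the cone after all.\<close>
lemma maximal:
  obtains M where "acceptance_cone W M" "C \<subseteq> M"
    "\<And>f. simple_function W f \<Longrightarrow> f \<in> M \<or> (\<lambda>w. - f w) \<in> M"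
proof -
  define \<A> where "\<A> = {M. acceptance_cone W M \<and> C \<subseteq> M}"
  have "\<exists>M\<in>\<A>. \<forall>N\<in>\<A>. M \<subseteq> N \<longrightarrow> N = M"
  proof (rule subset_Zorn_nonempty)
    show "\<A> \<noteq> {}" using acceptance_cone_axioms by (auto simp: \<A>_def)
    fix \<C> assume ne: "\<C> \<noteq> {}" and chain: "subset.chain \<A> \<C>"
    have cone: "acceptance_cone W M" "C \<subseteq> M" if "M \<in> \<C>" for M
      using that chain by (auto simp: \<A>_def subset.chain_def)
    have dir: "\<exists>N\<in>\<C>. f \<in> N \<and> g \<in> N" if fg: "f \<in> \<Union> \<C>" "g \<in> \<Union> \<C>" for f g
    proof -
      obtain M N where "M \<in> \<C>" "N \<in> \<C>" "f \<in> M" "g \<in> N" using fg by blast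
      moreover have "M \<subseteq> N \<or> N \<subseteq> M" using chain calculation(1,2) unfolding subset_chain_def by blast
      ultimately show ?thesis by blast
    qed
    have "acceptance_cone W (\<Union> \<C>)"
    proof
      show "(\<lambda>w. f w + g w) \<in> \<Union> \<C>" if "f \<in> \<Union> \<C>" "g \<in> \<Union> \<C>" for f g
        using dir[OF that] acceptance_cone.add cone(1) by blast
      show "simple_function W f" if "f \<in> \<Union> \<C>" for f
        using that acceptance_cone.simple cone(1) by blast
      show "f \<in> \<Union> \<C>" if "simple_function W f" "\<And>w. w \<in> space W \<Longrightarrow> 0 \<le> f w" for f
        using ne nonneg[OF that] cone(2) by blast
      show "(\<lambda>w. a * f w) \<in> \<Union> \<C>" if "f \<in> \<Union> \<C>" "0 < a" for f a
        using that acceptance_cone.scale cone(1) by blast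
      show "(\<lambda>_. - 1) \<notin> \<Union> \<C>"
        using acceptance_cone.minus_one cone(1) by blast
    qed
    then show "\<Union> \<C> \<in> \<A>" using ne cone(2) by (auto simp: \<A>_def)
  qed
  then obtain M where M\<A>: "M \<in> \<A>" and max\<A>: "\<forall>N\<in>\<A>. M \<subseteq> N \<longrightarrow> N = M" by blast
  then have M: "acceptance_cone W M" "C \<subseteq> M" by (auto simp: \<A>_def)
  have max: "N = M" if "acceptance_cone W N" "M \<subseteq> N" for N
    using max\<A> that M(2) by (auto simp: \<A>_def)
  interpret M: acceptance_cone W M by (rule M)
  have "(\<lambda>w. - g w) \<in> M" if g: "simple_function W g" and nin: "g \<notin> M" for g
  proof -
    define N where "N = {\<lambda>w. m w + t * g w | m t. m \<in> M \<and> 0 \<le> t}"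
    have NI: "(\<lambda>w. m w + t * g w) \<in> N" if "m \<in> M" "0 \<le> t" for m t using that by (auto simp: N_def)
    have sub: "M \<subseteq> N" using NI[of _ 0] by auto
    have "g \<in> N" using NI[OF M.zero_in, of 1] by simp
    then have "\<not> acceptance_cone W N" using max[OF _ sub] nin by blast
    moreover have "acceptance_cone W N" if "(\<lambda>_. - 1) \<notin> N"
    proof
      show "simple_function W f" if "f \<in> N" for f
        using that M.simple g by (auto simp: N_def intro!: simple_function_real_intros)
      show "f \<in> N" if "simple_function W f" "\<And>w. w \<in> space W \<Longrightarrow> 0 \<le> f w" for f
        using M.nonneg[OF that] sub by auto
      show "(\<lambda>w. f w + g' w) \<in> N" if fg: "f \<in> N" "g' \<in> N" for f g'
      proof -
        obtain m t m' t' where "f = (\<lambda>w. m w + t * g w)" "g' = (\<lambda>w. m' w + t' * g w)"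
          "m \<in> M" "0 \<le> t" "m' \<in> M" "0 \<le> t'" using fg by (auto simp: N_def)
        then show ?thesis using NI[OF M.add[of m m'], of "t + t'"] by (simp add: algebra_simps)
      qed
      show "(\<lambda>w. a * f w) \<in> N" if fa: "f \<in> N" "0 < a" for f a
      proof -
        obtain m t where "f = (\<lambda>w. m w + t * g w)" "m \<in> M" "0 \<le> t" using fa by (auto simp: N_def)
        then show ?thesis using NI[OF M.scale[of m a], of "a * t"] fa(2) by (simp add: algebra_simps)
      qed
    qed (use that in auto)
    ultimately have "(\<lambda>_. - 1) \<in> N" by blast
    then obtain m t where m: "m \<in> M" "0 \<le> t" "(\<lambda>_. - 1) = (\<lambda>w. m w + t * g w)"
      unfolding N_def by blast
    then have "t \<noteq> 0" using M.minus_one by auto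
    have "(\<lambda>_. 1) \<in> M" by (rule M.nonneg) auto
    then have "(\<lambda>w. (1 / t) * (m w + 1)) \<in> M" using m \<open>t \<noteq> 0\<close> by (intro M.scale M.add) auto
    moreover have "(1 / t) * (m w + 1) = - g w" for w
      using fun_cong[OF m(3), of w] \<open>t \<noteq> 0\<close> by (simp add: field_simps)
    ultimately show ?thesis by simp
  qed
  then show ?thesis using that M by blast
qed

text \<open>In a maximal cone \<open>M\<close> each simple \<open>f\<close> defines a Dedekind cut:
  \<open>f - k\<close> is in \<open>M\<close> for \<open>k\<close> below \<open>L f\<close>, and by
  the dichotomy of \<open>maximal\<close>, \<open>k - f\<close> is in \<open>M\<close> for
  \<open>k\<close> above it. Linearity of \<open>L\<close> is then the arithmetic of cuts.\<close>

lemma functional: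
  obtains L where
    "\<And>f g. \<lbrakk>simple_function W f; simple_function W g\<rbrakk> \<Longrightarrow> L (\<lambda>w. f w + g w) = L f + L g"
    "\<And>f a. simple_function W f \<Longrightarrow> L (\<lambda>w. a * f w) = a * L f"
    "L (\<lambda>_. 1) = (1 :: real)" "\<And>f. f \<in> C \<Longrightarrow> 0 \<le> L f"
proof -
  obtain M where M: "acceptance_cone W M" "C \<subseteq> M"
    and dich: "\<And>f. simple_function W f \<Longrightarrow> f \<in> M \<or> (\<lambda>w. - f w) \<in> M" using maximal by blast
  interpret M: acceptance_cone W M by (rule M)
  define L where "L f = Sup {k. (\<lambda>w. f w - k) \<in> M}" for f
  note si = simple_function_real_intros
  have le: "k \<le> l" if "(\<lambda>w. f w - k) \<in> M" "(\<lambda>w. l - f w) \<in> M" for f k l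
    using M.const_nonneg[of "l - k"] M.add[OF that] by simp
  have ne: "{k. (\<lambda>w. f w - k) \<in> M} \<noteq> {}" and bdd: "bdd_above {k. (\<lambda>w. f w - k) \<in> M}"
    if f: "simple_function W f" for f
  proof -
    obtain K where K: "\<And>w. w \<in> space W \<Longrightarrow> \<bar>f w\<bar> \<le> K" using bounded[OF f] by blast
    have "(\<lambda>w. f w - (- K)) \<in> M" by (rule M.nonneg) (use K f in \<open>force intro: si simp: abs_le_iff\<close>)+
    then show "{k. (\<lambda>w. f w - k) \<in> M} \<noteq> {}" by blast
    have "(\<lambda>w. K - f w) \<in> M" by (rule M.nonneg) (use K f in \<open>force intro: si simp: abs_le_iff\<close>)+
    then show "bdd_above {k. (\<lambda>w. f w - k) \<in> M}" using le by (auto simp: bdd_above_def)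
  qed
  have low: "(\<lambda>w. f w - k) \<in> M" if f: "simple_function W f" and "k < L f" for f k
  proof -
    obtain k' where k': "k < k'" "(\<lambda>w. f w - k') \<in> M"
      using \<open>k < L f\<close> less_cSup_iff[OF ne[OF f] bdd[OF f]] unfolding L_def by blast
    have "(\<lambda>w. (f w - k') + (k' - k)) \<in> M" by (intro M.add k' M.nonneg) (use k' in auto)
    then show ?thesis by simp
  qed
  have up: "(\<lambda>w. k - f w) \<in> M" if f: "simple_function W f" and "L f < k" for f k
  proof -
    have "(\<lambda>w. f w - k) \<notin> M" using that cSup_upper[OF _ bdd[OF f], of k] unfolding L_def by auto
    then show ?thesis using dich[of "\<lambda>w. f w - k"] f by (auto intro: si)
  qed
  \<comment> \<open>\<open>M\<close> need not be closed, so nothing is asked at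
    \<open>k = l\<close>; the two one-sided conditions already pin down the cut.\<close>
  have eqI: "L f = l" if f: "simple_function W f"
    and 1: "\<And>k. k < l \<Longrightarrow> (\<lambda>w. f w - k) \<in> M" and 2: "\<And>k. l < k \<Longrightarrow> (\<lambda>w. k - f w) \<in> M" for f l
  proof (rule antisym)
    show "L f \<le> l" unfolding L_def
    proof (rule cSup_least[OF ne[OF f]], rule ccontr)
      fix k assume "k \<in> {k. (\<lambda>w. f w - k) \<in> M}" "\<not> k \<le> l"
      then show False using le[of f k "(k + l) / 2"] 2[of "(k + l) / 2"] by auto
    qed
    show "l \<le> L f"
    proof (rule dense_le)
      show "k \<le> L f" if "k < l" for k
        using cSup_upper[OF _ bdd[OF f], of k] 1[OF that] unfolding L_def by blast
    qed
  qed
  have half: "\<exists>a b. a < x \<and> b < y \<and> a + b = k" if "k < x + y" for x y k :: real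
    using that by (intro exI[of _ "x - (x + y - k) / 2"] exI[of _ "y - (x + y - k) / 2"]) (auto simp: field_simps)
  show ?thesis
  proof
    show Ladd: "L (\<lambda>w. f w + g w) = L f + L g" if "simple_function W f" "simple_function W g" for f g
    proof (rule eqI)
      fix k
      { assume "k < L f + L g"
        then obtain a b where ab: "a < L f" "b < L g" "a + b = k" using half by blast
        then show "(\<lambda>w. f w + g w - k) \<in> M"
          using M.add[OF low[OF that(1) ab(1)] low[OF that(2) ab(2)]] by (simp add: algebra_simps) }
      { assume "L f + L g < k"
        then have "- k < - L f + - L g" by simp
        then obtain a b where "a < - L f" "b < - L g" "a + b = - k" using half by blast
        then have ab: "L f < - a" "L g < - b" "k = - a + - b" by auto
        show "(\<lambda>w. k - (f w + g w)) \<in> M"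
          using M.add[OF up[OF that(1) ab(1)] up[OF that(2) ab(2)]] unfolding ab(3) by (simp add: algebra_simps) }
    qed (use that in \<open>auto intro: si\<close>)
    have L0: "L (\<lambda>_. 0) = 0" by (rule eqI) (auto intro: M.nonneg)
    have pos: "L (\<lambda>w. a * f w) = a * L f" if f: "simple_function W f" and "0 < a" for f a
    proof (rule eqI)
      fix k
      { assume "k < a * L f"
        then have "k / a < L f" using that by (simp add: field_simps)
        then show "(\<lambda>w. a * f w - k) \<in> M"
          using M.scale[OF low[OF f] \<open>0 < a\<close>, of "k / a"] that by (simp add: algebra_simps) }
      { assume "a * L f < k"
        then have "L f < k / a" using that by (simp add: field_simps)
        then show "(\<lambda>w. k - a * f w) \<in> M"
          using M.scale[OF up[OF f] \<open>0 < a\<close>, of "k / a"] that by (simp add: algebra_simps) }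
    qed (use f in \<open>auto intro: si\<close>)
    show "L (\<lambda>w. a * f w) = a * L f" if f: "simple_function W f" for f a
    proof -
      consider "a = 0" | "0 < a" | "a < 0" by linarith
      then show ?thesis
      proof cases
        case 3
        have "L (\<lambda>w. a * f w + (- a) * f w) = L (\<lambda>w. a * f w) + (- a) * L f"
          using 3 f pos[OF f, of "- a"] by (subst Ladd) (auto intro: si)
        then show ?thesis using L0 by simp
      qed (use L0 pos f in auto)
    qed
    show "L (\<lambda>_. 1) = 1" by (rule eqI) (auto intro: M.nonneg)
    show "0 \<le> L f" if "f \<in> C" for f
      using cSup_upper[OF _ bdd[OF simple[OF that]], of 0] that M(2) unfolding L_def by auto
  qed
qed

text \<open>\<open>\<mu>\<close> is the functional restricted to indicators. It reproduces the
  functional on simple functions, whose properties can therefore be stated for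
  \<open>simple_expectation\<close>.\<close>

lemma fa_probability:
  "\<exists>\<mu>\<in>fa_probs W.
     (\<forall>f g. simple_function W f \<longrightarrow> simple_function W g \<longrightarrow> (\<forall>w\<in>space W. f w \<le> g w) \<longrightarrow>
        simple_expectation W \<mu> f \<le> simple_expectation W \<mu> g) \<and>
     (\<forall>f a. simple_function W f \<longrightarrow>
        simple_expectation W \<mu> (\<lambda>w. f w - a) = simple_expectation W \<mu> f - a) \<and>
     (\<forall>k. simple_expectation W \<mu> (\<lambda>_. k) = k) \<and> (\<forall>f\<in>C. 0 \<le> simple_expectation W \<mu> f)"
proof -
  obtain L where Ladd: "\<And>f g. \<lbrakk>simple_function W f; simple_function W g\<rbrakk> \<Longrightarrow> L (\<lambda>w. f w + g w) = L f + L g"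
    and Lscale: "\<And>f a. simple_function W f \<Longrightarrow> L (\<lambda>w. a * f w) = a * L f"
    and L1: "L (\<lambda>_. 1) = (1 :: real)" and Lpos: "\<And>f. f \<in> C \<Longrightarrow> 0 \<le> L f" using functional by blast
  note si = simple_function_real_intros
  define \<mu> where "\<mu> A = L (indicat_real A)" for A
  have Lconst: "L (\<lambda>_. k) = k" for k using Lscale[of "\<lambda>_. 1" k] L1 by simp
  have Ldiff: "L (\<lambda>w. g w - f w) = L g - L f" if "simple_function W f" "simple_function W g" for f g
    using Ladd[of g "\<lambda>w. (- 1) * f w"] Lscale[of f "- 1"] that by (auto intro: si)
  have Lmono: "L f \<le> L g"
    if "simple_function W f" "simple_function W g" "\<And>w. w \<in> space W \<Longrightarrow> f w \<le> g w" for f g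
    using Lpos[OF nonneg[of "\<lambda>w. g w - f w"]] Ldiff[of f g] that by (auto intro: si)
  have Lsum: "L (\<lambda>w. \<Sum>y\<in>F. y * indicat_real (A y) w) = (\<Sum>y\<in>F. y * \<mu> (A y))"
    if "finite F" "\<And>y. y \<in> F \<Longrightarrow> A y \<in> sets W" for F A
    using that
  proof (induction F rule: finite_induct)
    case empty
    then show ?case by (simp add: Lconst)
  next
    case (insert y F)
    have ind: "simple_function W (indicat_real (A z))" if "z \<in> insert y F" for z
      using insert.prems that by auto
    have "simple_function W (\<lambda>w. \<Sum>y\<in>F. y * indicat_real (A y) w)"
      using insert.prems by (intro simple_function_sum si(3)[OF ind ind]) auto
    then have "L (\<lambda>w. y * indicat_real (A y) w + (\<Sum>y\<in>F. y * indicat_real (A y) w)) =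
        L (\<lambda>w. y * indicat_real (A y) w) + L (\<lambda>w. \<Sum>y\<in>F. y * indicat_real (A y) w)"
      using ind by (intro Ladd) (auto intro: si)
    moreover have "L (\<lambda>w. \<Sum>y\<in>F. y * indicat_real (A y) w) = (\<Sum>y\<in>F. y * \<mu> (A y))"
      by (rule insert.IH) (use insert.prems in blast)
    ultimately show ?case
      by (simp only: sum.insert[OF insert.hyps] Lscale[OF ind[OF insertI1]] \<mu>_def)
  qed
  have Lrep: "simple_expectation W \<mu> f = L f" if f: "simple_function W f" for f
  proof -
    have fin: "finite (f ` space W)" and meas: "\<And>y. y \<in> f ` space W \<Longrightarrow> f -` {y} \<inter> space W \<in> sets W"
      using f by (auto simp: simple_function_def)
    let ?g = "\<lambda>w. \<Sum>y\<in>f ` space W. y * indicat_real (f -` {y} \<inter> space W) w"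
    have "simple_function W ?g"
      using meas by (intro simple_function_sum si(3)) auto
    moreover have "?g w = f w" if "w \<in> space W" for w
    proof -
      have "?g w = (\<Sum>y\<in>f ` space W. if f w = y then y else 0)"
        using that by (intro sum.cong) (auto simp: indicator_def)
      then show ?thesis using fin that by simp
    qed
    \<comment> \<open>\<open>f\<close> and its standard form agree only on \<open>space W\<close>;
      as positivity looks at \<open>space W\<close> alone, monotonicity in both directions
      identifies their values.\<close>
    ultimately have "L f = L ?g" using f by (intro antisym Lmono) auto
    then show ?thesis using Lsum[OF fin meas] by (simp add: simple_expectation_def)
  qed
  have "\<mu> \<in> fa_probs W"
  proof -
    have "0 \<le> \<mu> A" if "A \<in> sets W" for A unfolding \<mu>_def using that by (intro Lpos nonneg) auto
    moreover have "\<mu> (A \<union> B) = \<mu> A + \<mu> B" if "A \<in> sets W" "B \<in> sets W" "A \<inter> B = {}" for A B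
    proof -
      have "indicat_real (A \<union> B) = (\<lambda>w. indicator A w + indicator B w)"
        using that by (auto simp: indicator_def fun_eq_iff)
      then show ?thesis unfolding \<mu>_def using that by (simp add: Ladd)
    qed
    moreover have "\<mu> (space W) = 1"
    proof -
      have "L (indicat_real (space W)) = L (\<lambda>_. 1)" by (intro antisym Lmono) auto
      then show ?thesis by (simp add: \<mu>_def L1)
    qed
    ultimately show ?thesis by (simp add: fa_probs_def additive_def)
  qed
  moreover have "L (\<lambda>w. f w - a) = L f - a" if "simple_function W f" for f a
    using Ldiff[of "\<lambda>_. a" f] that by (simp add: Lconst)
  ultimately show ?thesis
    using Lmono Lconst Lpos simple
    by (intro bexI[of _ \<mu>]) (auto simp: Lrep simple_function_real_intros)
qed

end

subsection \<open>Rank-dependent utility\<close>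

locale ambiguity_preference = risk_preference P W R
  for P :: "'s measure" and W :: "'w measure" and R :: "('w, 's) pref" +
  assumes A5: "A5 W P R" and A6: "A6 W P R" and A7: "A7 W P R"
begin

text \<open>Subtracting the value at 0 turns the subjective sum into addition of utils and the
  subjective mixture into a convex combination, for the very utility that occurs in A6 and
  A7.\<close>

definition \<phi> :: "real \<Rightarrow> real" where "\<phi> x = utility W P R x - utility W P R 0"

definition rng :: "real set" where "rng = range \<phi>"

text \<open>Since \<open>\<phi> 0 = 0\<close>, this is the weight that the biseparable
  representation gives to the larger outcome when its probability is \<open>p\<close>.\<close>

definition \<psi> :: "real \<Rightarrow> real" where "\<psi> p = \<phi> (c p 1 0) / \<phi> 1"

text \<open>\<open>\<gamma>\<close> is the inverse of \<open>\<phi>\<close> and takes unspecified values outside \<open>rng\<close>.\<close>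
definition \<gamma> :: "real \<Rightarrow> real" where "\<gamma> = inv \<phi>"

lemma biseparable_utility: obtains U \<rho> where "biseparable W P R U \<rho> (utility W P R)"
  unfolding utility_def using someI_ex[OF biseparable_exists] that by blast

lemma strict_mono_\<phi>: "strict_mono \<phi>" and continuous_\<phi>: "continuous_on UNIV \<phi>"
proof -
  obtain U \<rho> where b: "biseparable W P R U \<rho> (utility W P R)" by (rule biseparable_utility)
  then have sm: "strict_mono (utility W P R)" by (simp add: biseparable_def)
  show "strict_mono \<phi>" by (rule strict_monoI) (use sm in \<open>auto simp: \<phi>_def strict_mono_less\<close>)
  show "continuous_on UNIV \<phi>" 
    using b unfolding \<phi>_def biseparable_def by (intro continuous_intros) auto
qed

lemma \<phi>_0 [simp]: "\<phi> 0 = 0" by (simp add: \<phi>_def)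

lemmas \<phi>_less_iff [simp] = strict_mono_less[OF strict_mono_\<phi>]
lemmas \<phi>_le_iff [simp] = strict_mono_less_eq[OF strict_mono_\<phi>]
lemmas \<phi>_eq_iff [simp] = strict_mono_eq[OF strict_mono_\<phi>]

lemma \<phi>_1: "0 < \<phi> 1" "\<phi> (- 1) < 0"
  using \<phi>_less_iff[of 0 1] \<phi>_less_iff[of "- 1" 0] by (simp_all del: \<phi>_less_iff)

lemma \<gamma>_\<phi> [simp]: "\<gamma> (\<phi> x) = x"
  unfolding \<gamma>_def using strict_mono_\<phi> by (simp add: inv_f_f strict_mono_imp_inj_on)

lemma \<phi>_\<gamma> [simp]: "y \<in> rng \<Longrightarrow> \<phi> (\<gamma> y) = y" by (auto simp: rng_def)

lemma \<phi>_in_rng [simp]: "\<phi> x \<in> rng" by (simp add: rng_def)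

lemma \<gamma>_0 [simp]: "\<gamma> 0 = 0" using \<gamma>_\<phi>[of 0] by (simp del: \<gamma>_\<phi>)

lemma zero_in_range [simp]: "0 \<in> rng" using \<phi>_in_rng[of 0] by (simp del: \<phi>_in_rng)

lemma range_between: assumes "a \<in> rng" "b \<in> rng" "a \<le> y" "y \<le> b" shows "y \<in> rng"
proof -
  obtain x z where xz: "a = \<phi> x" "b = \<phi> z" using assms by (auto simp: rng_def)
  then have "x \<le> z" using assms \<phi>_le_iff[of x z] by linarith
  then obtain t where "\<phi> t = y"
    using IVT'[of \<phi> x y z] assms xz continuous_on_subset[OF continuous_\<phi>] by auto
  then show ?thesis by (auto simp: rng_def)
qed

lemma range_nhd: obtains \<epsilon> where "\<epsilon> > 0" "\<And>y. \<bar>y\<bar> < \<epsilon> \<Longrightarrow> y \<in> rng"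
proof
  show "min (\<phi> 1) (- \<phi> (- 1)) > 0" using \<phi>_1 by auto
  show "y \<in> rng" if "\<bar>y\<bar> < min (\<phi> 1) (- \<phi> (- 1))" for y
    using that by (intro range_between[of "\<phi> (- 1)" "\<phi> 1" y]) (auto simp: abs_less_iff)
qed

lemma \<gamma>_le_iff: "\<lbrakk>x \<in> rng; y \<in> rng\<rbrakk> \<Longrightarrow> \<gamma> x \<le> \<gamma> y \<longleftrightarrow> x \<le> y"
  by (metis \<phi>_\<gamma> \<phi>_le_iff)

lemma \<phi>_c: assumes p: "p \<in> {0..1}" and "x \<le> t" shows "\<phi> (c p t x) = \<psi> p * \<phi> t + (1 - \<psi> p) * \<phi> x"
proof -
  let ?u = "utility W P R"
  obtain U \<rho> where b: "biseparable W P R U \<rho> ?u" by (rule biseparable_utility)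
  have U: "?u (c p t x) = ?u t * \<rho> p + ?u x * (1 - \<rho> p)" if "x \<le> t" for t x
  proof -
    have v: "bin_act (event p) t x \<in> V0 W P" using event[OF p] by auto
    have "R (const_act (c p t x)) (bin_act (event p) t x)" "R (bin_act (event p) t x) (const_act (c p t x))"
      using cert_equiv[OF v] by (auto simp: c_def indiff_def)
    then have "U (const_act (c p t x)) = U (bin_act (event p) t x)"
      using b v unfolding biseparable_def by (metis const_act_in order_antisym)
    then show ?thesis using b event[OF p] that unfolding biseparable_def by auto
  qed
  have "\<phi> (c p t x) = \<rho> p * \<phi> t + (1 - \<rho> p) * \<phi> x" if "x \<le> t" for t x
    using U[OF that] by (simp add: \<phi>_def algebra_simps)
  from this[of 0 1] this[OF assms(2)] show ?thesis using \<phi>_1 by (simp add: \<psi>_def)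
qed

lemma c_in_unit: "p \<in> {0..1} \<Longrightarrow> c p 1 0 \<in> {0..1}"
  using c_le[of p 0 1] by (cases "p = 0 \<or> p = 1") (auto simp: c_0 c_1)

lemma c_mono: assumes "p \<in> {0..1}" "q \<in> {0..1}" "p \<le> q" shows "c p 1 0 \<le> c q 1 0"
proof -
  have "R (bin_act (event q) 1 0) (bin_act (event p) 1 0)"
    using assms event[of p] event[of q] by (intro dominance) (auto simp: act_cdf_bin)
  then show ?thesis unfolding c_def using assms event by (simp add: pref_iff)
qed

lemma weighting_\<psi>: "weighting_function \<psi>"
  unfolding weighting_function_def
proof (intro conjI)
  have "0 \<le> \<psi> p \<and> \<psi> p \<le> 1" if "p \<in> {0..1}" for p
    using c_in_unit[OF that] \<phi>_1 \<phi>_le_iff[of 0 "c p 1 0"] \<phi>_le_iff[of "c p 1 0" 1]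
    by (simp add: \<psi>_def del: \<phi>_le_iff)
  then show "\<psi> \<in> {0..1} \<rightarrow> {0..1}" by auto
  show "mono_on {0..1} \<psi>"
    using c_mono \<phi>_1 by (auto intro!: mono_onI divide_right_mono simp: \<psi>_def)
  show "continuous_on {0..1} \<psi>" unfolding continuous_on_sequentially
  proof (intro allI ballI impI)
    fix q :: "nat \<Rightarrow> real" and p assume "p \<in> {0..1}" "(\<forall>n. q n \<in> {0..1}) \<and> q \<longlonglongrightarrow> p"
    then have "(\<lambda>n. c (q n) 1 0) \<longlonglongrightarrow> c p 1 0" by (intro c_tendsto) auto
    moreover have "isCont \<phi> (c p 1 0)" using continuous_\<phi> by (simp add: continuous_on_eq_continuous_at)
    ultimately have "(\<lambda>n. \<phi> (c (q n) 1 0)) \<longlonglongrightarrow> \<phi> (c p 1 0)" by (rule isCont_tendsto_compose[rotated])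
    then show "(\<psi> \<circ> q) \<longlonglongrightarrow> \<psi> p" using \<phi>_1 by (auto simp: o_def \<psi>_def intro!: tendsto_intros)
  qed
qed (use \<phi>_1 in \<open>simp_all add: \<psi>_def c_0 c_1\<close>)

section \<open>Acts measured in utils\<close>

lemma Vt0_iff: "v \<in> Vt0 W P \<longleftrightarrow> simple_function (W \<Otimes>\<^sub>M P) v"
  by (auto simp: Vt0_def Vt_def simple_function_borel_measurable borel_measurable_simple_function
      finite_imp_bounded dest: simple_functionD)

text \<open>\<open>ssum\<close> and \<open>smix\<close> are total functions whose values off the
  product space are uncontrolled; by A2 they can be exchanged for the intended acts.\<close>

lemma agree_indiff:
  assumes v: "v \<in> Vt0 W P" and eq: "\<And>\<omega>. \<omega> \<in> space (W \<Otimes>\<^sub>M P) \<Longrightarrow> u \<omega> = v \<omega>"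
  shows "u \<in> Vt0 W P" "indiff R v u"
proof -
  show u: "u \<in> Vt0 W P"
    using v eq unfolding Vt0_iff by (subst simple_function_cong[of _ u v]) auto
  have "cond_cdf P v w t = cond_cdf P u w t" if "w \<in> space W" for w t
  proof -
    have "{s \<in> space P. v (w, s) \<le> t} = {s \<in> space P. u (w, s) \<le> t}"
      using eq that by (auto simp: space_pair_measure)
    then show ?thesis by (simp add: cond_cdf_def)
  qed
  then show "indiff R v u" using A2 v u unfolding A2_def by blast
qed

lemma section_in: assumes "v \<in> Vt0 W P" "w \<in> space W" shows "lift (\<lambda>s. v (w, s)) \<in> V0 W P"
proof (rule lift_in)
  show "(\<lambda>s. v (w, s)) \<in> borel_measurable P"
    using assms by (auto simp: Vt0_def Vt_def intro: measurable_Pair2)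
  have "(\<lambda>s. v (w, s)) ` space P \<subseteq> v ` space (W \<Otimes>\<^sub>M P)" using assms by (auto simp: space_pair_measure)
  then show "finite ((\<lambda>s. v (w, s)) ` space P)"
    using assms by (auto simp: Vt0_def intro: finite_subset)
qed

lemma statewise:
  assumes "v \<in> Vt0 W P" "u \<in> Vt0 W P"
    "\<And>w. w \<in> space W \<Longrightarrow> R (lift (\<lambda>s. v (w, s))) (lift (\<lambda>s. u (w, s)))"
  shows "R v u"
proof -
  have "section_pref W P R w v u" if "w \<in> space W" for w
    unfolding section_pref_def using section_in[OF _ that] assms that
    by (intro bexI[of _ "lift (\<lambda>s. v (w, s))"] bexI[of _ "lift (\<lambda>s. u (w, s))"])
       (auto simp: act_cdf_def cond_cdf_def fun_eq_iff)
  then show ?thesis using A5 assms(1,2) unfolding A5_def by blast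
qed

lemma lift_mono:
  assumes "lift f \<in> V0 W P" "lift g \<in> V0 W P" "\<And>s. s \<in> space P \<Longrightarrow> g s \<le> f s"
  shows "R (lift f) (lift g)"
proof (rule dominance)
  obtain w where w: "w \<in> space W" using space_W by blast
  have meas: "h \<in> borel_measurable P" if "lift h \<in> V0 W P" for h
  proof -
    have "lift h \<in> borel_measurable (W \<Otimes>\<^sub>M P)" using that by (auto simp: V0_def Vt0_def Vt_def)
    then show ?thesis using measurable_Pair2[OF _ w, of "lift h" P borel] by simp
  qed
  fix z show "act_cdf W P (lift f) z \<le> act_cdf W P (lift g) z"
    unfolding act_cdf_def cond_cdf_def lift_apply
    using assms(3) meas[OF assms(2)] by (intro finite_measure_mono) (auto intro: order_trans)
qed (use assms in auto)

lemma pref_mono: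
  assumes "v \<in> Vt0 W P" "u \<in> Vt0 W P" "\<And>\<omega>. \<omega> \<in> space (W \<Otimes>\<^sub>M P) \<Longrightarrow> u \<omega> \<le> v \<omega>"
  shows "R v u"
proof (rule statewise[OF assms(1,2)])
  fix w assume w: "w \<in> space W"
  show "R (lift (\<lambda>s. v (w, s))) (lift (\<lambda>s. u (w, s)))"
    using section_in[OF assms(1) w] section_in[OF assms(2) w]
    by (rule lift_mono) (use assms(3) w in \<open>simp add: space_pair_measure\<close>)
qed

definition act :: "('w \<times> 's \<Rightarrow> real) \<Rightarrow> ('w, 's) act" where "act F = (\<lambda>\<omega>. \<gamma> (F \<omega>))"

lemma act_apply: "act F \<omega> = \<gamma> (F \<omega>)" by (simp add: act_def)

lemma const_act_apply: "const_act m \<omega> = m" by (simp add: const_act_def)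

abbreviation util :: "('w \<times> 's \<Rightarrow> real) \<Rightarrow> bool" where
  "util F \<equiv> simple_function (W \<Otimes>\<^sub>M P) F \<and> (\<forall>\<omega>\<in>space (W \<Otimes>\<^sub>M P). F \<omega> \<in> rng)"

lemma act_in: "util F \<Longrightarrow> act F \<in> Vt0 W P"
  unfolding Vt0_iff act_def by (rule simple_function_compose1) (rule conjunct1)

lemma const_act_eq: "const_act (\<gamma> k) = act (\<lambda>_. k)" by (simp add: const_act_def act_def)

lemma Vt0_const [simp]: "const_act m \<in> Vt0 W P" by (intro V0_Vt0) auto

text \<open>This is A7 for acts given by their utils. The conditions that sums stay in
  \<open>rng\<close> express the existence of the subjective sums, and comonotonicity passes from
  utils to outcomes because \<open>\<gamma>\<close> is increasing on \<open>rng\<close>.\<close>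

lemma independence:
  assumes F: "util F" and G: "util G" and K: "util K" "act K \<in> V0 W P"
    and FK: "util (\<lambda>\<omega>. F \<omega> + K \<omega>)" and GK: "util (\<lambda>\<omega>. G \<omega> + K \<omega>)"
    and com: "comonotonic W P F K" "comonotonic W P G K" and R: "R (act F) (act G)"
  shows "R (act (\<lambda>\<omega>. F \<omega> + K \<omega>)) (act (\<lambda>\<omega>. G \<omega> + K \<omega>))"
proof -
  let ?u = "utility W P R"
  have eq: "1/2 * ?u y + 1/2 * ?u 0 = 1/2 * ?u (\<gamma> a) + 1/2 * ?u (\<gamma> b) \<longleftrightarrow> y = \<gamma> (a + b)"
    if "a \<in> rng" "b \<in> rng" "a + b \<in> rng" for y a b
  proof -
    have "1/2 * ?u y + 1/2 * ?u 0 = 1/2 * ?u (\<gamma> a) + 1/2 * ?u (\<gamma> b) \<longleftrightarrow> \<phi> y = \<phi> (\<gamma> a) + \<phi> (\<gamma> b)"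
      by (auto simp: \<phi>_def)
    also have "\<dots> \<longleftrightarrow> y = \<gamma> (a + b)" using that by (metis \<gamma>_\<phi> \<phi>_\<gamma>)
    finally show ?thesis .
  qed
  have com': "comonotonic W P (act F) (act K)" if "comonotonic W P F K" "util F" "util K" for F K
    unfolding comonotonic_def
  proof (intro ballI)
    fix w s s' assume s: "w \<in> space W" "s \<in> space P" "s' \<in> space P"
    then have r: "F (w, s) \<in> rng" "F (w, s') \<in> rng" "K (w, s) \<in> rng" "K (w, s') \<in> rng"
      using that by (auto simp: space_pair_measure)
    have "0 \<le> (F (w, s') - F (w, s)) * (K (w, s') - K (w, s))"
      using that(1) s unfolding comonotonic_def by blast
    then show "0 \<le> (act F (w, s') - act F (w, s)) * (act K (w, s') - act K (w, s))"
      using \<gamma>_le_iff[OF r(1,2)] \<gamma>_le_iff[OF r(2,1)] \<gamma>_le_iff[OF r(3,4)] \<gamma>_le_iff[OF r(4,3)]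
      by (auto simp: zero_le_mult_iff act_def)
  qed
  have sum: "ssum ?u (act F) (act K) \<omega> = act (\<lambda>\<omega>. F \<omega> + K \<omega>) \<omega>"
    and ex: "ssum_exists W P ?u (act F) (act K)"
    if "\<omega> \<in> space (W \<Otimes>\<^sub>M P)" "util F" "util (\<lambda>\<omega>. F \<omega> + K \<omega>)" for F \<omega>
  proof -
    have e: "1/2 * ?u y + 1/2 * ?u 0 = 1/2 * ?u (act F \<omega>) + 1/2 * ?u (act K \<omega>) \<longleftrightarrow> y = \<gamma> (F \<omega> + K \<omega>)"
      if "\<omega> \<in> space (W \<Otimes>\<^sub>M P)" for y \<omega>
      unfolding act_apply using that \<open>util F\<close> \<open>util (\<lambda>\<omega>. F \<omega> + K \<omega>)\<close> K by (intro eq) auto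
    show "ssum ?u (act F) (act K) \<omega> = act (\<lambda>\<omega>. F \<omega> + K \<omega>) \<omega>"
      unfolding ssum_def e[OF that(1)] unfolding act_apply by simp
    show "ssum_exists W P ?u (act F) (act K)"
      unfolding ssum_exists_def using e by blast
  qed
  have S: "util F \<Longrightarrow> util (\<lambda>\<omega>. F \<omega> + K \<omega>) \<Longrightarrow> ssum ?u (act F) (act K) \<in> Vt0 W P \<and>
    indiff R (act (\<lambda>\<omega>. F \<omega> + K \<omega>)) (ssum ?u (act F) (act K))" for F
    using agree_indiff[OF act_in sum] by blast
  obtain \<omega> where \<omega>: "\<omega> \<in> space (W \<Otimes>\<^sub>M P)" using space_W not_empty by (auto simp: space_pair_measure)
  note S = S[OF F FK] S[OF G GK]
  have "R (ssum ?u (act F) (act K)) (ssum ?u (act G) (act K))"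
    by (rule A7[unfolded A7_def, rule_format, OF act_in[OF F] act_in[OF G] K(2) com'[OF com(1) F K(1)]
        com'[OF com(2) G K(1)] ex[OF \<omega> F FK] ex[OF \<omega> G GK] R])
  note 1 = this
  have 2: "R (act (\<lambda>\<omega>. F \<omega> + K \<omega>)) (ssum ?u (act F) (act K))"
    and 3: "R (ssum ?u (act G) (act K)) (act (\<lambda>\<omega>. G \<omega> + K \<omega>))"
    using S by (simp_all add: indiff_def)
  from S have in': "ssum ?u (act F) (act K) \<in> Vt0 W P" "ssum ?u (act G) (act K) \<in> Vt0 W P" by simp_all
  show ?thesis
    by (rule trans[OF trans[OF 2 1 act_in[OF FK] in'] 3 act_in[OF FK] in'(2) act_in[OF GK]])
qed

lemma ex_const_between:
  assumes F: "util F" and "l \<in> rng" "u \<in> rng" "\<And>\<omega>. \<omega> \<in> space (W \<Otimes>\<^sub>M P) \<Longrightarrow> l \<le> F \<omega> \<and> F \<omega> \<le> u"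
  obtains k where "k \<in> {l..u}" "k \<in> rng" "indiff R (const_act (\<gamma> k)) (act F)"
proof -
  have "\<exists>m\<in>{\<gamma> l..\<gamma> u}. indiff R (const_act m) (act F)"
    by (rule ex_indiff_const[OF act_in[OF F]]; rule pref_mono)
       (use assms act_in[OF F] \<gamma>_le_iff in \<open>auto simp: const_act_apply act_apply\<close>)
  then obtain m where m: "m \<in> {\<gamma> l..\<gamma> u}" "indiff R (const_act m) (act F)" by blast
  then have "\<phi> m \<in> {l..u}"
    using assms(2,3) \<phi>_le_iff[of "\<gamma> l" m] \<phi>_le_iff[of m "\<gamma> u"] \<phi>_\<gamma>[OF assms(2)] \<phi>_\<gamma>[OF assms(3)]
    by (simp del: \<phi>_le_iff)
  then show ?thesis using that[of "\<phi> m"] m by simp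
qed

lemma const_util_iff:
  "\<lbrakk>k \<in> rng; l \<in> rng\<rbrakk> \<Longrightarrow> R (const_act (\<gamma> k)) (const_act (\<gamma> l)) \<longleftrightarrow> l \<le> k"
  by (simp add: const_iff \<gamma>_le_iff)

lemma indiff_sym: "indiff R v u \<Longrightarrow> indiff R u v" by (auto simp: indiff_def)

lemma indiff_trans: "\<lbrakk>indiff R v u; indiff R u r; v \<in> Vt0 W P; u \<in> Vt0 W P; r \<in> Vt0 W P\<rbrakk> \<Longrightarrow> indiff R v r"
  using trans unfolding indiff_def by blast

text \<open>First \<open>F\<close> is replaced by the constant \<open>k\<close> with
  \<open>K\<close> as the common summand, then \<open>K\<close> by \<open>l\<close> with the
  constant \<open>k\<close> as the common summand, a constant being comonotonic with
  everything.\<close>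

lemma indiff_add:
  assumes F: "util F" and K: "util K" "act K \<in> V0 W P" and FK: "util (\<lambda>\<omega>. F \<omega> + K \<omega>)"
    and com: "comonotonic W P F K"
    and k: "k \<in> rng" "indiff R (act F) (const_act (\<gamma> k))"
    and l: "l \<in> rng" "indiff R (act K) (const_act (\<gamma> l))"
    and kK: "util (\<lambda>\<omega>. k + K \<omega>)" and kl: "k + l \<in> rng"
  shows "indiff R (act (\<lambda>\<omega>. F \<omega> + K \<omega>)) (const_act (\<gamma> (k + l)))"
proof -
  have const: "util (\<lambda>_. k)" "util (\<lambda>_. l)" "util (\<lambda>_. k + l)" "util (\<lambda>_. l + k)"
    using k l kl by (auto simp: add.commute)
  have com_const: "comonotonic W P G (\<lambda>_. a)" "comonotonic W P (\<lambda>_. a) G" for G and a :: real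
    by (auto simp: comonotonic_def)
  have "indiff R (act (\<lambda>\<omega>. F \<omega> + K \<omega>)) (act (\<lambda>\<omega>. k + K \<omega>))"
    using independence[OF F const(1) K FK kK com com_const(2)] independence[OF const(1) F K kK FK com_const(2) com]
      k(2) by (auto simp: indiff_def const_act_eq)
  moreover have "indiff R (act (\<lambda>\<omega>. k + K \<omega>)) (act (\<lambda>_. k + l))"
  proof -
    have Kk: "util (\<lambda>\<omega>. K \<omega> + k)" using kK by (simp add: add.commute)
    have "indiff R (act K) (act (\<lambda>_. l))" using l(2) by (simp add: const_act_eq)
    moreover have "act (\<lambda>_. k) \<in> V0 W P" unfolding const_act_eq[symmetric] by (rule const_act_in)
    ultimately have "indiff R (act (\<lambda>\<omega>. K \<omega> + k)) (act (\<lambda>_. l + k))"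
      using independence[OF K(1) const(2) const(1) _ Kk const(4) com_const(1) com_const(1)]
        independence[OF const(2) K(1) const(1) _ const(4) Kk com_const(1) com_const(1)]
      unfolding indiff_def by blast
    then show ?thesis by (simp only: add.commute)
  qed
  ultimately show ?thesis
    unfolding const_act_eq using act_in[OF FK] act_in[OF kK] act_in[OF const(3)] by (rule indiff_trans)
qed

section \<open>The rank-dependent integral, level by level\<close>

definition decum :: "('s \<Rightarrow> real) \<Rightarrow> real \<Rightarrow> real" where
  "decum h t = \<psi> (1 - prob {s \<in> space P. h s \<le> t})"

text \<open>The integral of a non-integrable function is 0 by convention, so integrability of both
  integrands is carried along with the value of \<open>rd\<close>.\<close>

definition rd_ok :: "('s \<Rightarrow> real) \<Rightarrow> bool" where
  "rd_ok h \<longleftrightarrow> set_integrable lborel {..0} (\<lambda>t. decum h t - 1) \<and> set_integrable lborel {0..} (decum h)"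

abbreviation rd :: "('s \<Rightarrow> real) \<Rightarrow> real" where "rd \<equiv> rd_integral P \<psi>"

lemma rd_eq: "rd h = (LBINT t:{..0}. decum h t - 1) + (LBINT t:{0..}. decum h t)"
  by (simp add: rd_integral_def decum_def)

lemma \<psi>_0 [simp]: "\<psi> 0 = 0" and \<psi>_1 [simp]: "\<psi> 1 = 1"
  using weighting_\<psi> by (auto simp: weighting_function_def)

lemma \<psi>_unit: "p \<in> {0..1} \<Longrightarrow> \<psi> p \<in> {0..1}"
  using weighting_\<psi> by (auto simp: weighting_function_def)

lemma indicator_on:
  fixes a b k :: real
  assumes S: "S \<in> sets borel"
  shows "set_integrable lborel S (\<lambda>t. k * indicat_real {a..<b} t)"
    and "(LBINT t:S. k * indicat_real {a..<b} t) = k * measure lborel (S \<inter> {a..<b})"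
proof -
  have e: "(\<lambda>t. indicat_real S t *\<^sub>R (k * indicat_real {a..<b} t)) = (\<lambda>t. k * indicat_real (S \<inter> {a..<b}) t)"
    by (auto simp: indicator_def fun_eq_iff)
  have "emeasure lborel (S \<inter> {a..<b}) \<le> emeasure lborel {a..b}" using S by (intro emeasure_mono) auto
  also have "\<dots> < \<infinity>" by (cases "a \<le> b") auto
  finally have "integrable lborel (indicat_real (S \<inter> {a..<b}))"
    using S by (intro integrable_real_indicator) auto
  then show "set_integrable lborel S (\<lambda>t. k * indicat_real {a..<b} t)"
    unfolding set_integrable_def e by simp
  show "(LBINT t:S. k * indicat_real {a..<b} t) = k * measure lborel (S \<inter> {a..<b})"
    unfolding set_lebesgue_integral_def e using S by simp
qed

text \<open>Removing one level alters the decumulative weights by a constant on one half-open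
  interval. The two half-lines of the integral overlap only in the null set \<open>{0}\<close>, so
  the lengths add up to \<open>b - a\<close>.\<close>

lemma rd_step:
  assumes g: "rd_ok g" and ab: "a \<le> b" "0 \<le> a \<or> b \<le> 0"
    and h: "\<And>t. decum h t = decum g t + k * indicat_real {a..<b} t"
  shows "rd_ok h" "rd h = rd g + k * (b - a)"
proof -
  have e: "decum h = (\<lambda>t. decum g t + k * indicat_real {a..<b} t)"
    "(\<lambda>t. decum h t - 1) = (\<lambda>t. (decum g t - 1) + k * indicat_real {a..<b} t)"
    by (auto simp: h)
  note i = indicator_on[of "{..0}" k a b] indicator_on[of "{0..}" k a b]
  show "rd_ok h"
    using g unfolding rd_ok_def e(2) unfolding e(1) by (intro conjI set_integral_add(1) i) auto
  have "measure lborel ({..0} \<inter> {a..<b}) + measure lborel ({0..} \<inter> {a..<b}) = b - a"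
  proof (cases "0 \<le> a")
    case True
    then have "{0..} \<inter> {a..<b} = {a..<b}" by auto
    moreover have "{..0} \<inter> {a..<b} = (if a = 0 \<and> 0 < b then {0} else {})" using True by auto
    ultimately show ?thesis using ab by simp
  next
    case False
    then have "{0..} \<inter> {a..<b} = {}" "{..0} \<inter> {a..<b} = {a..<b}" using ab by auto
    then show ?thesis using ab by simp
  qed
  then have k: "k * measure lborel ({..0} \<inter> {a..<b}) + k * measure lborel ({0..} \<inter> {a..<b}) = k * (b - a)"
    by (metis distrib_left)
  have "rd h = (LBINT t:{..0}. decum g t - 1) + (LBINT t:{..0}. k * indicat_real {a..<b} t)
      + ((LBINT t:{0..}. decum g t) + (LBINT t:{0..}. k * indicat_real {a..<b} t))"
    unfolding rd_eq[of h] e(2) unfolding e(1)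
    using g i unfolding rd_ok_def by (subst (1 2) set_integral_add(2)) auto
  also have "\<dots> = (LBINT t:{..0}. decum g t - 1) + k * measure lborel ({..0} \<inter> {a..<b})
      + ((LBINT t:{0..}. decum g t) + k * measure lborel ({0..} \<inter> {a..<b}))"
    by (subst (1 2) indicator_on(2)) auto
  finally have "rd h = (LBINT t:{..0}. decum g t - 1) + k * measure lborel ({..0} \<inter> {a..<b})
      + ((LBINT t:{0..}. decum g t) + k * measure lborel ({0..} \<inter> {a..<b}))" .
  then show "rd h = rd g + k * (b - a)" using k by (simp add: rd_eq)
qed

lemma rd_zero:
  assumes "\<And>s. s \<in> space P \<Longrightarrow> h s = 0" shows "rd_ok h" "rd h = 0"
proof -
  have d: "decum h t = of_bool (t < 0)" for t
  proof (cases "t < 0")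
    case True
    then have "{s \<in> space P. h s \<le> t} = {}" using assms by auto
    then show ?thesis using True by (simp only: decum_def) simp
  next
    case False
    then have "{s \<in> space P. h s \<le> t} = space P" using assms by auto
    then show ?thesis using False by (simp only: decum_def prob_space) simp
  qed
  \<comment> \<open>\<open>decum h 0 = 0\<close>, so the first integrand is -1 at the single point
    0, a null set.\<close>
  have 1: "(\<lambda>t. indicat_real {..0} t *\<^sub>R (decum h t - 1)) = (\<lambda>t. - indicat_real {0} t)"
    by (auto simp: d indicator_def fun_eq_iff)
  have 2: "(\<lambda>t. indicat_real {0..} t *\<^sub>R decum h t) = (\<lambda>t. 0)"
    by (auto simp: d indicator_def fun_eq_iff)
  show "rd_ok h" unfolding rd_ok_def set_integrable_def 1 2
    by (auto intro!: integrable_real_indicator)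
  show "rd h = 0" unfolding rd_eq set_lebesgue_integral_def 1 2 by simp
qed

lemma util_lift: "\<lbrakk>simple_function P g; \<And>s. s \<in> space P \<Longrightarrow> g s \<in> rng\<rbrakk> \<Longrightarrow> util (lift g)"
  using V0_Vt0[OF lift_in[of g]]
  by (auto simp: Vt0_iff borel_measurable_simple_function space_pair_measure simple_functionD)

lemma act_lift: "act (lift g) = lift (\<lambda>s. \<gamma> (g s))"
  by (auto simp: act_def lift_def)

lemma act_lift_in: assumes "simple_function P g" shows "act (lift g) \<in> V0 W P"
proof -
  have "simple_function P (\<lambda>s. \<gamma> (g s))" using assms by (rule simple_function_compose1)
  then show ?thesis unfolding act_lift
    by (intro lift_in) (auto simp: borel_measurable_simple_function simple_functionD)
qed

lemma indiff_const_bounds: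
  assumes F: "util F" and k: "k \<in> rng" "indiff R (act F) (const_act (\<gamma> k))"
    and b: "l \<in> rng" "u \<in> rng" "\<And>\<omega>. \<omega> \<in> space (W \<Otimes>\<^sub>M P) \<Longrightarrow> l \<le> F \<omega> \<and> F \<omega> \<le> u"
  shows "k \<in> {l..u}"
proof -
  obtain k' where k': "k' \<in> {l..u}" "k' \<in> rng" "indiff R (const_act (\<gamma> k')) (act F)"
    using ex_const_between[OF F b] by blast
  have "\<gamma> k' = \<gamma> k" using indiff_const_unique[OF act_in[OF F] k'(3) indiff_sym[OF k(2)]] .
  then have "k' = k" using \<phi>_\<gamma>[OF k(1)] \<phi>_\<gamma>[OF k'(2)] by metis
  then show ?thesis using k' by simp
qed

text \<open>Replacing the summands of \<open>g + r\<close> by their certainty equivalents, one after the other, is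
  allowed by A7 because \<open>r\<close> is binary and comonotonic with \<open>g\<close>.\<close>
lemma layer:
  assumes g: "simple_function P g" "\<And>s. s \<in> space P \<Longrightarrow> g s \<in> rng"
    and k: "k \<in> rng" "indiff R (act (lift g)) (const_act (\<gamma> k))"
    and A: "A \<in> sets P" and xy: "y \<le> x" "x \<in> rng" "y \<in> rng" "k + x \<in> rng" "k + y \<in> rng"
    and h: "\<And>s. s \<in> space P \<Longrightarrow> h s = g s + (if s \<in> A then x else y)" "\<And>s. s \<in> space P \<Longrightarrow> h s \<in> rng"
    and com: "\<And>s s'. \<lbrakk>s \<in> A; s' \<in> space P; s' \<notin> A\<rbrakk> \<Longrightarrow> g s' \<le> g s"
    and l: "l = \<psi> (prob A) * x + (1 - \<psi> (prob A)) * y"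
  shows "k + l \<in> rng" "indiff R (act (lift h)) (const_act (\<gamma> (k + l)))"
proof -
  let ?r = "\<lambda>s. if s \<in> A then x else y"
  have p: "prob A \<in> {0..1}" by simp
  have Asub: "A \<subseteq> space P" using A by (rule sets.sets_into_space)
  have l': "l = y + \<psi> (prob A) * (x - y)" using l by (simp add: algebra_simps)
  have "0 \<le> \<psi> (prob A) * (x - y)" "\<psi> (prob A) * (x - y) \<le> 1 * (x - y)"
    using \<psi>_unit[OF p] xy(1) mult_right_mono[of "\<psi> (prob A)" 1 "x - y"] by auto
  then have lb: "y \<le> l" "l \<le> x" using l' by auto
  then show kl: "k + l \<in> rng" by (intro range_between[OF xy(5,4)]) simp_all
  have r: "simple_function P ?r" using A by (intro simple_function_If_set) auto
  have gr: "simple_function P (\<lambda>s. g s + ?r s)" using g(1) r by (rule simple_function_real_intros)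
  have kr: "simple_function P (\<lambda>s. k + ?r s)" by (intro simple_function_real_intros r) auto
  have bin: "act (lift ?r) = bin_act A (\<gamma> x) (\<gamma> y)"
    unfolding act_lift bin_act_lift by (auto simp: fun_eq_iff lift_def)
  have "\<phi> (c (prob A) (\<gamma> x) (\<gamma> y)) = l"
    using \<phi>_c[OF p, of "\<gamma> y" "\<gamma> x"] xy l by (simp add: \<gamma>_le_iff)
  then have "\<gamma> l = c (prob A) (\<gamma> x) (\<gamma> y)" and lr: "l \<in> rng"
    using \<gamma>_\<phi> \<phi>_in_rng by metis+
  then have li: "indiff R (act (lift ?r)) (const_act (\<gamma> l))"
    using indiff_sym[OF cert_equiv[OF bin_act_in[OF A]]] by (simp add: bin cert_equiv_bin[OF A])
  have lifts: "(\<lambda>\<omega>. lift g \<omega> + lift ?r \<omega>) = lift (\<lambda>s. g s + ?r s)" "(\<lambda>\<omega>. k + lift ?r \<omega>) = lift (\<lambda>s. k + ?r s)"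
    by (auto simp: lift_def)
  have cm: "comonotonic W P (lift g) (lift ?r)"
    unfolding comonotonic_def lift_apply using com xy(1) Asub
    by (auto intro: mult_nonneg_nonneg mult_nonpos_nonpos)
  have "indiff R (act (\<lambda>\<omega>. lift g \<omega> + lift ?r \<omega>)) (const_act (\<gamma> (k + l)))"
  proof (rule indiff_add[OF util_lift[OF g] util_lift[OF r] act_lift_in[OF r] _ cm k lr li _ kl])
    show "?r s \<in> rng" if "s \<in> space P" for s using xy by simp
    have "util (lift (\<lambda>s. g s + ?r s))" by (rule util_lift[OF gr]) (use h in metis)
    then show "util (\<lambda>\<omega>. lift g \<omega> + lift ?r \<omega>)" unfolding lifts(1)[symmetric] .
    have "util (lift (\<lambda>s. k + ?r s))" by (rule util_lift[OF kr]) (use xy in simp)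
    then show "util (\<lambda>\<omega>. k + lift ?r \<omega>)" unfolding lifts(2)[symmetric] .
  qed
  then have i: "indiff R (act (lift (\<lambda>s. g s + ?r s))) (const_act (\<gamma> (k + l)))" by (simp only: lifts)
  have "act (lift (\<lambda>s. g s + ?r s)) \<in> Vt0 W P" using act_lift_in[OF gr] by (rule V0_Vt0)
  from agree_indiff[OF this, of "act (lift h)"] h(1)
  have "act (lift h) \<in> Vt0 W P" "indiff R (act (lift (\<lambda>s. g s + ?r s))) (act (lift h))"
    by (auto simp: space_pair_measure act_apply)
  then show "indiff R (act (lift h)) (const_act (\<gamma> (k + l)))"
    using indiff_trans[OF indiff_sym i] \<open>act (lift (\<lambda>s. g s + ?r s)) \<in> Vt0 W P\<close> by auto
qed

text \<open>Each step moves the top level, if positive, or the bottom level, if negative, to the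
  neighbouring value or to 0. Working towards 0 matters: \<open>rng\<close> is an interval around 0
  that need not be closed under addition, and in this direction all sums stay between values already
  in \<open>rng\<close>.\<close>

theorem rank_dependent_utility:
  assumes "simple_function P h" "\<And>s. s \<in> space P \<Longrightarrow> h s \<in> rng"
  shows "rd_ok h \<and> rd h \<in> rng \<and> indiff R (act (lift h)) (const_act (\<gamma> (rd h)))"
  using assms
proof (induction "card (h ` space P - {0})" arbitrary: h rule: less_induct)
  case less
  \<comment> \<open>Inserting 0 makes the neighbouring level \<open>M'\<close> stop at 0, so that
    \<open>M - M'\<close> is itself in \<open>rng\<close>.\<close>
  define Y where "Y = insert 0 (h ` space P)"
  have fin: "finite (h ` space P)" using less.prems(1) by (rule simple_functionD)
  then have finY: "finite Y" by (simp add: Y_def)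
  have Yr: "y \<in> rng" if "y \<in> Y" for y using that less.prems(2) by (auto simp: Y_def simp del: zero_in_range intro: zero_in_range)
  have hY: "h s \<in> Y" if "s \<in> space P" for s using that by (auto simp: Y_def)
  have neY: "Y \<noteq> {}" by (simp add: Y_def)
  have Min: "Min Y \<in> rng" "Max Y \<in> rng"
    by (rule Yr[OF Min_in[OF finY neY]], rule Yr[OF Max_in[OF finY neY]])
  consider (zero) "\<And>s. s \<in> space P \<Longrightarrow> h s = 0" | (pos) s where "s \<in> space P" "0 < h s"
    | (neg) s where "s \<in> space P" "h s < 0" by (meson linorder_neqE_linordered_idom)
  then show ?case
  proof cases
    case zero
    have "rd_ok h" "rd h = 0" using rd_zero zero by blast+
    moreover have "const_act (\<gamma> 0) \<in> Vt0 W P" by simp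
    from agree_indiff[OF this, of "act (lift h)"] have "indiff R (const_act (\<gamma> 0)) (act (lift h))"
      using zero by (auto simp: space_pair_measure act_apply const_act_apply)
    ultimately show ?thesis using indiff_sym by auto
  next
    case pos
    define M where "M = Max Y"
    define M' where "M' = Max (Y - {M})"
    have "h s \<le> M" using hY[OF pos(1)] finY by (simp add: M_def)
    then have M: "0 < M" using pos by simp
    have MY: "M \<in> Y" unfolding M_def by (rule Max_in[OF finY neY])
    have "Y - {M} \<noteq> {}" using M by (auto simp: Y_def)
    then have M'Y: "M' \<in> Y - {M}" unfolding M'_def using finY by (intro Max_in) auto
    then have "M' \<le> M" using finY by (simp add: M_def)
    then have M'M: "M' < M" using M'Y by auto
    have M': "0 \<le> M'" unfolding M'_def using finY M by (intro Max_ge) (auto simp: Y_def)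
    have le: "h s \<le> M" "h s \<noteq> M \<Longrightarrow> h s \<le> M'" if "s \<in> space P" for s
      using hY[OF that] finY by (auto simp: M_def[symmetric] M'_def intro: Max_ge) (simp add: M_def)
    define g where "g s = min (h s) M'" for s
    define A where "A = {s \<in> space P. h s = M}"
    have A: "A \<in> sets P" using less.prems(1) unfolding A_def by measurable
    have gval: "g s = (if s \<in> A then M' else h s)" if "s \<in> space P" for s
      using le[OF that] that M'M by (auto simp: g_def A_def)
    have gY: "g s \<in> Y - {M}" if "s \<in> space P" for s
      using gval[OF that] M'Y hY[OF that] that by (auto simp: A_def)
    have "g ` space P - {0} \<subset> h ` space P - {0}"
    proof
      show "g ` space P - {0} \<subseteq> h ` space P - {0}" using gY by (force simp: Y_def)
      have "M \<in> h ` space P - {0}" using MY M by (auto simp: Y_def)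
      moreover have "M \<notin> g ` space P" using gY by auto
      ultimately show "g ` space P - {0} \<noteq> h ` space P - {0}" by blast
    qed
    then have "card (g ` space P - {0}) < card (h ` space P - {0})" using fin by (intro psubset_card_mono) auto
    moreover have gs: "simple_function P g" unfolding g_def using less.prems(1) by (rule simple_function_compose1)
    moreover have gr: "g s \<in> rng" if "s \<in> space P" for s using Yr gY[OF that] by simp
    ultimately have IH: "rd_ok g" "rd g \<in> rng" "indiff R (act (lift g)) (const_act (\<gamma> (rd g)))"
      using less.hyps by blast+
    \<comment> \<open>The bound \<open>rd g \<le> M'\<close>, read off from preferences, keeps
      \<open>rd g + (M - M')\<close> at most \<open>M\<close> and thus in \<open>rng\<close>, as
      \<open>layer\<close> demands.\<close>
    have "rd g \<in> {Min Y..M'}"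
    proof (rule indiff_const_bounds[OF util_lift[OF gs gr] IH(2,3) Min(1) Yr])
      show "M' \<in> Y" using M'Y by simp
      show "Min Y \<le> lift g \<omega> \<and> lift g \<omega> \<le> M'" if "\<omega> \<in> space (W \<Otimes>\<^sub>M P)" for \<omega>
        using that gY[of "snd \<omega>"] Min_le[OF finY, of "g (snd \<omega>)"] Max_ge[OF finY, of "g (snd \<omega>)"]
        by (cases \<omega>) (auto simp: space_pair_measure g_def)
    qed auto
    then have k: "rd g + (M - M') \<in> rng" using M'M
      by (intro range_between[OF IH(2) Min(2)[folded M_def]]) simp_all
    have x: "M - M' \<in> rng" using M' M'M
      by (intro range_between[OF zero_in_range Min(2)[folded M_def]]) simp_all
    have dec: "decum h t = decum g t + \<psi> (prob A) * indicat_real {M'..<M} t" for t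
    proof -
      consider "t < M'" | "M' \<le> t" "t < M" | "M \<le> t" by linarith
      then show ?thesis
      proof cases
        case 1
        then have "{s \<in> space P. h s \<le> t} = {s \<in> space P. g s \<le> t}" by (auto simp: g_def)
        then show ?thesis using 1 by (simp add: decum_def)
      next
        case 2
        have "{s \<in> space P. h s \<le> t} = space P - A" using 2 le by (force simp: A_def)
        moreover have "{s \<in> space P. g s \<le> t} = space P" using 2 by (auto simp: g_def)
        ultimately show ?thesis using 2 A by (simp add: decum_def prob_compl prob_space)
      next
        case 3
        have "{s \<in> space P. h s \<le> t} = space P" using 3 le by force
        moreover have "{s \<in> space P. g s \<le> t} = space P" using 3 M'M by (auto simp: g_def)
        ultimately show ?thesis using 3 by (simp add: decum_def)
      qed
    qed
    have rdh: "rd_ok h" "rd h = rd g + \<psi> (prob A) * (M - M')"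
      using rd_step[OF IH(1) _ _ dec] M' M'M by auto
    have hg: "h s = g s + (if s \<in> A then M - M' else 0)" if "s \<in> space P" for s
      using gval[OF that] that by (auto simp: A_def)
    have com: "g s' \<le> g s" if "s \<in> A" "s' \<in> space P" "s' \<notin> A" for s s'
      using that gval[of s] by (auto simp: g_def A_def)
    have "rd g + \<psi> (prob A) * (M - M') \<in> rng"
      "indiff R (act (lift h)) (const_act (\<gamma> (rd g + \<psi> (prob A) * (M - M'))))"
      by (rule layer[OF gs gr IH(2,3) A _ x zero_in_range k _ hg less.prems(2) com]; use M'M IH(2) in simp)+
    then show ?thesis using rdh by simp
  next
    case neg
    define M where "M = Min Y"
    define M' where "M' = Min (Y - {M})"
    have "M \<le> h s" using hY[OF neg(1)] finY by (simp add: M_def)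
    then have M: "M < 0" using neg by simp
    have MY: "M \<in> Y" unfolding M_def by (rule Min_in[OF finY neY])
    have "Y - {M} \<noteq> {}" using M by (auto simp: Y_def)
    then have M'Y: "M' \<in> Y - {M}" unfolding M'_def using finY by (intro Min_in) auto
    then have "M \<le> M'" using finY by (simp add: M_def)
    then have M'M: "M < M'" using M'Y by auto
    have M': "M' \<le> 0" unfolding M'_def using finY M by (intro Min_le) (auto simp: Y_def)
    have le: "M \<le> h s" "h s \<noteq> M \<Longrightarrow> M' \<le> h s" if "s \<in> space P" for s
      using hY[OF that] finY by (auto simp: M_def[symmetric] M'_def intro: Min_le) (simp add: M_def)
    define g where "g s = max (h s) M'" for s
    \<comment> \<open>\<open>layer\<close> wants the larger outcome on \<open>A\<close>. The layer
      is \<open>M - M' < 0\<close> on the bottom level set and 0 elsewhere, so \<open>A\<close> is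
      the complement of that set.\<close>
    define A where "A = {s \<in> space P. h s \<noteq> M}"
    have A: "A \<in> sets P" using less.prems(1) unfolding A_def by measurable
    have gval: "g s = (if s \<in> A then h s else M')" if "s \<in> space P" for s
      using le[OF that] that M'M by (auto simp: g_def A_def)
    have gY: "g s \<in> Y - {M}" if "s \<in> space P" for s
      using gval[OF that] M'Y hY[OF that] that by (auto simp: A_def)
    have "g ` space P - {0} \<subset> h ` space P - {0}"
    proof
      show "g ` space P - {0} \<subseteq> h ` space P - {0}" using gY by (force simp: Y_def)
      have "M \<in> h ` space P - {0}" using MY M by (auto simp: Y_def)
      moreover have "M \<notin> g ` space P" using gY by auto
      ultimately show "g ` space P - {0} \<noteq> h ` space P - {0}" by blast
    qed
    then have "card (g ` space P - {0}) < card (h ` space P - {0})" using fin by (intro psubset_card_mono) auto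
    moreover have gs: "simple_function P g" unfolding g_def using less.prems(1) by (rule simple_function_compose1)
    moreover have gr: "g s \<in> rng" if "s \<in> space P" for s using Yr gY[OF that] by simp
    ultimately have IH: "rd_ok g" "rd g \<in> rng" "indiff R (act (lift g)) (const_act (\<gamma> (rd g)))"
      using less.hyps by blast+
    have "rd g \<in> {M'..Max Y}"
    proof (rule indiff_const_bounds[OF util_lift[OF gs gr] IH(2,3) Yr Min(2)])
      show "M' \<in> Y" using M'Y by simp
      show "M' \<le> lift g \<omega> \<and> lift g \<omega> \<le> Max Y" if "\<omega> \<in> space (W \<Otimes>\<^sub>M P)" for \<omega>
        using that gY[of "snd \<omega>"] Min_le[OF finY, of "g (snd \<omega>)"] Max_ge[OF finY, of "g (snd \<omega>)"]
        by (cases \<omega>) (auto simp: space_pair_measure g_def)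
    qed auto
    then have k: "rd g + (M - M') \<in> rng" using M'M
      by (intro range_between[OF Min(1)[folded M_def] IH(2)]) simp_all
    have x: "M - M' \<in> rng" using M' M'M
      by (intro range_between[OF Min(1)[folded M_def] zero_in_range]) simp_all
    have dec: "decum h t = decum g t + (\<psi> (prob A) - 1) * indicat_real {M..<M'} t" for t
    proof -
      consider "t < M" | "M \<le> t" "t < M'" | "M' \<le> t" by linarith
      then show ?thesis
      proof cases
        case 1
        have "{s \<in> space P. h s \<le> t} = {}" using 1 le by force
        moreover have "{s \<in> space P. g s \<le> t} = {}" using 1 M'M by (auto simp: g_def)
        ultimately show ?thesis using 1 by (simp only: decum_def) simp
      next
        case 2
        have "{s \<in> space P. h s \<le> t} = space P - A" using 2 le by (force simp: A_def)
        moreover have "{s \<in> space P. g s \<le> t} = {}" using 2 by (auto simp: g_def)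
        ultimately show ?thesis using 2 A by (simp only: decum_def prob_compl) simp
      next
        case 3
        then have "{s \<in> space P. h s \<le> t} = {s \<in> space P. g s \<le> t}" by (auto simp: g_def)
        then show ?thesis using 3 by (simp add: decum_def)
      qed
    qed
    define l where "l = (1 - \<psi> (prob A)) * (M - M')"
    have rdh: "rd_ok h" "rd h = rd g + l"
      using rd_step[OF IH(1) _ _ dec] M' M'M by (auto simp: l_def algebra_simps)
    have hg: "h s = g s + (if s \<in> A then 0 else M - M')" if "s \<in> space P" for s
      using gval[OF that] that by (auto simp: A_def)
    have com: "g s' \<le> g s" if "s \<in> A" "s' \<in> space P" "s' \<notin> A" for s s'
      using that gval[of s'] by (auto simp: g_def A_def)
    have "rd g + l \<in> rng" "indiff R (act (lift h)) (const_act (\<gamma> (rd g + l)))"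
      by (rule layer[OF gs gr IH(2,3) A _ zero_in_range x _ k hg less.prems(2) com]; use M'M IH(2) in \<open>simp add: l_def\<close>)+
    then show ?thesis using rdh by simp
  qed
qed

subsection \<open>The prior\<close>

definition wact :: "('w \<Rightarrow> real) \<Rightarrow> ('w, 's) act" where "wact f = act (\<lambda>\<omega>. f (fst \<omega>))"

lemma wact_apply: "wact f \<omega> = \<gamma> (f (fst \<omega>))" by (simp add: wact_def act_def)

abbreviation wutil :: "('w \<Rightarrow> real) \<Rightarrow> bool" where
  "wutil f \<equiv> simple_function W f \<and> (\<forall>w\<in>space W. f w \<in> rng)"

lemma wutil_util: assumes "wutil f" shows "util (\<lambda>\<omega>. f (fst \<omega>))"
proof
  show "simple_function (W \<Otimes>\<^sub>M P) (\<lambda>\<omega>. f (fst \<omega>))"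
    using assms by (intro simple_function_comp[OF measurable_fst]) auto
qed (use assms in \<open>auto simp: space_pair_measure\<close>)

lemma wact_in: "wutil f \<Longrightarrow> wact f \<in> Vt0 W P"
  unfolding wact_def by (intro act_in wutil_util)

lemma wact_const: "wact (\<lambda>_. k) = const_act (\<gamma> k)" by (simp add: wact_def const_act_eq)

lemma wutil_const: "k \<in> rng \<Longrightarrow> wutil (\<lambda>_. k)" by simp

lemma wact_mono:
  assumes "wutil f" "wutil g" "\<And>w. w \<in> space W \<Longrightarrow> g w \<le> f w" shows "R (wact f) (wact g)"
proof (rule pref_mono[OF wact_in[OF assms(1)] wact_in[OF assms(2)]])
  fix \<omega> assume "\<omega> \<in> space (W \<Otimes>\<^sub>M P)"
  then have "fst \<omega> \<in> space W" by (auto simp: space_pair_measure)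
  then show "wact g \<omega> \<le> wact f \<omega>" using assms by (simp add: wact_apply \<gamma>_le_iff)
qed

lemma translate:
  assumes f: "wutil f" and g: "wutil g" and k: "k \<in> rng"
    and fk: "wutil (\<lambda>w. f w + k)" and gk: "wutil (\<lambda>w. g w + k)" and R: "R (wact f) (wact g)"
  shows "R (wact (\<lambda>w. f w + k)) (wact (\<lambda>w. g w + k))"
proof -
  have "act (\<lambda>_. k) \<in> V0 W P" unfolding const_act_eq[symmetric] by (rule const_act_in)
  moreover have "util (\<lambda>_. k)" using k by simp
  moreover have "comonotonic W P h (\<lambda>_. k)" for h by (simp add: comonotonic_def)
  ultimately show ?thesis
    using independence[OF wutil_util[OF f] wutil_util[OF g] _ _ wutil_util[OF fk] wutil_util[OF gk]] R
    unfolding wact_def by blast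
qed

lemma translate_indiff:
  assumes f: "wutil f" and j: "j \<in> rng" and k: "k \<in> rng" and fk: "wutil (\<lambda>w. f w + k)" and jk: "j + k \<in> rng"
    and "indiff R (wact f) (const_act (\<gamma> j))"
  shows "indiff R (wact (\<lambda>w. f w + k)) (const_act (\<gamma> (j + k)))"
  using translate[OF f wutil_const[OF j] k fk wutil_const[OF jk]]
    translate[OF wutil_const[OF j] f k wutil_const[OF jk] fk] assms(6)
  by (simp add: wact_const indiff_def)

lemma rng_convex: 
  assumes "x \<in> rng" "y \<in> rng" "0 \<le> a" "a \<le> 1" shows "a * x + (1 - a) * y \<in> rng"
proof (cases "x \<le> y")
  case True
  have "a * x \<le> a * y" "(1 - a) * x \<le> (1 - a) * y" using assms True by (auto intro: mult_left_mono)
  then show ?thesis by (intro range_between[OF assms(1,2)]) (auto simp: algebra_simps)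
next
  case False
  have "a * y \<le> a * x" "(1 - a) * y \<le> (1 - a) * x" using assms False by (auto intro: mult_left_mono)
  then show ?thesis by (intro range_between[OF assms(2,1)]) (auto simp: algebra_simps)
qed

lemma mixture:
  assumes f: "wutil f" and g: "wutil g" and a: "a \<in> {0<..<1}" and i: "indiff R (wact f) (wact g)"
  shows "wutil (\<lambda>w. a * f w + (1 - a) * g w)" "R (wact (\<lambda>w. a * f w + (1 - a) * g w)) (wact f)"
proof -
  let ?u = "utility W P R" and ?m = "\<lambda>w. a * f w + (1 - a) * g w"
  show m: "wutil ?m"
    using f g a by (auto intro!: simple_function_real_intros rng_convex)
  have V: "wact f \<in> V0' W P" if "wutil f" for f
    using wact_in[OF that] by (auto simp: V0'_def wact_apply)
  have "smix ?u a (wact f) (wact g) \<omega> = wact ?m \<omega>" if "\<omega> \<in> space (W \<Otimes>\<^sub>M P)" for \<omega>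
  proof -
    have w: "fst \<omega> \<in> space W" using that by (auto simp: space_pair_measure)
    have "?u y = a * ?u (wact f \<omega>) + (1 - a) * ?u (wact g \<omega>) \<longleftrightarrow> y = wact ?m \<omega>" for y
    proof -
      have "?u y = a * ?u (wact f \<omega>) + (1 - a) * ?u (wact g \<omega>) \<longleftrightarrow>
          \<phi> y = a * \<phi> (wact f \<omega>) + (1 - a) * \<phi> (wact g \<omega>)"
        by (auto simp: \<phi>_def algebra_simps)
      also have "\<dots> \<longleftrightarrow> \<phi> y = ?m (fst \<omega>)" using f g w by (simp add: wact_apply)
      also have "\<dots> \<longleftrightarrow> y = wact ?m \<omega>"
      proof -
        have "\<phi> (wact ?m \<omega>) = ?m (fst \<omega>)" using m w unfolding wact_apply by (intro \<phi>_\<gamma>) blast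
        then show ?thesis using \<phi>_eq_iff by metis
      qed
      finally show ?thesis .
    qed
    then show ?thesis by (simp only: smix_def) simp
  qed
  note s = agree_indiff[OF wact_in[OF m] this]
  have "R (smix ?u a (wact f) (wact g)) (wact f)"
    using A6 V[OF f] V[OF g] a i unfolding A6_def by blast
  moreover have "R (wact ?m) (smix ?u a (wact f) (wact g))" using s(2) by (simp add: indiff_def)
  ultimately show "R (wact ?m) (wact f)" using trans s(1) wact_in[OF m] wact_in[OF f] by blast
qed

lemma ex_value:
  assumes f: "wutil f" and "l \<in> rng" "u \<in> rng" "\<And>w. w \<in> space W \<Longrightarrow> l \<le> f w \<and> f w \<le> u"
  obtains k where "k \<in> {l..u}" "k \<in> rng" "indiff R (wact f) (const_act (\<gamma> k))"
proof -
  have "l \<le> f (fst \<omega>) \<and> f (fst \<omega>) \<le> u" if "\<omega> \<in> space (W \<Otimes>\<^sub>M P)" for \<omega>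
    using assms(4) that by (auto simp: space_pair_measure)
  from ex_const_between[OF wutil_util[OF f] assms(2,3) this] show ?thesis
    using that indiff_sym unfolding wact_def by blast
qed

section \<open>The cone of acceptable functions\<close>

lemma small_multiples:
  assumes "simple_function W g" "\<delta> > 0"
  obtains a where "a > 0" "\<And>\<alpha> w. \<lbrakk>0 < \<alpha>; \<alpha> \<le> a; w \<in> space W\<rbrakk> \<Longrightarrow> \<bar>\<alpha> * g w\<bar> < (\<delta> :: real)"
proof -
  have "bounded (g ` space W)" using assms(1) by (simp add: simple_function_def finite_imp_bounded)
  then obtain K where "\<forall>y\<in>g ` space W. \<bar>y\<bar> \<le> K" unfolding bounded_real by blast
  then have K: "\<bar>g w\<bar> < \<bar>K\<bar> + 1" if "w \<in> space W" for w using that by fastforce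
  show ?thesis
  proof
    show "\<delta> / (\<bar>K\<bar> + 1) > 0" using assms(2) by simp
    fix \<alpha> w assume \<alpha>: "0 < \<alpha>" "\<alpha> \<le> \<delta> / (\<bar>K\<bar> + 1)" and "w \<in> space W"
    then have "\<alpha> * \<bar>g w\<bar> < \<alpha> * (\<bar>K\<bar> + 1)" using K by simp
    also have "\<dots> \<le> \<delta>" using \<alpha> by (simp add: pos_le_divide_eq)
    finally show "\<bar>\<alpha> * g w\<bar> < \<delta>" using \<alpha> by (simp add: abs_mult)
  qed
qed

text \<open>\<open>g\<close> itself may leave the range of utility, so it is judged by multiples
  near 0. Asking for all small multiples, not just one, gives two acceptable functions a common
  scale.\<close>

definition accept :: "('w \<Rightarrow> real) \<Rightarrow> bool" where
  "accept g \<longleftrightarrow> simple_function W g \<and> (\<exists>a>0. \<forall>\<alpha>. 0 < \<alpha> \<longrightarrow> \<alpha> \<le> a \<longrightarrow>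
     (\<forall>w\<in>space W. \<alpha> * g w \<in> rng) \<and> R (wact (\<lambda>w. \<alpha> * g w)) (const_act (\<gamma> 0)))"

text \<open>A6 mixes only indifferent acts, so \<open>\<beta> * g\<close> and
  \<open>\<beta> * h\<close> are first lowered by their certainty equivalents \<open>k\<close>,
  \<open>l \<ge> 0\<close> in utils. Both are then indifferent to 0, so their even mixture
  \<open>\<alpha> * (g + h) - (k + l) / 2\<close> is weakly preferred to 0, and so is the larger
  \<open>\<alpha> * (g + h)\<close>.\<close>

lemma accept_add:
  assumes "accept g" "accept h" shows "accept (\<lambda>w. g w + h w)"
proof -
  obtain \<epsilon> where \<epsilon>: "\<epsilon> > 0" "\<And>y. \<bar>y\<bar> < \<epsilon> \<Longrightarrow> y \<in> rng" using range_nhd by blast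
  have sg: "simple_function W g" and sh: "simple_function W h" using assms by (auto simp: accept_def)
  obtain a where a: "a > 0" "\<And>\<alpha>. \<lbrakk>0 < \<alpha>; \<alpha> \<le> a\<rbrakk> \<Longrightarrow> R (wact (\<lambda>w. \<alpha> * g w)) (const_act (\<gamma> 0))"
    using assms(1) unfolding accept_def by blast
  obtain b where b: "b > 0" "\<And>\<alpha>. \<lbrakk>0 < \<alpha>; \<alpha> \<le> b\<rbrakk> \<Longrightarrow> R (wact (\<lambda>w. \<alpha> * h w)) (const_act (\<gamma> 0))"
    using assms(2) unfolding accept_def by blast
  \<comment> \<open>With this bound, a function lowered by its certainty equivalent stays below
    \<open>\<epsilon> / 2\<close> in absolute value and so has values in \<open>rng\<close>.\<close>
  have \<epsilon>4: "\<epsilon> / 4 > 0" using \<epsilon> by simp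
  obtain a' where a': "a' > 0" "\<And>\<alpha> w. \<lbrakk>0 < \<alpha>; \<alpha> \<le> a'; w \<in> space W\<rbrakk> \<Longrightarrow> \<bar>\<alpha> * g w\<bar> < \<epsilon> / 4"
    using small_multiples[OF sg \<epsilon>4] by blast
  obtain b' where b': "b' > 0" "\<And>\<alpha> w. \<lbrakk>0 < \<alpha>; \<alpha> \<le> b'; w \<in> space W\<rbrakk> \<Longrightarrow> \<bar>\<alpha> * h w\<bar> < \<epsilon> / 4"
    using small_multiples[OF sh \<epsilon>4] by blast
  have centre: "\<exists>k\<in>{0..\<epsilon> / 4}. wutil (\<lambda>w. \<beta> * f w - k) \<and> indiff R (wact (\<lambda>w. \<beta> * f w - k)) (const_act (\<gamma> 0))"
    if f: "simple_function W f" and bd: "\<And>w. w \<in> space W \<Longrightarrow> \<bar>\<beta> * f w\<bar> < \<epsilon> / 4"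
      and Rf: "R (wact (\<lambda>w. \<beta> * f w)) (const_act (\<gamma> 0))" for f \<beta>
  proof -
    have wu: "wutil (\<lambda>w. \<beta> * f w)"
    proof (intro conjI ballI)
      show "\<beta> * f w \<in> rng" if "w \<in> space W" for w using bd[OF that] \<epsilon> by (intro \<epsilon>(2)) linarith
    qed (use f in \<open>auto intro: simple_function_real_intros\<close>)
    have "- (\<epsilon> / 4) \<le> \<beta> * f w \<and> \<beta> * f w \<le> \<epsilon> / 4" if "w \<in> space W" for w using bd[OF that] by linarith
    moreover have "- (\<epsilon> / 4) \<in> rng" "\<epsilon> / 4 \<in> rng" using \<epsilon> by auto
    ultimately obtain k where k: "k \<in> {- (\<epsilon> / 4)..\<epsilon> / 4}" "k \<in> rng"
      "indiff R (wact (\<lambda>w. \<beta> * f w)) (const_act (\<gamma> k))" using ex_value[OF wu] by blast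
    have "R (const_act (\<gamma> k)) (const_act (\<gamma> 0))"
      using k(3) Rf trans wact_in[OF wu] Vt0_const unfolding indiff_def by blast
    then have k0: "0 \<le> k" using k(2) by (simp add: const_util_iff del: \<gamma>_0)
    have mk: "- k \<in> rng" using k \<epsilon> by (intro \<epsilon>(2)) auto
    have wk: "wutil (\<lambda>w. \<beta> * f w + - k)"
    proof (intro conjI ballI)
      show "\<beta> * f w + - k \<in> rng" if "w \<in> space W" for w using bd[OF that] k(1) \<epsilon>(1) by (intro \<epsilon>(2)) auto
    qed (use wu f in \<open>intro simple_function_real_intros, auto\<close>)
    have "indiff R (wact (\<lambda>w. \<beta> * f w + - k)) (const_act (\<gamma> (k + - k)))"
      using translate_indiff[OF wu k(2) mk wk _ k(3)] by simp
    then show ?thesis using k k0 wk by (intro bexI[of _ k]) auto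
  qed
  show ?thesis
    unfolding accept_def
  proof (intro conjI exI[of _ "min (min a b) (min a' b') / 2"] allI impI ballI)
    show "simple_function W (\<lambda>w. g w + h w)" using sg sh by (rule simple_function_real_intros)
    show "min (min a b) (min a' b') / 2 > 0" using a b a' b' by simp
    fix \<alpha> :: real assume \<alpha>: "0 < \<alpha>" "\<alpha> \<le> min (min a b) (min a' b') / 2"
    define \<beta> where "\<beta> = 2 * \<alpha>"
    have \<beta>: "0 < \<beta>" "\<beta> \<le> a" "\<beta> \<le> b" "\<beta> \<le> a'" "\<beta> \<le> b'" using \<alpha> by (auto simp: \<beta>_def)
    have inr: "\<alpha> * (g w + h w) \<in> rng" if "w \<in> space W" for w
    proof -
      have "\<alpha> * (g w + h w) = (\<beta> * g w + \<beta> * h w) / 2" by (simp add: \<beta>_def algebra_simps)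
      moreover have "\<bar>(x + y) / 2\<bar> < \<epsilon>" if "\<bar>x\<bar> < \<epsilon> / 4" "\<bar>y\<bar> < \<epsilon> / 4" for x y
        using that \<epsilon>(1) by (auto simp: abs_less_iff)
      then have "\<bar>(\<beta> * g w + \<beta> * h w) / 2\<bar> < \<epsilon>"
        using a'(2)[OF \<beta>(1,4) that] b'(2)[OF \<beta>(1,5) that] by blast
      ultimately show ?thesis using \<epsilon>(2) by simp
    qed
    then show "\<And>w. w \<in> space W \<Longrightarrow> \<alpha> * (g w + h w) \<in> rng" .
    obtain k where k: "k \<in> {0..\<epsilon> / 4}" and wk: "wutil (\<lambda>w. \<beta> * g w - k)"
      and ik: "indiff R (wact (\<lambda>w. \<beta> * g w - k)) (const_act (\<gamma> 0))"
      using centre[OF sg, of \<beta>, OF a'(2)[OF \<beta>(1,4)] a(2)[OF \<beta>(1,2)]] by blast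
    obtain l where l: "l \<in> {0..\<epsilon> / 4}" and wl: "wutil (\<lambda>w. \<beta> * h w - l)"
      and il: "indiff R (wact (\<lambda>w. \<beta> * h w - l)) (const_act (\<gamma> 0))"
      using centre[OF sh, of \<beta>, OF b'(2)[OF \<beta>(1,5)] b(2)[OF \<beta>(1,3)]] by blast
    have "indiff R (wact (\<lambda>w. \<beta> * g w - k)) (wact (\<lambda>w. \<beta> * h w - l))"
      by (rule indiff_trans[OF ik indiff_sym[OF il] wact_in[OF wk] Vt0_const wact_in[OF wl]])
    note mix = mixture[OF wk wl _ this, of "1/2"]
    let ?m = "\<lambda>w. 1/2 * (\<beta> * g w - k) + (1 - 1/2) * (\<beta> * h w - l)"
    have m: "wutil ?m" and Rm: "R (wact ?m) (wact (\<lambda>w. \<beta> * g w - k))" using mix by simp_all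
    have s: "wutil (\<lambda>w. \<alpha> * (g w + h w))"
      using inr sg sh by (intro conjI ballI simple_function_real_intros(3)[of _ "\<lambda>w. g w + h w" "\<lambda>w. g w + h w"]) (auto intro: simple_function_real_intros)
    have "R (wact (\<lambda>w. \<alpha> * (g w + h w))) (wact ?m)"
      using s m by (rule wact_mono) (use k l in \<open>simp add: \<beta>_def algebra_simps\<close>)
    from trans[OF this Rm wact_in[OF s] wact_in[OF m] wact_in[OF wk]]
    show "R (wact (\<lambda>w. \<alpha> * (g w + h w))) (const_act (\<gamma> 0))"
      using ik wact_in[OF s] wact_in[OF wk] trans Vt0_const unfolding indiff_def by blast
  qed
qed

lemma accept_cone: "acceptance_cone W (Collect accept)"
proof
  obtain \<epsilon> where \<epsilon>: "\<epsilon> > 0" "\<And>y. \<bar>y\<bar> < \<epsilon> \<Longrightarrow> y \<in> rng" using range_nhd by blast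
  show "simple_function W f" if "f \<in> Collect accept" for f using that by (simp add: accept_def)
  show "f \<in> Collect accept" if f: "simple_function W f" and nn: "\<And>w. w \<in> space W \<Longrightarrow> 0 \<le> f w" for f
  proof -
    obtain a where a: "a > 0" "\<And>\<alpha> w. \<lbrakk>0 < \<alpha>; \<alpha> \<le> a; w \<in> space W\<rbrakk> \<Longrightarrow> \<bar>\<alpha> * f w\<bar> < \<epsilon>"
      using small_multiples[OF f \<epsilon>(1)] by blast
    have "R (wact (\<lambda>w. \<alpha> * f w)) (const_act (\<gamma> 0))" if "0 < \<alpha>" "\<alpha> \<le> a" for \<alpha>
    proof -
      have "wutil (\<lambda>w. \<alpha> * f w)" using a(2)[OF that] \<epsilon>(2) f by (auto intro: simple_function_real_intros)
      from wact_mono[OF this wutil_const[OF zero_in_range]] show ?thesis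
        using nn that by (simp add: wact_const)
    qed
    then have "accept f" unfolding accept_def using a f \<epsilon>(2) by (intro conjI exI[of _ a]) auto
    then show ?thesis by simp
  qed
  show "(\<lambda>w. f w + g w) \<in> Collect accept" if "f \<in> Collect accept" "g \<in> Collect accept" for f g
    using that accept_add by simp
  show "(\<lambda>w. c * f w) \<in> Collect accept" if fc: "f \<in> Collect accept" "0 < c" for f c
  proof -
    obtain a where a: "a > 0" and sf: "simple_function W f" and
      acc: "\<And>\<alpha>. \<lbrakk>0 < \<alpha>; \<alpha> \<le> a\<rbrakk> \<Longrightarrow> (\<forall>w\<in>space W. \<alpha> * f w \<in> rng) \<and> R (wact (\<lambda>w. \<alpha> * f w)) (const_act (\<gamma> 0))"
      using fc unfolding accept_def by blast
    have "(\<forall>w\<in>space W. \<alpha> * (c * f w) \<in> rng) \<and> R (wact (\<lambda>w. \<alpha> * (c * f w))) (const_act (\<gamma> 0))"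
      if "0 < \<alpha>" "\<alpha> \<le> a / c" for \<alpha>
      using acc[of "\<alpha> * c"] that fc(2) by (simp add: pos_le_divide_eq mult.assoc)
    then have "accept (\<lambda>w. c * f w)"
      unfolding accept_def using a fc(2) sf by (intro conjI exI[of _ "a / c"]) (auto intro: simple_function_real_intros)
    then show ?thesis by simp
  qed
  show "(\<lambda>_. - 1) \<notin> Collect accept"
  proof
    assume "(\<lambda>_. - 1) \<in> Collect accept"
    then obtain a where a: "a > 0" "\<forall>w\<in>space W. a * - 1 \<in> rng" "R (wact (\<lambda>w. a * - 1)) (const_act (\<gamma> 0))"
      unfolding accept_def by blast
    then have "- a \<in> rng" using space_W by auto
    moreover have "R (const_act (\<gamma> (- a))) (const_act (\<gamma> 0))" using a(3) by (simp add: wact_const)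
    ultimately show False using a(1) const_util_iff[of "- a" 0] zero_in_range by linarith
  qed
qed

text \<open>\<open>k'\<close> is the certainty equivalent of \<open>f\<close> in utils, since A6
  needs indifference. If \<open>\<alpha> * (f - k')\<close> had a value \<open>j < 0\<close>,
  translation by \<open>k'\<close> would give \<open>\<alpha> * f + (1 - \<alpha>) * k'\<close> the
  value \<open>j + k' < k'\<close>, while by A6 this mixture of indifferent acts is at least as good
  as \<open>f\<close>.\<close>

lemma accept_excess:
  assumes f: "wutil f" and k: "k \<in> rng" and Rk: "R (wact f) (const_act (\<gamma> k))"
  obtains k' where "k \<le> k'" "accept (\<lambda>w. f w - k')"
proof -
  obtain \<epsilon> where \<epsilon>: "\<epsilon> > 0" "\<And>y. \<bar>y\<bar> < \<epsilon> \<Longrightarrow> y \<in> rng" using range_nhd by blast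
  have fin: "finite (f ` space W)" "f ` space W \<noteq> {}" using f space_W by (auto simp: simple_functionD)
  define l u where "l = Min (f ` space W)" and "u = Max (f ` space W)"
  have lu: "l \<le> f w \<and> f w \<le> u" if "w \<in> space W" for w using that fin by (auto simp: l_def u_def)
  have "l \<in> f ` space W" "u \<in> f ` space W" unfolding l_def u_def using fin by (auto intro: Min_in Max_in)
  then have lur: "l \<in> rng" "u \<in> rng" using f by auto
  obtain k' where k': "k' \<in> rng" "indiff R (wact f) (const_act (\<gamma> k'))" "k' \<in> {l..u}"
    using ex_value[OF f lur lu] by blast
  have "R (const_act (\<gamma> k')) (const_act (\<gamma> k))"
    using k'(2) Rk trans wact_in[OF f] Vt0_const unfolding indiff_def by blast
  then have kk': "k \<le> k'" using const_util_iff k k'(1) by simp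
  have sf: "simple_function W (\<lambda>w. f w - k')" using f by (auto intro: simple_function_real_intros)
  obtain a where a: "a > 0" "\<And>\<alpha> w. \<lbrakk>0 < \<alpha>; \<alpha> \<le> a; w \<in> space W\<rbrakk> \<Longrightarrow> \<bar>\<alpha> * (f w - k')\<bar> < \<epsilon> / 2"
    using small_multiples[OF sf, of "\<epsilon> / 2"] \<epsilon> by auto
  have main: "(\<forall>w\<in>space W. \<alpha> * (f w - k') \<in> rng) \<and> R (wact (\<lambda>w. \<alpha> * (f w - k'))) (const_act (\<gamma> 0))"
    if \<alpha>: "0 < \<alpha>" "\<alpha> \<le> min a (1/2)" for \<alpha>
  proof -
    let ?g = "\<lambda>w. \<alpha> * (f w - k')"
    have \<alpha>a: "\<alpha> \<le> a" and \<alpha>1: "\<alpha> \<in> {0<..<1}" using \<alpha> by auto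
    have g: "wutil ?g"
    proof (intro conjI ballI)
      show "?g w \<in> rng" if "w \<in> space W" for w using a(2)[OF \<alpha>(1) \<alpha>a that] \<epsilon> by (intro \<epsilon>(2)) linarith
    qed (rule simple_function_real_intros(3)[OF sf sf])
    \<comment> \<open>The first bound puts \<open>j + k'\<close> above the convex combination
      \<open>\<alpha> * l + (1 - \<alpha>) * k'\<close> and so into \<open>rng\<close>; the second
      keeps \<open>l'\<close> itself in \<open>rng\<close>.\<close>
    define l' where "l' = max (\<alpha> * (l - k')) (- (\<epsilon> / 2))"
    have low: "l' \<le> ?g w \<and> ?g w \<le> \<epsilon> / 2" if "w \<in> space W" for w
      using a(2)[OF \<alpha>(1) \<alpha>a that] lu[OF that] \<alpha>(1) by (auto simp: l'_def abs_less_iff intro: mult_left_mono)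
    have "l' \<le> 0" using k'(3) \<alpha>(1) \<epsilon> by (auto simp: l'_def mult_le_0_iff)
    then have lr: "l' \<in> rng" "\<epsilon> / 2 \<in> rng" using \<epsilon> by (auto intro!: \<epsilon>(2) simp: l'_def)
    obtain j where j: "j \<in> {l'..\<epsilon> / 2}" "j \<in> rng" "indiff R (wact ?g) (const_act (\<gamma> j))"
      using ex_value[OF g lr low] by blast
    have "0 \<le> j"
    proof (rule ccontr)
      assume "\<not> 0 \<le> j"
      have eq: "\<alpha> * f w + (1 - \<alpha>) * k' = \<alpha> * (f w - k') + k'" for w by (simp add: algebra_simps)
      have "\<alpha> * l + (1 - \<alpha>) * k' \<in> rng" using lur k' \<alpha>1 by (intro rng_convex) auto
      moreover have "\<alpha> * l + (1 - \<alpha>) * k' \<le> j + k'" using j(1) by (auto simp: l'_def algebra_simps)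
      moreover have "j + k' \<le> k'" using \<open>\<not> 0 \<le> j\<close> by simp
      ultimately have jk: "j + k' \<in> rng" by (rule range_between[OF _ k'(1)])
      have "indiff R (wact f) (wact (\<lambda>_. k'))" using k'(2) by (simp add: wact_const)
      note mix = mixture[OF f wutil_const[OF k'(1)] \<alpha>1 this, unfolded eq]
      have "indiff R (wact (\<lambda>w. \<alpha> * (f w - k') + k')) (const_act (\<gamma> (j + k')))"
        by (rule translate_indiff[OF g j(2) k'(1) mix(1) jk j(3)])
      then have "R (const_act (\<gamma> (j + k'))) (wact f)"
        using mix trans wact_in[OF mix(1)] wact_in[OF f] Vt0_const unfolding indiff_def by blast
      then have "R (const_act (\<gamma> (j + k'))) (const_act (\<gamma> k'))"
        using k'(2) trans wact_in[OF f] Vt0_const unfolding indiff_def by blast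
      then show False using const_util_iff[OF jk k'(1)] \<open>\<not> 0 \<le> j\<close> by simp
    qed
    then have "R (const_act (\<gamma> j)) (const_act (\<gamma> 0))" using const_util_iff[OF j(2) zero_in_range] by blast
    then have "R (wact ?g) (const_act (\<gamma> 0))"
      using j(3) trans wact_in[OF g] Vt0_const unfolding indiff_def by blast
    then show ?thesis using g by blast
  qed
  have "accept (\<lambda>w. f w - k')"
    unfolding accept_def using main sf a(1) by (intro conjI exI[of _ "min a (1/2)"]) auto
  then show ?thesis using that kk' by blast
qed

section \<open>Conditional rank-dependent utility and its simple approximations\<close>

definition rdu :: "('w, 's) act \<Rightarrow> 'w \<Rightarrow> real" where
  "rdu v w = rd (\<lambda>s. \<phi> (v (w, s)))"

lemma rdu_indiff:
  assumes v: "v \<in> Vt0 W P" and w: "w \<in> space W"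
  shows "rdu v w \<in> rng" "indiff R (lift (\<lambda>s. v (w, s))) (const_act (\<gamma> (rdu v w)))"
proof -
  have m: "(\<lambda>s. v (w, s)) \<in> borel_measurable P"
    using assms by (auto simp: Vt0_def Vt_def intro: measurable_Pair2)
  have "(\<lambda>s. v (w, s)) ` space P \<subseteq> v ` space (W \<Otimes>\<^sub>M P)" using w by (auto simp: space_pair_measure)
  then have "finite ((\<lambda>s. v (w, s)) ` space P)" using v by (auto simp: Vt0_def intro: finite_subset)
  with m have "simple_function P (\<lambda>s. v (w, s))" by (rule simple_function_borel_measurable)
  then have "simple_function P (\<lambda>s. \<phi> (v (w, s)))" by (rule simple_function_compose1)
  from rank_dependent_utility[OF this] show "rdu v w \<in> rng"
    "indiff R (lift (\<lambda>s. v (w, s))) (const_act (\<gamma> (rdu v w)))"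
    by (auto simp: rdu_def act_lift)
qed

lemma rdu_bounded:
  assumes v: "v \<in> Vt0 W P" obtains K where "\<And>w. w \<in> space W \<Longrightarrow> \<phi> (- K) \<le> rdu v w \<and> rdu v w \<le> \<phi> K"
proof -
  have "bounded (v ` space (W \<Otimes>\<^sub>M P))" using v by (simp add: Vt0_def Vt_def)
  then obtain K where "\<forall>y\<in>v ` space (W \<Otimes>\<^sub>M P). \<bar>y\<bar> \<le> K" unfolding bounded_real by blast
  then have K: "- K \<le> v (w, s) \<and> v (w, s) \<le> K" if "w \<in> space W" "s \<in> space P" for w s
    using that by (force simp: space_pair_measure abs_le_iff)
  have "\<phi> (- K) \<le> rdu v w \<and> rdu v w \<le> \<phi> K" if w: "w \<in> space W" for w
  proof -
    let ?l = "lift (\<lambda>s. v (w, s))"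
    have lin: "?l \<in> Vt0 W P" using section_in[OF v w] by (rule V0_Vt0)
    have "R (const_act K) ?l" "R ?l (const_act (- K))"
      by (rule pref_mono; use lin K[OF w] in \<open>auto simp: space_pair_measure const_act_apply\<close>)+
    then have "R (const_act K) (const_act (\<gamma> (rdu v w)))" "R (const_act (\<gamma> (rdu v w))) (const_act (- K))"
      using rdu_indiff(2)[OF v w] trans lin Vt0_const unfolding indiff_def by blast+
    then have "- K \<le> \<gamma> (rdu v w)" "\<gamma> (rdu v w) \<le> K" by (simp_all add: const_iff)
    then have "\<phi> (- K) \<le> \<phi> (\<gamma> (rdu v w))" "\<phi> (\<gamma> (rdu v w)) \<le> \<phi> K" by simp_all
    then show ?thesis using rdu_indiff(1)[OF v w] by simp
  qed
  then show ?thesis using that by blast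
qed

lemma rdu_measurable:
  assumes v: "v \<in> Vt0 W P" shows "rdu v \<in> borel_measurable W"
proof -
  \<comment> \<open>\<open>\<psi>\<close> is controlled only on the unit interval; clamping the
    argument gives a continuous, hence Borel, function on the line with the same values at
    probabilities.\<close>
  define \<psi>' where "\<psi>' p = \<psi> (max 0 (min 1 p))" for p
  have "continuous_on UNIV \<psi>'" unfolding \<psi>'_def
    by (rule continuous_on_compose2[of "{0..1}" \<psi>])
       (use weighting_\<psi> in \<open>auto simp: weighting_function_def intro!: continuous_intros\<close>)
  then have [measurable]: "\<psi>' \<in> borel_measurable borel" by (rule borel_measurable_continuous_onI)
  have [measurable]: "\<phi> \<in> borel_measurable borel" using continuous_\<phi> by (rule borel_measurable_continuous_onI)
  have [measurable]: "v \<in> borel_measurable (W \<Otimes>\<^sub>M P)" using v by (simp add: Vt0_def Vt_def)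
  define F :: "'w \<times> real \<Rightarrow> real" where
    "F x = (\<integral>s. (if \<phi> (v (fst x, s)) \<le> snd x then 1 else 0) \<partial>P)" for x
  have F: "prob {s \<in> space P. \<phi> (v (w, s)) \<le> t} = F (w, t)" if w: "w \<in> space W" for w t
  proof -
    have [measurable]: "(\<lambda>s. v (w, s)) \<in> borel_measurable P" using w by measurable
    have "F (w, t) = (\<integral>s. indicator {s \<in> space P. \<phi> (v (w, s)) \<le> t} s \<partial>P)"
      unfolding F_def by (intro Bochner_Integration.integral_cong) (auto simp: indicator_def)
    then show ?thesis by simp
  qed
  have [measurable]: "F \<in> borel_measurable (W \<Otimes>\<^sub>M lborel)"
    unfolding F_def
    by (rule borel_measurable_lebesgue_integral) (simp add: case_prod_beta', measurable)
  have e: "rdu v w = (\<integral>t. indicator {..0} t * (\<psi>' (1 - F (w, t)) - 1) \<partial>lborel)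
      + (\<integral>t. indicator {0..} t * \<psi>' (1 - F (w, t)) \<partial>lborel)" if w: "w \<in> space W" for w
  proof -
    have "\<psi> (1 - prob {s \<in> space P. \<phi> (v (w, s)) \<le> t}) = \<psi>' (1 - F (w, t))" for t
      by (simp add: F[OF w, symmetric] \<psi>'_def)
    then show ?thesis by (simp add: rdu_def rd_integral_def set_lebesgue_integral_def)
  qed
  have "(\<lambda>w. (\<integral>t. indicator {..0} t * (\<psi>' (1 - F (w, t)) - 1) \<partial>lborel)
      + (\<integral>t. indicator {0..} t * \<psi>' (1 - F (w, t)) \<partial>lborel)) \<in> borel_measurable W"
    by measurable
  then show ?thesis by (subst measurable_cong[OF e])
qed

text \<open>Rounding up to the grid of width \<open>\<delta>\<close> that starts at \<open>l\<close>
  gives finitely many values; cutting off at \<open>u\<close> keeps them within the given bounds,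
  which are chosen in \<open>rng\<close> later.\<close>

lemma simple_above:
  assumes f: "f \<in> borel_measurable W" and b: "\<And>w. w \<in> space W \<Longrightarrow> l \<le> f w \<and> f w \<le> u" and "\<delta> > 0"
  obtains g where "simple_function W g" "\<And>w. w \<in> space W \<Longrightarrow> f w \<le> g w \<and> g w \<le> f w + \<delta>"
    "\<And>w. w \<in> space W \<Longrightarrow> l \<le> g w \<and> g w \<le> (u :: real)"
proof
  define n where "n w = \<lceil>(f w - l) / \<delta>\<rceil>" for w
  define g where "g w = min u (l + \<delta> * real_of_int (n w))" for w
  have n: "(f w - l) / \<delta> \<le> real_of_int (n w)" "real_of_int (n w) < (f w - l) / \<delta> + 1" for w
    unfolding n_def by linarith+
  have n': "f w \<le> l + \<delta> * real_of_int (n w)" "l + \<delta> * real_of_int (n w) \<le> f w + \<delta>" for w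
  proof -
    have "f w - l \<le> \<delta> * real_of_int (n w)" using n(1)[of w] \<open>\<delta> > 0\<close> by (simp add: field_simps)
    moreover have "\<delta> * real_of_int (n w) < f w - l + \<delta>" using n(2)[of w] \<open>\<delta> > 0\<close> by (simp add: field_simps)
    ultimately show "f w \<le> l + \<delta> * real_of_int (n w)" "l + \<delta> * real_of_int (n w) \<le> f w + \<delta>"
      by linarith+
  qed
  show "simple_function W g"
  proof (rule simple_function_borel_measurable)
    show "g \<in> borel_measurable W" unfolding g_def n_def using f by measurable
    have "n w \<in> {0..\<lceil>(u - l) / \<delta>\<rceil>}" if "w \<in> space W" for w
    proof -
      have "0 \<le> (f w - l) / \<delta>" "(f w - l) / \<delta> \<le> (u - l) / \<delta>"
        using b[OF that] \<open>\<delta> > 0\<close> by (auto intro: divide_right_mono)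
      then show ?thesis unfolding n_def by (auto intro: ceiling_mono)
    qed
    then have "g ` space W \<subseteq> (\<lambda>i. min u (l + \<delta> * real_of_int i)) ` {0..\<lceil>(u - l) / \<delta>\<rceil>}"
      unfolding g_def by blast
    then show "finite (g ` space W)" by (rule finite_subset) simp
  qed
  show "f w \<le> g w \<and> g w \<le> f w + \<delta>" "l \<le> g w \<and> g w \<le> u" if "w \<in> space W" for w
    using n'[of w] b[OF that] by (auto simp: g_def min_def)
qed

theorem ambiguity_averse: "ambiguity_averse W P R"
proof -
  obtain \<mu> where \<mu>: "\<mu> \<in> fa_probs W"
    and Lmono: "\<And>f g. \<lbrakk>simple_function W f; simple_function W g; \<And>w. w \<in> space W \<Longrightarrow> f w \<le> g w\<rbrakk>
      \<Longrightarrow> simple_expectation W \<mu> f \<le> simple_expectation W \<mu> g"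
    and Ldiff: "\<And>f a. simple_function W f \<Longrightarrow>
      simple_expectation W \<mu> (\<lambda>w. f w - a) = simple_expectation W \<mu> f - a"
    and Lconst: "\<And>k. simple_expectation W \<mu> (\<lambda>_. k) = k"
    and Lpos: "\<And>f. accept f \<Longrightarrow> 0 \<le> simple_expectation W \<mu> f"
    using acceptance_cone.fa_probability[OF accept_cone] by auto
  let ?L = "simple_expectation W \<mu>"
  define E where "E = fa_expectation W \<mu>"
  \<comment> \<open>The comparison relation keeps \<open>\<phi>\<close> and \<open>\<psi>\<close>
    and so ranks acts in \<open>V0\<close> as \<open>R\<close> does; only the prior is new.\<close>
  define R' where "R' v u \<longleftrightarrow> E (rdu u) \<le> E (rdu v)" for v u
  have "ambiguity_neutral W P R'"
    unfolding ambiguity_neutral_def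
    using \<mu> strict_mono_\<phi> continuous_\<phi> weighting_\<psi>
    by (intro bexI[of _ \<mu>] exI[of _ \<phi>] exI[of _ \<psi>])
       (auto simp: R'_def E_def rdu_def[abs_def] utility_function_def)
  moreover have "more_ambiguity_averse W P R R'"
    unfolding more_ambiguity_averse_def
  proof (intro ballI impI)
    fix v u assume v: "v \<in> Vt0 W P" and u: "u \<in> V0 W P" and Rvu: "R v u"
    have Eset: "E f = Sup (?L ` {g. simple_function W g \<and> (\<forall>w\<in>space W. g w \<le> f w)})" for f
      unfolding E_def fa_expectation_def by (simp add: simple_expectation_def)
    obtain w0 where w0: "w0 \<in> space W" using space_W by blast
    note u' = V0_Vt0[OF u]
    define k where "k = rdu u w0"
    \<comment> \<open>Every section of \<open>u\<close> has the distribution of \<open>u\<close>, so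
      all its conditional utilities come from certainty equivalents of the same act and
      coincide.\<close>
    have usec: "indiff R (const_act (\<gamma> (rdu u w))) u" if w: "w \<in> space W" for w
    proof -
      have "act_cdf W P u z = act_cdf W P (lift (\<lambda>s. u (w, s))) z" for z
        using act_cdf_eq[OF u w] by (simp add: act_cdf_def cond_cdf_def)
      then have "indiff R u (lift (\<lambda>s. u (w, s)))" by (rule indiff_cdf[OF u section_in[OF u' w]])
      then show ?thesis
        using rdu_indiff(2)[OF u' w] indiff_trans indiff_sym u' section_in[OF u' w] V0_Vt0 Vt0_const by meson
    qed
    have krng: "k \<in> rng" using rdu_indiff(1)[OF u' w0] by (simp add: k_def)
    have const: "rdu u w = k" if w: "w \<in> space W" for w
    proof -
      have "\<gamma> (rdu u w) = \<gamma> k" using indiff_const_unique[OF u' usec[OF w] usec[OF w0]] by (simp add: k_def)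
      then show ?thesis using \<phi>_\<gamma>[OF rdu_indiff(1)[OF u' w]] \<phi>_\<gamma>[OF krng] by metis
    qed
    have "E (rdu u) = k" unfolding Eset
    proof (rule cSup_eq_maximum)
      show "k \<in> ?L ` {g. simple_function W g \<and> (\<forall>w\<in>space W. g w \<le> rdu u w)}"
        by (intro image_eqI[of _ _ "\<lambda>_. k"]) (auto simp: Lconst const)
      show "x \<le> k" if "x \<in> ?L ` {g. simple_function W g \<and> (\<forall>w\<in>space W. g w \<le> rdu u w)}" for x
        using that Lmono[of _ "\<lambda>_. k"] by (auto simp: Lconst const)
    qed
    moreover have "k \<le> E (rdu v)"
    proof (rule field_le_epsilon)
      fix \<delta> :: real assume \<delta>: "\<delta> > 0"
      obtain K where K: "\<And>w. w \<in> space W \<Longrightarrow> \<phi> (- K) \<le> rdu v w \<and> rdu v w \<le> \<phi> K"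
        using rdu_bounded[OF v] by blast
      \<comment> \<open>An approximation from above is at least as good as \<open>v\<close>, hence
        as the constant with utility \<open>k\<close>, and so has expectation at least
        \<open>k\<close>; lowered by \<open>\<delta>\<close> it is admissible in the supremum that
        defines \<open>E\<close>.\<close>
      obtain g where g: "simple_function W g" "\<And>w. w \<in> space W \<Longrightarrow> rdu v w \<le> g w \<and> g w \<le> rdu v w + \<delta>"
        "\<And>w. w \<in> space W \<Longrightarrow> \<phi> (- K) \<le> g w \<and> g w \<le> \<phi> K"
        using simple_above[OF rdu_measurable[OF v] K \<delta>] by blast
      have gr: "g w \<in> rng" if "w \<in> space W" for w
        using g(3)[OF that] range_between[OF \<phi>_in_rng \<phi>_in_rng] by blast
      then have wg: "wutil g" using g(1) by blast
      have "R (wact g) v"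
      proof (rule statewise[OF wact_in[OF wg] v])
        fix w assume w: "w \<in> space W"
        have "lift (\<lambda>s. wact g (w, s)) = const_act (\<gamma> (g w))" by (simp add: wact_apply const_act_lift)
        moreover have "R (const_act (\<gamma> (g w))) (const_act (\<gamma> (rdu v w)))"
          using const_util_iff gr[OF w] rdu_indiff(1)[OF v w] g(2)[OF w] by blast
        ultimately show "R (lift (\<lambda>s. wact g (w, s))) (lift (\<lambda>s. v (w, s)))"
          using rdu_indiff(2)[OF v w] trans V0_Vt0[OF section_in[OF v w]] Vt0_const
          unfolding indiff_def by metis
      qed
      moreover have "R v (const_act (\<gamma> k))"
        using trans[OF Rvu _ v u' Vt0_const] usec[OF w0] by (auto simp: indiff_def k_def)
      ultimately have "R (wact g) (const_act (\<gamma> k))" using trans wact_in[OF wg] v Vt0_const by blast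
      then obtain k' where "k \<le> k'" "accept (\<lambda>w. g w - k')" using accept_excess[OF wg krng] by blast
      then have "k \<le> ?L g" using Lpos[of "\<lambda>w. g w - k'"] Ldiff[OF g(1), of k'] by simp
      also have "?L g = ?L (\<lambda>w. g w - \<delta>) + \<delta>" using Ldiff[OF g(1)] by simp
      also have "?L (\<lambda>w. g w - \<delta>) \<le> E (rdu v)" unfolding Eset
      proof (rule cSup_upper)
        show "?L (\<lambda>w. g w - \<delta>) \<in> ?L ` {g. simple_function W g \<and> (\<forall>w\<in>space W. g w \<le> rdu v w)}"
          using g(1,2) by (intro imageI) (auto intro: simple_function_real_intros simp: diff_le_eq)
        have "?L f \<le> \<phi> K" if "simple_function W f" "\<And>w. w \<in> space W \<Longrightarrow> f w \<le> rdu v w" for f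
          using Lmono[of f "\<lambda>_. \<phi> K"] that K by (force simp: Lconst)
        then show "bdd_above (?L ` {g. simple_function W g \<and> (\<forall>w\<in>space W. g w \<le> rdu v w)})"
          by (intro bdd_aboveI[of _ "\<phi> K"]) auto
      qed
      finally show "k \<le> E (rdu v) + \<delta>" by simp
    qed
    ultimately show "R' v u" by (simp add: R'_def)
  qed
  ultimately show ?thesis unfolding ambiguity_averse_def by blast
qed

end

theorem proposition4p3:
  fixes W :: "'w measure" and P :: "'s measure" and R :: "('w, 's) pref"
  assumes "space W \<noteq> {}"
    and "prob_space P" and "nonatomic P" and "supports_uniform P"
    and "A1 W P R" and "A2 W P R" and "A3 W P R" and "A4 W P R"
    and "A5 W P R" and "A6 W P R" and "A7 W P R" and "A8 W P R"
  shows "ambiguity_averse W P R"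
proof -
  interpret prob_space P by fact
  interpret ambiguity_preference P W R using assms by unfold_locales
  show ?thesis by (rule ambiguity_averse)
qed

end
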